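(* Assume (A0)–(A3) as in the context, and let $N_t:=\max\{n\in\mathbb{N}:\tau_n\le t\}$. (i) If $-1<r\le1$ and (M$_p$) holds with some $p>2$, then for any $\varepsilon>0$, a.s., for all but finitely many $t$, $$t^{\frac{1+r}{2}}(\log t)^{-3-r-\varepsilon}\le N_t\le t^{\frac{1+r}{2}}(\log t)^{1+\varepsilon}.$$ (ii) If $r>1$ and (M$_p$) holds with some $p>1+r$, then a.s. $t^{-1}N_t\to 1/\mathbb{E}[\eta_1]\in(0,\infty)$ as $t\to\infty$.
   Context: $\mathbb{N}=\{1,2,\dots\}$. (A0): $\mathbb{S}$ is a locally finite (every bounded set meets it in finitely many points), unbounded subset of $[0,\infty)$ with $0\in\mathbb{S}$; $(X_t)_{t\in\mathbb{N}}$ is an $\mathbb{S}$-valued process adapted to a filtration $(\mathcal{F}_t)_{t\in\mathbb{N}}$ with $\mathbb{P}[X_1=0]=1$. (A1): for each $x,y\in\mathbb{S}$ there exist $m(x,y)\in\mathbb{N}$, $\varphi(x,y)>0$ with $\mathbb{P}[X_{t+m(X_t,y)}=y\mid\mathcal{F}_t]\ge\varphi(X_t,y)$ a.s. for all $t$. Write $\Delta_t:=X_{t+1}-X_t$. (A2): there are $c\in\mathbb{R}$, $s^2\in(0,\infty)$ with, as $X_t\to\infty$, $\mathbb{E}[\Delta_t\mid\mathcal{F}_t]=cX_t^{-1}+o(X_t^{-1}(\log X_t)^{-1})$ and $\mathbb{E}[\Delta_t^2\mid\mathcal{F}_t]=s^2+o((\log X_t)^{-1})$ a.s., where the implicit constants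 in $o(\cdot)$ are non-random and uniform in $t$ and in the sample point. Set $r:=-2c/s^2$. Excursions: $\tau_0:=1$, $\tau_n:=\min\{t>\tau_{n-1}:X_t=0\}$ ($\min\emptyset=\infty$), $\eta_n:=\tau_n-\tau_{n-1}$, $\mathcal{E}_n:=(X_t)_{\tau_{n-1}\le t\le\tau_n-1}$, $N:=\min\{n\in\mathbb{N}:\tau_n=\infty\}$. (A3): (a) on $\{N=\infty\}$, $(\mathcal{E}_n)_{n\in\mathbb{N}}$ is i.i.d.; (b) $\mathbb{P}[\eta_{n+1}<\infty\mid\tau_n<\infty]=\mathbb{P}[\eta_1<\infty]$ for all $n$. (M$_p$): there exist $\delta>0$, $C<\infty$ with $\mathbb{E}[|\Delta_t|^p\mid\mathcal{F}_t]\le C(1+X_t)^{p-2-\delta}$ a.s. for all $t$. *)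

theory Defs
  imports "HOL-Probability.Probability" "HOL-Library.Extended_Nat"
begin

fun tau :: "(nat \<Rightarrow> 'a \<Rightarrow> real) \<Rightarrow> nat \<Rightarrow> 'a \<Rightarrow> enat" where
  "tau X 0 \<omega> = 1"
| "tau X (Suc n) \<omega> =
     (case tau X n \<omega> of
        \<infinity> \<Rightarrow> \<infinity>
      | enat k \<Rightarrow> (if \<exists>t>k. X t \<omega> = 0 then enat (LEAST t. t > k \<and> X t \<omega> = 0) else \<infinity>))"

definition eta :: "(nat \<Rightarrow> 'a \<Rightarrow> real) \<Rightarrow> nat \<Rightarrow> 'a \<Rightarrow> enat" where
  "eta X n \<omega> = tau X n \<omega> - tau X (n - 1) \<omega>"

text \<open>The n-th excursion (n \<ge> 1): the finite path (X t) for tau (n-1) \<le> t \<le> tau n - 1,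
  represented as a list; it is only meaningful when tau n is finite.\<close>
definition excursion :: "(nat \<Rightarrow> 'a \<Rightarrow> real) \<Rightarrow> nat \<Rightarrow> 'a \<Rightarrow> real list" where
  "excursion X n \<omega> =
     (case (tau X (n - 1) \<omega>, tau X n \<omega>) of
        (enat a, enat b) \<Rightarrow> map (\<lambda>t. X t \<omega>) [a..<b]
      | _ \<Rightarrow> [])"

definition Nexc :: "(nat \<Rightarrow> 'a \<Rightarrow> real) \<Rightarrow> 'a \<Rightarrow> enat" where
  "Nexc X \<omega> = (if \<exists>n\<ge>1. tau X n \<omega> = \<infinity> then enat (LEAST n. n \<ge> 1 \<and> tau X n \<omega> = \<infinity>) else \<infinity>)"

definition Ncount :: "(nat \<Rightarrow> 'a \<Rightarrow> real) \<Rightarrow> nat \<Rightarrow> 'a \<Rightarrow> nat" where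
  "Ncount X t \<omega> = Max {n. n \<ge> 1 \<and> tau X n \<omega> \<le> enat t}"

definition moment_cond :: "'a measure \<Rightarrow> (nat \<Rightarrow> 'a measure) \<Rightarrow> (nat \<Rightarrow> 'a \<Rightarrow> real) \<Rightarrow> real \<Rightarrow> bool" where
  "moment_cond M F X p \<longleftrightarrow>
     (\<exists>\<delta>>0. \<exists>C::real. \<forall>t\<ge>1. AE \<omega> in M.
        nn_cond_exp M (F t) (\<lambda>\<omega>'. ennreal (\<bar>X (Suc t) \<omega>' - X t \<omega>'\<bar> powr p)) \<omega>
          \<le> ennreal (C * (1 + X t \<omega>) powr (p - 2 - \<delta>)))"

end

theory Submission
  imports Defs "HOL-Real_Asymp.Real_Asymp"
begin

text \<open>
  Put \<open>a = 1 + r\<close>. The functions \<open>y\<^sup>a (log y)\<^sup>g\<close> are, for large \<open>y\<close>, strict supersolutions of the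
  one-step drift when \<open>g < 0\<close> and strict subsolutions when \<open>g > 0\<close>; the logarithm is what beats the error
  terms in (A2), and (M\<open>\<^sub>p\<close>) makes the Taylor remainder polynomially smaller.

  Let \<open>L\<^sub>t\<close> be the event that the first excursion is still running at time \<open>t\<close>. Summing the drift of
  \<open>(y / log y)\<^sup>a\<close> over the events \<open>L\<^sub>t\<close>, and bounding the time spent near \<open>0\<close> by (A1), gives
  \<open>E min(\<eta>\<^sub>1, T) = \<Sum>\<^sub>t P(L\<^sub>t) \<le> K T\<^bsup>1 - a/2\<^esup> (log T)\<^bsup>1 + a\<^esup>\<close>: a time \<open>t \<le> T\<close> either has \<open>X\<^sub>t \<ge> \<surd>T\<close>,
  where the function is large, or \<open>X\<^sub>t < \<surd>T\<close>, where its drift is large. In particular the process is recurrent. Conversely, \<open>y\<^sup>a log y\<close> shows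
  that the first excursion reaches height \<open>x\<close> with probability at least of order \<open>1 / (x\<^sup>a log x)\<close>, and from there
  it survives a further time of order \<open>x\<^sup>2\<close> with probability at least one half.

  As the excursions are i.i.d., Markov's inequality for \<open>\<Sum>\<^sub>i min(\<eta>\<^sub>i, t)\<close> bounds \<open>\<tau>\<^sub>n\<close> from above,
  independence of the events \<open>\<eta>\<^sub>i < t\<close> bounds it from below, and Borel-Cantelli along powers of two gives (i). For \<open>r > 1\<close> the function \<open>y\<^sup>2\<close>
  gives \<open>E \<eta>\<^sub>1 < \<infinity>\<close>, and (ii) is the renewal form of the strong law of large numbers.
\<close>

section \<open>Powers times powers of the logarithm\<close>

definition powr_ln :: "real \<Rightarrow> real \<Rightarrow> real \<Rightarrow> real" where
  "powr_ln a g y = y powr a * ln y powr g"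

fun powr_ln_deriv :: "nat \<Rightarrow> real \<Rightarrow> real \<Rightarrow> real \<Rightarrow> real" where
  "powr_ln_deriv 0 a g y = powr_ln a g y"
| "powr_ln_deriv (Suc n) a g y =
     a * powr_ln_deriv n (a - 1) g y + g * powr_ln_deriv n (a - 1) (g - 1) y"

lemma powr_ln_nonneg [simp]: "0 \<le> powr_ln a g y"
  by (simp add: powr_ln_def)

lemma powr_ln_pos: "y > 1 \<Longrightarrow> 0 < powr_ln a g y"
  by (simp add: powr_ln_def)

lemma measurable_powr_ln [measurable]: "powr_ln a g \<in> borel_measurable borel"
  unfolding powr_ln_def by measurable

lemma measurable_powr_ln_deriv [measurable]: "powr_ln_deriv n a g \<in> borel_measurable borel"
proof (induction n arbitrary: a g)
  case 0
  have "powr_ln_deriv 0 a g = powr_ln a g" by (rule ext) simp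
  then show ?case by simp
next
  case (Suc n)
  have "powr_ln_deriv (Suc n) a g =
      (\<lambda>y. a * powr_ln_deriv n (a - 1) g y + g * powr_ln_deriv n (a - 1) (g - 1) y)"
    by (rule ext) simp
  then show ?case using Suc by simp
qed

lemma has_real_derivative_powr_ln_deriv:
  assumes "y > 1"
  shows "(powr_ln_deriv n a g has_real_derivative powr_ln_deriv (Suc n) a g y) (at y)"
proof (induction n arbitrary: a g)
  case 0
  have eq: "powr_ln_deriv 0 a g = (\<lambda>y. y powr a * ln y powr g)"
    by (rule ext) (simp add: powr_ln_def)
  have "((\<lambda>y. y powr a) has_real_derivative a * y powr (a - 1)) (at y)"
    using assms by (intro has_real_derivative_powr) auto
  moreover have "((\<lambda>y. ln y powr g) has_real_derivative (g * ln y powr (g - 1)) * (1 / y)) (at y)"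
    using assms by (intro DERIV_chain2[where f = "\<lambda>z. z powr g"] has_real_derivative_powr)
      (auto intro!: derivative_eq_intros)
  ultimately have "((\<lambda>y. y powr a * ln y powr g) has_real_derivative
      a * y powr (a - 1) * ln y powr g + (g * ln y powr (g - 1)) * (1 / y) * y powr a) (at y)"
    by (rule DERIV_mult)
  moreover have "y powr a = y powr (a - 1) * y"
    using assms by (simp add: powr_diff)
  ultimately show ?case using assms unfolding eq
    by (simp add: powr_ln_def field_simps)
next
  case (Suc n)
  have eq: "powr_ln_deriv (Suc n) a g =
      (\<lambda>y. a * powr_ln_deriv n (a - 1) g y + g * powr_ln_deriv n (a - 1) (g - 1) y)"
    by (rule ext) simp
  show ?case unfolding eq
    using DERIV_add[OF DERIV_cmult[OF Suc.IH[of "a - 1" g], of a] DERIV_cmult[OF Suc.IH[of "a - 1" "g - 1"], of g]]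
    by simp
qed

lemma ln_ge_1: "y \<ge> 3 \<Longrightarrow> 1 \<le> ln (y::real)"
proof -
  assume "y \<ge> 3"
  then have "exp 1 \<le> y" using exp_le by linarith
  then show ?thesis using \<open>y \<ge> 3\<close> by (subst ln_ge_iff) auto
qed

lemma powr_ln_mono_exponent:
  assumes "y \<ge> 3" "a \<le> a'" "g \<le> g'"
  shows "powr_ln a g y \<le> powr_ln a' g' y"
  unfolding powr_ln_def using assms ln_ge_1[OF assms(1)] by (intro mult_mono powr_mono) auto

lemma powr_ln_deriv_bound:
  "\<exists>K\<ge>0. \<forall>y\<ge>3. \<bar>powr_ln_deriv n a g y\<bar> \<le> K * powr_ln (a - real n) g y"
proof (induction n arbitrary: a g)
  case 0
  show ?case by (intro exI[of _ 1]) auto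
next
  case (Suc n)
  obtain K1 where K1: "K1 \<ge> 0" "\<And>y. y \<ge> 3 \<Longrightarrow>
      \<bar>powr_ln_deriv n (a - 1) g y\<bar> \<le> K1 * powr_ln (a - 1 - real n) g y"
    using Suc[of "a - 1" g] by auto
  obtain K2 where K2: "K2 \<ge> 0" "\<And>y. y \<ge> 3 \<Longrightarrow>
      \<bar>powr_ln_deriv n (a - 1) (g - 1) y\<bar> \<le> K2 * powr_ln (a - 1 - real n) (g - 1) y"
    using Suc[of "a - 1" "g - 1"] by auto
  have "\<bar>powr_ln_deriv (Suc n) a g y\<bar> \<le> (\<bar>a\<bar> * K1 + \<bar>g\<bar> * K2) * powr_ln (a - real (Suc n)) g y"
    if "y \<ge> 3" for y
  proof -
    have "powr_ln (a - 1 - real n) (g - 1) y \<le> powr_ln (a - 1 - real n) g y"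
      using that by (intro powr_ln_mono_exponent) auto
    with K2 that have 2: "\<bar>powr_ln_deriv n (a - 1) (g - 1) y\<bar> \<le> K2 * powr_ln (a - 1 - real n) g y"
      by (meson mult_left_mono order_trans)
    have "\<bar>powr_ln_deriv (Suc n) a g y\<bar> \<le>
        \<bar>a\<bar> * \<bar>powr_ln_deriv n (a - 1) g y\<bar> + \<bar>g\<bar> * \<bar>powr_ln_deriv n (a - 1) (g - 1) y\<bar>"
      by (simp add: abs_mult[symmetric] abs_triangle_ineq)
    also have "\<dots> \<le> \<bar>a\<bar> * (K1 * powr_ln (a - 1 - real n) g y) + \<bar>g\<bar> * (K2 * powr_ln (a - 1 - real n) g y)"
      using K1(2)[OF that] 2 by (intro add_mono mult_left_mono) auto
    also have "\<dots> = (\<bar>a\<bar> * K1 + \<bar>g\<bar> * K2) * powr_ln (a - real (Suc n)) g y"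
      by (simp add: algebra_simps)
    finally show ?thesis .
  qed
  then show ?case using K1(1) K2(1) by (intro exI[of _ "\<bar>a\<bar> * K1 + \<bar>g\<bar> * K2"]) auto
qed

lemma powr_ln_le_powr:
  assumes "\<kappa> > 0"
  shows "\<exists>K\<ge>0. \<forall>y\<ge>3. \<forall>a. powr_ln a g y \<le> K * y powr (a + \<kappa>)"
proof -
  define G where "G = \<bar>g\<bar> + 1"
  have G: "G > 0" "g \<le> G" by (auto simp: G_def)
  have "powr_ln a g y \<le> (G / \<kappa>) powr G * y powr (a + \<kappa>)" if "y \<ge> 3" for y a
  proof -
    have "ln y \<le> y powr (\<kappa> / G) / (\<kappa> / G)"
      using that assms G by (intro ln_powr_bound) auto
    then have "ln y powr G \<le> (y powr (\<kappa> / G) / (\<kappa> / G)) powr G"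
      using that ln_ge_1[OF that] G by (intro powr_mono2) auto
    also have "\<dots> = (y powr (\<kappa> / G) * (G / \<kappa>)) powr G" by simp
    also have "\<dots> = (G / \<kappa>) powr G * y powr \<kappa>"
      using G assms that by (subst powr_mult) (auto simp: powr_powr)
    finally have "ln y powr g \<le> (G / \<kappa>) powr G * y powr \<kappa>"
      using powr_mono[OF G(2) ln_ge_1[OF that]] by linarith
    then have "y powr a * ln y powr g \<le> y powr a * ((G / \<kappa>) powr G * y powr \<kappa>)"
      by (intro mult_left_mono) auto
    then show ?thesis by (simp add: powr_ln_def powr_add algebra_simps)
  qed
  then show ?thesis by (intro exI[of _ "(G / \<kappa>) powr G"]) auto
qed

lemma powr_local_bound:
  fixes y \<xi> b :: real
  assumes "0 < y" "y / 2 \<le> \<xi>" "\<xi> \<le> 3 * y / 2" "0 \<le> b" "b \<le> 3"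
  shows "\<xi> powr (b - 3) \<le> 8 * y powr (b - 3)"
proof -
  have "\<xi> powr (b - 3) \<le> (y / 2) powr (b - 3)"
    using assms by (intro powr_mono2') auto
  also have "\<dots> = y powr (b - 3) * 2 powr (3 - b)"
  proof -
    have "2 powr (3 - b) = inverse (2 powr (b - 3) :: real)"
      using powr_minus[of 2 "b - 3"] by (simp only: minus_diff_eq)
    moreover have "(y / 2) powr (b - 3) = y powr (b - 3) / 2 powr (b - 3)"
      by (rule powr_divide)
    ultimately show ?thesis by (simp only: divide_inverse)
  qed
  also have "2 powr (3 - b) \<le> (8::real)"
    using powr_mono[of "3 - b" 3 2] assms by simp
  then have "y powr (b - 3) * 2 powr (3 - b) \<le> y powr (b - 3) * 8"
    by (intro mult_left_mono) auto
  finally show ?thesis by simp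
qed

lemma taylor_remainder_bound:
  fixes f :: "nat \<Rightarrow> real \<Rightarrow> real" and G :: "real \<Rightarrow> real"
  assumes deriv: "\<And>m z. m < 3 \<Longrightarrow> z \<ge> 3 \<Longrightarrow> (f m has_real_derivative f (Suc m) z) (at z)"
    and bound: "\<And>m z. m \<le> 3 \<Longrightarrow> z \<ge> 3 \<Longrightarrow> \<bar>f m z\<bar> \<le> K * z powr (b - real m)"
    and b: "0 \<le> b" "b \<le> 3" "b \<le> p" and p: "2 \<le> p" and \<kappa>: "0 < \<kappa>" "\<kappa> \<le> 1"
    and growth: "\<And>z. z \<ge> 0 \<Longrightarrow> \<bar>G z\<bar> \<le> K * (1 + z) powr b"
    and y: "y \<ge> 6" "y powr \<kappa> \<ge> 2" "y + d \<ge> 0"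
    and local: "\<And>z. y / 2 \<le> z \<Longrightarrow> z \<le> 3 * y / 2 \<Longrightarrow> G z = f 0 z"
  shows "\<bar>G (y + d) - G y - f 1 y * d - f 2 y / 2 * d\<^sup>2\<bar>
    \<le> K * (3 powr p + 3) * (y powr (b - 2 - \<kappa>) * d\<^sup>2 + y powr (b - p + p * \<kappa>) * \<bar>d\<bar> powr p)"
proof -
  have K: "K \<ge> 0" using growth[of 0] by simp
  have y1: "y powr \<kappa> \<ge> 1" using y by simp
  have Gy: "G y = f 0 y" using y by (intro local) auto
  have y1\<kappa>: "y powr (1 - \<kappa>) = y / y powr \<kappa>" using y by (simp add: powr_diff)
  show ?thesis
  proof (cases "\<bar>d\<bar> \<le> y powr (1 - \<kappa>)")
    case True
    have half: "y powr (1 - \<kappa>) \<le> y / 2"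
      unfolding y1\<kappa> using y by (intro divide_left_mono) auto
    have d2: "\<bar>d\<bar> \<le> y / 2" using True half by simp
    have "\<bar>G (y + d) - G y - f 1 y * d - f 2 y / 2 * d\<^sup>2\<bar> \<le> K * 2 * (y powr (b - 2 - \<kappa>) * d\<^sup>2)"
    proof (cases "d = 0")
      case True then show ?thesis by simp
    next
      case False
      have "\<exists>t. (if y + d < y then y + d < t \<and> t < y else y < t \<and> t < y + d) \<and>
        f 0 (y + d) = (\<Sum>m<3. (f m y / fact m) * (y + d - y)^m) + (f 3 t / fact 3) * (y + d - y)^3"
        using y d2 False by (intro Taylor[where a = "y / 2" and b = "3 * y / 2"]) (auto intro!: deriv)
      then obtain t where t': "if y + d < y then y + d < t \<and> t < y else y < t \<and> t < y + d"
        and eq: "f 0 (y + d) = (\<Sum>m<3. (f m y / fact m) * d^m) + (f 3 t / fact 3) * d^3"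
        unfolding add_diff_cancel_left' by blast
      have t: "y / 2 \<le> t" "t \<le> 3 * y / 2"
        using t' d2 y by (auto split: if_splits)
      have G: "G (y + d) = f 0 (y + d)" using d2 by (intro local) auto
      have fact3: "(fact 3 :: real) = 6" by (simp add: fact_numeral)
      have "G (y + d) - G y - f 1 y * d - f 2 y / 2 * d\<^sup>2 = f 3 t / 6 * d^3"
        unfolding G eq Gy by (simp add: lessThan_Suc eval_nat_numeral fact3[unfolded numeral_3_eq_3])
      then have "\<bar>G (y + d) - G y - f 1 y * d - f 2 y / 2 * d\<^sup>2\<bar> = \<bar>f 3 t\<bar> / 6 * \<bar>d\<bar>^3"
        by (simp only: abs_mult abs_divide power_abs abs_numeral)
      also have "\<bar>d\<bar>^3 = \<bar>d\<bar> * d\<^sup>2" by (simp add: power3_eq_cube power2_eq_square)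
      also have "\<bar>f 3 t\<bar> / 6 * (\<bar>d\<bar> * d\<^sup>2) \<le> (K * (8 * y powr (b - 3))) / 6 * (y powr (1 - \<kappa>) * d\<^sup>2)"
      proof (intro mult_mono divide_right_mono)
        have "\<bar>f 3 t\<bar> \<le> K * t powr (b - 3)" using bound[of 3 t] t y by simp
        also have "\<dots> \<le> K * (8 * y powr (b - 3))"
          using t y b K by (intro mult_left_mono powr_local_bound) auto
        finally show "\<bar>f 3 t\<bar> \<le> K * (8 * y powr (b - 3))" .
      qed (use True K in auto)
      also have "\<dots> = K * (8 / 6) * (y powr (b - 3) * y powr (1 - \<kappa>) * d\<^sup>2)" by simp
      also have "y powr (b - 3) * y powr (1 - \<kappa>) = y powr (b - 2 - \<kappa>)"
        by (simp add: powr_add[symmetric] algebra_simps)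
      also have "K * (8 / 6) * (y powr (b - 2 - \<kappa>) * d\<^sup>2) \<le> K * 2 * (y powr (b - 2 - \<kappa>) * d\<^sup>2)"
        using K by (intro mult_right_mono mult_left_mono) auto
      finally show ?thesis .
    qed
    also have "\<dots> \<le> K * (3 powr p + 3) * (y powr (b - 2 - \<kappa>) * d\<^sup>2 + y powr (b - p + p * \<kappa>) * \<bar>d\<bar> powr p)"
    proof -
      have "2 \<le> 3 powr p + (3::real)" using powr_ge_zero[of 3 p] by linarith
      then show ?thesis using K by (intro mult_mono) auto
    qed
    finally show ?thesis .
  next
    case False
    define u v where "u = \<bar>d\<bar> / y" and "v = u * y powr \<kappa>"
    have u0: "u \<ge> 0" using y by (simp add: u_def)
    have v1: "v > 1"
      using False y unfolding v_def u_def y1\<kappa> by (simp add: field_simps)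
    have uv: "u \<le> v" unfolding v_def using y1 u0 by (simp add: mult_le_cancel_left1)
    have d: "\<bar>d\<bar> = y * u" using y by (simp add: u_def)
    have key: "y powr b * v powr p = y powr (b - p + p * \<kappa>) * \<bar>d\<bar> powr p"
    proof -
      have "v powr p = u powr p * y powr (p * \<kappa>)"
        unfolding v_def using u0 by (simp add: powr_mult powr_powr mult.commute)
      also have "u powr p = \<bar>d\<bar> powr p / y powr p"
        unfolding u_def using y by (simp add: powr_divide)
      finally show ?thesis by (simp add: powr_add powr_diff)
    qed
    have vp: "v \<le> v powr p" "v\<^sup>2 \<le> v powr p" "1 \<le> v powr p"
    proof -
      show "v \<le> v powr p" using powr_mono[of 1 p v] v1 p by simp
      show "v\<^sup>2 \<le> v powr p" using powr_mono[of 2 p v] v1 p by simp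
      show "1 \<le> v powr p" using powr_mono[of 0 p v] v1 p by simp
    qed
    have G1: "\<bar>G (y + d)\<bar> \<le> K * (y powr b * (3 powr p * v powr p))"
    proof -
      have "\<bar>G (y + d)\<bar> \<le> K * (1 + (y + d)) powr b" using y by (intro growth) auto
      also have "(1 + (y + d)) powr b \<le> (y * (3 * v)) powr b"
      proof (intro powr_mono2)
        have "1 + (y + d) \<le> y + y + y * u" using d y by linarith
        also have "\<dots> = y * (2 + u)" by (simp add: algebra_simps)
        also have "\<dots> \<le> y * (3 * v)" using uv v1 y by (intro mult_left_mono) auto
        finally show "1 + (y + d) \<le> y * (3 * v)" .
      qed (use b y in auto)
      also have "\<dots> = y powr b * (3 * v) powr b" using y v1 by (simp add: powr_mult)
      also have "(3 * v) powr b \<le> (3 * v) powr p" using v1 b by (intro powr_mono) auto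
      also have "\<dots> = 3 powr p * v powr p" using v1 by (simp add: powr_mult)
      finally show ?thesis using K by (simp add: mult_left_mono)
    qed
    have G2: "\<bar>G y\<bar> \<le> K * (y powr b * v powr p)"
    proof -
      have "\<bar>G y\<bar> \<le> K * (y powr b * 1)" unfolding Gy using bound[of 0 y] y by simp
      also have "\<dots> \<le> K * (y powr b * v powr p)" using K vp by (intro mult_left_mono) auto
      finally show ?thesis .
    qed
    have G3: "\<bar>f 1 y * d\<bar> \<le> K * (y powr b * v powr p)"
    proof -
      have "\<bar>f 1 y * d\<bar> \<le> (K * y powr (b - 1)) * (y * u)"
        using bound[of 1 y] y u0 by (simp add: abs_mult d mult_right_mono)
      also have "\<dots> = K * (y powr b * u)" using y by (simp add: powr_diff)
      also have "\<dots> \<le> K * (y powr b * v powr p)" using K vp uv by (intro mult_left_mono) auto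
      finally show ?thesis .
    qed
    have G4: "\<bar>f 2 y / 2 * d\<^sup>2\<bar> \<le> K * (y powr b * v powr p)"
    proof -
      have "d\<^sup>2 = (y * u)\<^sup>2" using d by (metis power2_abs)
      then have "\<bar>f 2 y / 2 * d\<^sup>2\<bar> \<le> (K * y powr (b - 2)) * (y * u)\<^sup>2"
        using bound[of 2 y] y mult_right_mono[of "\<bar>f 2 y\<bar> / 2" "K * y powr (b - 2)" "(y * u)\<^sup>2"]
        by (simp add: abs_mult)
      also have "\<dots> = K * (y powr b * u\<^sup>2)"
        using y by (simp add: powr_diff power_mult_distrib)
      also have "u\<^sup>2 \<le> v\<^sup>2" using uv u0 by (intro power_mono) auto
      then have "K * (y powr b * u\<^sup>2) \<le> K * (y powr b * v powr p)"
        using K vp by (intro mult_left_mono) auto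
      finally show ?thesis .
    qed
    have "\<bar>G (y + d) - G y - f 1 y * d - f 2 y / 2 * d\<^sup>2\<bar>
        \<le> K * (y powr b * (3 powr p * v powr p)) + 3 * (K * (y powr b * v powr p))"
      using G1 G2 G3 G4 by linarith
    also have "\<dots> = K * (3 powr p + 3) * (y powr b * v powr p)" by (simp add: algebra_simps)
    also have "\<dots> \<le> K * (3 powr p + 3) * (y powr (b - 2 - \<kappa>) * d\<^sup>2 + y powr b * v powr p)"
      using K by (intro mult_left_mono) auto
    finally show ?thesis unfolding key .
  qed
qed

lemma powr_ln_div_ln: "y > 1 \<Longrightarrow> powr_ln a g y / ln y = powr_ln a (g - 1) y"
  by (simp add: powr_ln_def powr_diff)

lemma powr_ln_div_self: "y > 1 \<Longrightarrow> powr_ln a g y / y = powr_ln (a - 1) g y"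
  by (simp add: powr_ln_def powr_diff)

lemma powr_ln_generator:
  assumes "y > 1" "c = - (a - 1) * s2 / 2"
  shows "powr_ln_deriv 1 a g y * (c / y) + powr_ln_deriv 2 a g y / 2 * s2 =
    s2 / 2 * g * (a * powr_ln (a - 2) (g - 1) y + (g - 1) * powr_ln (a - 2) (g - 2) y)"
proof -
  have "powr_ln (a - 1) g y / y = powr_ln (a - 2) g y"
       "powr_ln (a - 1) (g - 1) y / y = powr_ln (a - 2) (g - 1) y"
    using powr_ln_div_self[OF assms(1)] by auto
  then have 1: "powr_ln_deriv 1 a g y / y = a * powr_ln (a - 2) g y + g * powr_ln (a - 2) (g - 1) y"
    by (simp add: add_divide_distrib times_divide_eq_right[symmetric] del: times_divide_eq_right)
  have 2: "powr_ln_deriv 2 a g y =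
      a * ((a - 1) * powr_ln (a - 2) g y + g * powr_ln (a - 2) (g - 1) y)
      + g * ((a - 1) * powr_ln (a - 2) (g - 1) y + (g - 1) * powr_ln (a - 2) (g - 2) y)"
    by (simp add: numeral_2_eq_2)
  have "powr_ln_deriv 1 a g y * (c / y) = c * (powr_ln_deriv 1 a g y / y)"
    by (metis times_divide_eq_right mult.commute)
  then show ?thesis
    unfolding 1 2 by (simp add: assms(2) algebra_simps add_divide_distrib diff_divide_distrib)
qed

lemma powr_ln_drift:
  fixes a g c s2 p \<delta> C K \<kappa> :: real
  assumes "a > 0" "s2 > 0" "g \<noteq> 0" "c = - (a - 1) * s2 / 2" "\<sigma> = - sgn g"
    and "\<kappa> > 0" "(p + 1) * \<kappa> \<le> \<delta>" "C \<ge> 0" "K \<ge> 0"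
  defines "h1 \<equiv> \<lambda>y. \<sigma> * powr_ln_deriv 1 a g y"
    and "h2 \<equiv> \<lambda>y. \<sigma> * powr_ln_deriv 2 a g y / 2 + K * y powr (a - 2 - \<kappa> / 2)"
    and "h3 \<equiv> \<lambda>y. K * y powr (a + \<kappa> / 2 - p + p * \<kappa>)"
  shows "\<exists>\<epsilon>>0. \<exists>x0. \<forall>y\<ge>x0.
    h1 y * (c / y) + h2 y * s2 + \<bar>h1 y\<bar> * (\<epsilon> / (y * ln y)) + \<bar>h2 y\<bar> * (\<epsilon> / ln y)
      + h3 y * (C * (1 + y) powr (p - 2 - \<delta>)) + s2 * \<bar>g\<bar> * a / 8 * powr_ln (a - 2) (g - 1) y \<le> 0"
proof -
  obtain K1 where K1: "K1 \<ge> 0" "\<And>y. y \<ge> 3 \<Longrightarrow> \<bar>powr_ln_deriv 1 a g y\<bar> \<le> K1 * powr_ln (a - 1) g y"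
    using powr_ln_deriv_bound[of 1 a g] by auto
  obtain K2 where K2: "K2 \<ge> 0" "\<And>y. y \<ge> 3 \<Longrightarrow> \<bar>powr_ln_deriv 2 a g y\<bar> \<le> K2 * powr_ln (a - 2) g y"
    using powr_ln_deriv_bound[of 2 a g] by auto
  define q where "q = s2 * \<bar>g\<bar> * a / 8"
  have q: "q > 0" using assms by (simp add: q_def)
  define \<epsilon> where "\<epsilon> = q / (K1 + K2 + 1)"
  have \<epsilon>: "\<epsilon> > 0" "\<epsilon> * (K1 + K2) \<le> q"
    using q K1 K2 by (auto simp: \<epsilon>_def field_simps)
  define K3 where "K3 = K * s2 + K * \<epsilon> + K * (C * 2 powr \<bar>p - 2 - \<delta>\<bar>)"
  have K3: "K3 \<ge> 0" using assms \<epsilon> by (simp add: K3_def)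
  have "\<forall>\<^sub>F y in at_top. s2 / 2 * \<bar>g\<bar> * \<bar>g - 1\<bar> / ln y < q"
  proof -
    have "((\<lambda>y. s2 / 2 * \<bar>g\<bar> * \<bar>g - 1\<bar> / ln y) \<longlongrightarrow> 0) at_top" by real_asymp
    then show ?thesis using q by (rule order_tendstoD)
  qed
  moreover have "\<forall>\<^sub>F y in at_top. K3 * (y powr (-\<kappa> / 2) * ln y powr (1 - g)) < q"
  proof -
    have "((\<lambda>y. K3 * (y powr (-\<kappa> / 2) * ln y powr (1 - g))) \<longlongrightarrow> K3 * 0) at_top"
      using assms by (intro tendsto_mult tendsto_const) real_asymp
    then show ?thesis using q by (intro order_tendstoD) auto
  qed
  ultimately have "\<forall>\<^sub>F y in at_top. y \<ge> 3 \<and> s2 / 2 * \<bar>g\<bar> * \<bar>g - 1\<bar> / ln y < q \<and>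
      K3 * (y powr (-\<kappa> / 2) * ln y powr (1 - g)) < q"
    by (intro eventually_conj eventually_ge_at_top)
  then obtain x0 where x0: "\<And>y. y \<ge> x0 \<Longrightarrow> y \<ge> 3 \<and> s2 / 2 * \<bar>g\<bar> * \<bar>g - 1\<bar> / ln y < q \<and>
      K3 * (y powr (-\<kappa> / 2) * ln y powr (1 - g)) < q"
    unfolding eventually_at_top_linorder by blast
  have "h1 y * (c / y) + h2 y * s2 + \<bar>h1 y\<bar> * (\<epsilon> / (y * ln y)) + \<bar>h2 y\<bar> * (\<epsilon> / ln y)
      + h3 y * (C * (1 + y) powr (p - 2 - \<delta>)) + q * powr_ln (a - 2) (g - 1) y \<le> 0"
    if "y \<ge> x0" for y
  proof -
    define P where "P = powr_ln (a - 2) (g - 1) y"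
    define W where "W = y powr (a - 2 - \<kappa> / 2)"
    have y: "y \<ge> 3" "ln y \<ge> 1" using x0[OF that] ln_ge_1 by auto
    have P: "P > 0" using y by (simp add: P_def powr_ln_pos)
    have W: "W \<ge> 0" by (simp add: W_def)
    have \<sigma>: "\<bar>\<sigma>\<bar> = 1" "\<sigma> * g = - \<bar>g\<bar>"
      using assms by (auto simp: abs_sgn_eq abs_sgn)
    have P1: "powr_ln (a - 1) g y / (y * ln y) = P"
    proof -
      have "powr_ln (a - 1) g y / (y * ln y) = powr_ln (a - 1) g y / y / ln y" by simp
      also have "\<dots> = P"
        using y powr_ln_div_self[of y "a - 1" g] powr_ln_div_ln[of y "a - 2" g]
        by (simp add: P_def)
      finally show ?thesis .
    qed
    have P2: "powr_ln (a - 2) g y / ln y = P"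
      using y by (simp add: P_def powr_ln_div_ln)
    have P3: "powr_ln (a - 2) (g - 2) y = P / ln y"
      using y powr_ln_div_ln[of y "a - 2" "g - 1"] by (simp add: P_def)
    have "h1 y * (c / y) + \<sigma> * powr_ln_deriv 2 a g y / 2 * s2 =
        \<sigma> * (powr_ln_deriv 1 a g y * (c / y) + powr_ln_deriv 2 a g y / 2 * s2)"
      by (simp add: h1_def algebra_simps)
    also have "\<dots> = \<sigma> * (s2 / 2 * g * (a * P + (g - 1) * (P / ln y)))"
      using y assms by (subst powr_ln_generator) (auto simp: P_def[symmetric] P3[symmetric])
    also have "\<dots> = (\<sigma> * g) * (s2 / 2) * (a * P + (g - 1) * (P / ln y))" by (simp only: mult_ac)
    also have "\<dots> = - (4 * q * P) + s2 / 2 * \<bar>g\<bar> * (1 - g) / ln y * P"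
    proof -
      define Q where "Q = P / ln y"
      have e1: "s2 / 2 * \<bar>g\<bar> * (1 - g) / ln y * P = s2 / 2 * \<bar>g\<bar> * (1 - g) * Q"
        unfolding Q_def by (metis times_divide_eq_left times_divide_eq_right)
      have e2: "4 * q * P = s2 / 2 * \<bar>g\<bar> * a * P" by (simp add: q_def)
      show ?thesis unfolding \<sigma> e1 e2 Q_def[symmetric] by (simp add: algebra_simps)
    qed
    also have "\<dots> \<le> - (4 * q * P) + s2 / 2 * \<bar>g\<bar> * \<bar>g - 1\<bar> / ln y * P"
      using P y assms by (intro add_left_mono mult_right_mono divide_right_mono mult_left_mono) auto
    also have "\<dots> \<le> - (4 * q * P) + q * P"
      using P x0[OF that] by (intro add_left_mono mult_right_mono) auto
    finally have T1: "h1 y * (c / y) + \<sigma> * powr_ln_deriv 2 a g y / 2 * s2 \<le> - 3 * q * P"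
      by (simp add: algebra_simps)
    have T2: "\<bar>h1 y\<bar> * (\<epsilon> / (y * ln y)) \<le> \<epsilon> * K1 * P"
    proof -
      have "\<bar>h1 y\<bar> * (\<epsilon> / (y * ln y)) \<le> (K1 * powr_ln (a - 1) g y) * (\<epsilon> / (y * ln y))"
        using y \<epsilon> K1(2)[of y] by (intro mult_right_mono) (auto simp: h1_def abs_mult \<sigma>)
      also have "\<dots> = \<epsilon> * K1 * (powr_ln (a - 1) g y / (y * ln y))" by simp
      finally show ?thesis unfolding P1 .
    qed
    have T3: "\<bar>h2 y\<bar> * (\<epsilon> / ln y) \<le> \<epsilon> * K2 * P + K * \<epsilon> * W"
    proof -
      have "\<bar>h2 y\<bar> \<le> \<bar>\<sigma> * powr_ln_deriv 2 a g y / 2\<bar> + \<bar>K * W\<bar>"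
        unfolding h2_def W_def by (rule abs_triangle_ineq)
      also have "\<dots> = \<bar>powr_ln_deriv 2 a g y\<bar> / 2 + K * W"
        using assms W by (simp add: abs_mult \<sigma>)
      also have "\<dots> \<le> K2 * powr_ln (a - 2) g y + K * W"
        using K2(2)[of y] y by linarith
      finally have "\<bar>h2 y\<bar> * (\<epsilon> / ln y) \<le> (K2 * powr_ln (a - 2) g y + K * W) * (\<epsilon> / ln y)"
        using y \<epsilon> by (intro mult_right_mono) auto
      also have "\<dots> = \<epsilon> * K2 * (powr_ln (a - 2) g y / ln y) + K * \<epsilon> * W / ln y"
        by (simp add: algebra_simps add_divide_distrib)
      also have "K * \<epsilon> * W / ln y \<le> K * \<epsilon> * W / 1"
        using y \<epsilon> assms W by (intro divide_left_mono) auto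
      finally show ?thesis unfolding P2 by simp
    qed
    have T4: "h3 y * (C * (1 + y) powr (p - 2 - \<delta>)) \<le> K * (C * 2 powr \<bar>p - 2 - \<delta>\<bar>) * W"
    proof -
      have "(1 + y) powr (p - 2 - \<delta>) \<le> 2 powr \<bar>p - 2 - \<delta>\<bar> * y powr (p - 2 - \<delta>)"
      proof (cases "p - 2 - \<delta> \<ge> 0")
        case True
        then have "(1 + y) powr (p - 2 - \<delta>) \<le> (2 * y) powr (p - 2 - \<delta>)"
          using y by (intro powr_mono2) auto
        then show ?thesis using True y by (simp add: powr_mult)
      next
        case False
        then have "(1 + y) powr (p - 2 - \<delta>) \<le> 1 * y powr (p - 2 - \<delta>)"
          using y powr_mono2'[of "p - 2 - \<delta>" y "1 + y"] by simp
        also have "\<dots> \<le> 2 powr \<bar>p - 2 - \<delta>\<bar> * y powr (p - 2 - \<delta>)"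
          by (intro mult_right_mono ge_one_powr_ge_zero) auto
        finally show ?thesis .
      qed
      then have "h3 y * (C * (1 + y) powr (p - 2 - \<delta>)) \<le>
          h3 y * (C * (2 powr \<bar>p - 2 - \<delta>\<bar> * y powr (p - 2 - \<delta>)))"
        using assms by (intro mult_left_mono) (auto simp: h3_def)
      also have "\<dots> = K * (C * 2 powr \<bar>p - 2 - \<delta>\<bar>) * (y powr (a + \<kappa> / 2 - p + p * \<kappa>) * y powr (p - 2 - \<delta>))"
        by (simp add: h3_def)
      also have "y powr (a + \<kappa> / 2 - p + p * \<kappa>) * y powr (p - 2 - \<delta>) =
          y powr (a - 2 + \<kappa> / 2 + p * \<kappa> - \<delta>)"
        by (simp add: powr_add[symmetric] algebra_simps)
      also have "\<dots> \<le> W"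
        unfolding W_def using y assms by (intro powr_mono) (auto simp: algebra_simps)
      finally show ?thesis using assms by (simp add: mult_left_mono)
    qed
    have "K3 * W = K3 * (y powr (-\<kappa> / 2) * ln y powr (1 - g)) * P"
    proof -
      have "ln y powr (1 - g) * ln y powr (g - 1) = 1"
        using y by (simp add: powr_add[symmetric])
      then have "(y powr (-\<kappa> / 2) * ln y powr (1 - g)) * P = y powr (-\<kappa> / 2) * y powr (a - 2)"
        by (simp add: P_def powr_ln_def)
      also have "\<dots> = W" by (simp add: W_def powr_add[symmetric] algebra_simps)
      finally show ?thesis by simp
    qed
    also have "\<dots> \<le> q * P"
      using P x0[OF that] by (intro mult_right_mono) auto
    finally have T5: "K3 * W \<le> q * P" .
    have T6: "\<epsilon> * K1 * P + \<epsilon> * K2 * P \<le> q * P"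
      using mult_right_mono[OF \<epsilon>(2), of P] P by (simp add: algebra_simps)
    have "h2 y * s2 = \<sigma> * powr_ln_deriv 2 a g y / 2 * s2 + K * s2 * W"
      by (simp add: h2_def W_def algebra_simps)
    moreover have "K * s2 * W + K * \<epsilon> * W + K * (C * 2 powr \<bar>p - 2 - \<delta>\<bar>) * W = K3 * W"
      by (simp add: K3_def algebra_simps)
    ultimately show ?thesis
      using T1 T2 T3 T4 T5 T6 unfolding P_def[symmetric] by linarith
  qed
  then show ?thesis using \<epsilon>(1) unfolding q_def by blast
qed

lemma powr_ln_lyapunov:
  fixes a g c s2 p \<delta> C :: real
  assumes a: "a > 0" "a \<le> 2" and s2: "s2 > 0" and g: "g \<noteq> 0" and c: "c = - (a - 1) * s2 / 2"
    and p: "p > 2" and \<delta>: "\<delta> > 0" and C: "C \<ge> 0"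
  defines "\<sigma> \<equiv> - sgn g"
  shows "\<exists>\<epsilon>>0. \<exists>x1\<ge>3. \<exists>h1 h2 h3.
    h1 \<in> borel_measurable borel \<and> h2 \<in> borel_measurable borel \<and> h3 \<in> borel_measurable borel \<and>
    (\<forall>y. 0 \<le> h3 y) \<and>
    (\<forall>b. \<exists>H. \<forall>y\<in>{x1..b}. \<bar>h1 y\<bar> \<le> H \<and> \<bar>h2 y\<bar> \<le> H \<and> h3 y \<le> H) \<and>
    (\<forall>y\<ge>x1. h1 y * (c / y) + h2 y * s2 + \<bar>h1 y\<bar> * (\<epsilon> / (y * ln y)) + \<bar>h2 y\<bar> * (\<epsilon> / ln y)
      + h3 y * (C * (1 + y) powr (p - 2 - \<delta>)) + s2 * \<bar>g\<bar> * a / 8 * powr_ln (a - 2) (g - 1) y \<le> 0) \<and>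
    (\<forall>G y d. y \<ge> x1 \<longrightarrow> y + d \<ge> 0 \<longrightarrow> (\<forall>z. y / 2 \<le> z \<longrightarrow> z \<le> 3 * y / 2 \<longrightarrow> G z = powr_ln a g z) \<longrightarrow>
      (\<forall>z\<ge>0. \<bar>G z\<bar> \<le> powr_ln a g (max z 3)) \<longrightarrow>
      \<sigma> * G (y + d) \<le> \<sigma> * G y + h1 y * d + h2 y * d\<^sup>2 + h3 y * \<bar>d\<bar> powr p)"
proof -
  define \<kappa> where "\<kappa> = min 1 (min (p - 2) (\<delta> / (p + 1)))"
  have \<kappa>: "\<kappa> > 0" "\<kappa> \<le> 1" "\<kappa> \<le> p - 2" "(p + 1) * \<kappa> \<le> \<delta>"
  proof -
    show "\<kappa> > 0" using p \<delta> by (auto simp: \<kappa>_def)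
    have "\<kappa> \<le> \<delta> / (p + 1)" by (simp add: \<kappa>_def)
    then show "(p + 1) * \<kappa> \<le> \<delta>" using p by (simp add: field_simps)
  qed (auto simp: \<kappa>_def)
  define b where "b = a + \<kappa> / 2"
  have b: "0 \<le> b" "b \<le> 3" "b \<le> p" using a \<kappa> by (auto simp: b_def)
  obtain L where L: "L \<ge> 0" "\<And>y a. y \<ge> 3 \<Longrightarrow> powr_ln a g y \<le> L * y powr (a + \<kappa> / 2)"
    using powr_ln_le_powr[of "\<kappa> / 2" g] \<kappa> by auto
  have "\<exists>Q. \<forall>m. Q m \<ge> 0 \<and> (\<forall>y\<ge>3. \<bar>powr_ln_deriv m a g y\<bar> \<le> Q m * powr_ln (a - real m) g y)"
    using powr_ln_deriv_bound[of _ a g] by (intro choice) blast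
  then obtain Q where Q: "\<And>m. Q m \<ge> 0"
    "\<And>m y. y \<ge> 3 \<Longrightarrow> \<bar>powr_ln_deriv m a g y\<bar> \<le> Q m * powr_ln (a - real m) g y" by blast
  define K where "K = (\<Sum>m\<le>3. Q m * L) + L * 3 powr b"
  have K0: "K \<ge> 0" using Q L by (auto simp: K_def intro!: sum_nonneg add_nonneg_nonneg)
  have QK: "Q m * L \<le> K" if "m \<le> 3" for m
  proof -
    have "Q m * L \<le> (\<Sum>m\<le>3. Q m * L)" using that Q L by (intro member_le_sum) auto
    moreover have "0 \<le> L * 3 powr b" using L by simp
    ultimately show ?thesis by (simp add: K_def)
  qed
  have bound: "\<bar>powr_ln_deriv m a g z\<bar> \<le> K * z powr (b - real m)" if "m \<le> 3" "z \<ge> 3" for m z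
  proof -
    have "\<bar>powr_ln_deriv m a g z\<bar> \<le> Q m * (L * z powr (a - real m + \<kappa> / 2))"
      using Q(2)[OF that(2), of m] L(2)[OF that(2), of "a - real m"] Q(1)[of m]
      by (meson mult_left_mono order_trans)
    also have "\<dots> = (Q m * L) * z powr (b - real m)" by (simp add: b_def algebra_simps)
    also have "\<dots> \<le> K * z powr (b - real m)" using QK[OF that(1)] by (intro mult_right_mono) auto
    finally show ?thesis .
  qed
  define K' where "K' = K * (3 powr p + 3)"
  have K': "K' \<ge> 0" using K0 by (simp add: K'_def)
  define h1 h2 h3 where "h1 = (\<lambda>y. \<sigma> * powr_ln_deriv 1 a g y)"
    and "h2 = (\<lambda>y. \<sigma> * powr_ln_deriv 2 a g y / 2 + K' * y powr (a - 2 - \<kappa> / 2))"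
    and "h3 = (\<lambda>y. K' * y powr (a + \<kappa> / 2 - p + p * \<kappa>))"
  obtain \<epsilon> x0 where \<epsilon>: "\<epsilon> > 0" and x0: "\<And>y. y \<ge> x0 \<Longrightarrow>
    h1 y * (c / y) + h2 y * s2 + \<bar>h1 y\<bar> * (\<epsilon> / (y * ln y)) + \<bar>h2 y\<bar> * (\<epsilon> / ln y)
      + h3 y * (C * (1 + y) powr (p - 2 - \<delta>)) + s2 * \<bar>g\<bar> * a / 8 * powr_ln (a - 2) (g - 1) y \<le> 0"
    using powr_ln_drift[OF a(1) s2 g c refl \<kappa>(1) \<kappa>(4) C K'] unfolding h1_def h2_def h3_def \<sigma>_def by blast
  have "\<forall>\<^sub>F y in at_top. y powr \<kappa> \<ge> 2"
  proof -
    have "filterlim (\<lambda>y::real. y powr \<kappa>) at_top at_top" using \<kappa>(1) by real_asymp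
    then show ?thesis by (simp add: filterlim_at_top)
  qed
  then obtain x2 where x2: "\<And>y. y \<ge> x2 \<Longrightarrow> y powr \<kappa> \<ge> 2"
    unfolding eventually_at_top_linorder by blast
  define x1 where "x1 = max 6 (max x0 x2)"
  have \<sigma>: "\<bar>\<sigma>\<bar> = 1" using g by (simp add: \<sigma>_def abs_sgn_eq)
  have x1: "x1 \<ge> 3" by (simp add: x1_def)
  have meas: "h1 \<in> borel_measurable borel" "h2 \<in> borel_measurable borel" "h3 \<in> borel_measurable borel"
    unfolding h1_def h2_def h3_def by measurable
  have h3: "\<forall>y. 0 \<le> h3 y" using K' by (simp add: h3_def)
  have cont: "continuous_on {x1..B} (powr_ln_deriv m a g)" for m B
    by (rule DERIV_continuous_on, rule has_field_derivative_at_within,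
        rule has_real_derivative_powr_ln_deriv) (use x1 in auto)
  have loc: "\<exists>H. \<forall>y\<in>{x1..B}. \<bar>h1 y\<bar> \<le> H \<and> \<bar>h2 y\<bar> \<le> H \<and> h3 y \<le> H" for B
  proof -
    have bdd: "\<exists>H. \<forall>y\<in>{x1..B}. \<bar>h y\<bar> \<le> H" if "continuous_on {x1..B} h" for h :: "real \<Rightarrow> real"
      using compact_imp_bounded[OF compact_continuous_image[OF that compact_Icc]]
      unfolding bounded_iff by auto
    have "continuous_on {x1..B} h1" "continuous_on {x1..B} h2" "continuous_on {x1..B} h3"
      unfolding h1_def h2_def h3_def using x1 by (intro continuous_intros cont; auto)+
    from this[THEN bdd] obtain H1 H2 H3 where
      "\<forall>y\<in>{x1..B}. \<bar>h1 y\<bar> \<le> H1" "\<forall>y\<in>{x1..B}. \<bar>h2 y\<bar> \<le> H2" "\<forall>y\<in>{x1..B}. \<bar>h3 y\<bar> \<le> H3" by blast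
    then show ?thesis by (intro exI[of _ "max H1 (max H2 H3)"]) fastforce
  qed
  have tay: "\<sigma> * G (y + d) \<le> \<sigma> * G y + h1 y * d + h2 y * d\<^sup>2 + h3 y * \<bar>d\<bar> powr p"
    if y: "y \<ge> x1" "y + d \<ge> 0" and G: "\<forall>z. y / 2 \<le> z \<longrightarrow> z \<le> 3 * y / 2 \<longrightarrow> G z = powr_ln a g z"
      "\<forall>z\<ge>0. \<bar>G z\<bar> \<le> powr_ln a g (max z 3)" for G y d
  proof -
    have "\<bar>G (y + d) - G y - powr_ln_deriv 1 a g y * d - powr_ln_deriv 2 a g y / 2 * d\<^sup>2\<bar>
      \<le> K * (3 powr p + 3) * (y powr (b - 2 - \<kappa>) * d\<^sup>2 + y powr (b - p + p * \<kappa>) * \<bar>d\<bar> powr p)"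
    proof (rule taylor_remainder_bound[where f = "\<lambda>m. powr_ln_deriv m a g"])
      fix z :: real assume z: "z \<ge> 0"
      have "\<bar>G z\<bar> \<le> L * (max z 3) powr b"
        using G(2) z L(2)[of "max z 3" a] by (force simp: b_def)
      also have "(max z 3) powr b \<le> (3 * (1 + z)) powr b"
        using z b by (intro powr_mono2) auto
      also have "(3 * (1 + z)) powr b = 3 powr b * (1 + z) powr b" by (rule powr_mult)
      finally have "\<bar>G z\<bar> \<le> L * 3 powr b * (1 + z) powr b"
        using L by (simp add: mult_left_mono mult.assoc)
      also have "\<dots> \<le> K * (1 + z) powr b"
        using Q L by (intro mult_right_mono) (auto simp: K_def intro!: sum_nonneg)
      finally show "\<bar>G z\<bar> \<le> K * (1 + z) powr b" .
    next
      show "y powr \<kappa> \<ge> 2" using y by (intro x2) (simp add: x1_def)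
    qed (use y G b p \<kappa> bound in \<open>auto simp: x1_def simp del: powr_ln_deriv.simps(2)
        intro!: has_real_derivative_powr_ln_deriv\<close>)
    also have "\<dots> = K' * y powr (a - 2 - \<kappa> / 2) * d\<^sup>2 + h3 y * \<bar>d\<bar> powr p"
      by (simp add: K'_def h3_def b_def algebra_simps)
    finally have *: "\<bar>G (y + d) - G y - powr_ln_deriv 1 a g y * d - powr_ln_deriv 2 a g y / 2 * d\<^sup>2\<bar>
      \<le> K' * y powr (a - 2 - \<kappa> / 2) * d\<^sup>2 + h3 y * \<bar>d\<bar> powr p" .
    have "\<sigma> * (G (y + d) - G y - powr_ln_deriv 1 a g y * d - powr_ln_deriv 2 a g y / 2 * d\<^sup>2)
      \<le> \<bar>\<sigma> * (G (y + d) - G y - powr_ln_deriv 1 a g y * d - powr_ln_deriv 2 a g y / 2 * d\<^sup>2)\<bar>"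
      by (rule abs_ge_self)
    also have "\<dots> = \<bar>G (y + d) - G y - powr_ln_deriv 1 a g y * d - powr_ln_deriv 2 a g y / 2 * d\<^sup>2\<bar>"
      by (simp only: abs_mult \<sigma> mult_1)
    finally show ?thesis using * unfolding h1_def h2_def by (simp only: algebra_simps) (simp add: algebra_simps)
  qed
  have x0': "h1 y * (c / y) + h2 y * s2 + \<bar>h1 y\<bar> * (\<epsilon> / (y * ln y)) + \<bar>h2 y\<bar> * (\<epsilon> / ln y)
      + h3 y * (C * (1 + y) powr (p - 2 - \<delta>)) + s2 * \<bar>g\<bar> * a / 8 * powr_ln (a - 2) (g - 1) y \<le> 0"
    if "y \<ge> x1" for y
    using that by (intro x0) (simp add: x1_def)
  show ?thesis
    by (rule exI[of _ \<epsilon>], rule conjI, rule \<epsilon>, rule exI[of _ x1], rule conjI, rule x1,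
        rule exI[of _ h1], rule exI[of _ h2], rule exI[of _ h3], intro conjI meas h3)
      (use loc x0' tay in blast)+
qed

section \<open>One-step drift inequalities\<close>

lemma (in sigma_finite_subalgebra) real_cond_exp_nonneg_eq:
  assumes [measurable]: "g \<in> borel_measurable M" and "\<And>x. 0 \<le> g x"
  shows "AE x in M. real_cond_exp M F g x = enn2real (nn_cond_exp M F (\<lambda>x. ennreal (g x)) x)"
proof -
  have "(\<lambda>x. ennreal (- g x)) = (\<lambda>_. 0)"
    using assms(2) by (auto simp: ennreal_neg)
  moreover have "AE x in M. nn_cond_exp M F (\<lambda>_. 0) x = 0"
    using nn_cond_exp_F_meas[of "\<lambda>_. 0"] by auto
  ultimately show ?thesis by (auto simp: real_cond_exp_def)
qed

locale lamperti_process = prob_space M for M :: "'a measure" +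
  fixes F :: "nat \<Rightarrow> 'a measure" and X :: "nat \<Rightarrow> 'a \<Rightarrow> real" and S :: "real set"
    and c s2 p \<delta> C :: real and m :: "real \<Rightarrow> nat" and \<phi> :: "real \<Rightarrow> real"
  assumes S_nonneg: "S \<subseteq> {0..}" and S_zero: "0 \<in> S"
    and S_locfin: "finite {x\<in>S. x \<le> b}"
    and filt_sub: "t \<ge> 1 \<Longrightarrow> subalgebra M (F t)"
    and filt_mono: "1 \<le> s \<Longrightarrow> s \<le> t \<Longrightarrow> sets (F s) \<subseteq> sets (F t)"
    and adapted: "t \<ge> 1 \<Longrightarrow> X t \<in> borel_measurable (F t)"
    and S_valued: "t \<ge> 1 \<Longrightarrow> \<omega> \<in> space M \<Longrightarrow> X t \<omega> \<in> S"
    and start: "AE \<omega> in M. X 1 \<omega> = 0"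
    and return_pos: "x \<in> S \<Longrightarrow> m x \<ge> 1" "x \<in> S \<Longrightarrow> \<phi> x > 0"
    and return: "t \<ge> 1 \<Longrightarrow> AE \<omega> in M. real_cond_exp M (F t)
        (indicator {\<omega>'\<in>space M. X (t + m (X t \<omega>')) \<omega>' = 0} :: 'a \<Rightarrow> real) \<omega> \<ge> \<phi> (X t \<omega>)"
    and s2_pos: "s2 > 0"
    and drift: "\<epsilon> > 0 \<Longrightarrow> \<exists>x0. \<forall>t\<ge>1. AE \<omega> in M. X t \<omega> \<ge> x0 \<longrightarrow>
               nn_cond_exp M (F t) (\<lambda>\<omega>'. ennreal ((X (Suc t) \<omega>' - X t \<omega>') ^ 2)) \<omega> < \<top> \<and>
               \<bar>real_cond_exp M (F t) (\<lambda>\<omega>'. X (Suc t) \<omega>' - X t \<omega>') \<omega> - c / X t \<omega>\<bar>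
                  \<le> \<epsilon> / (X t \<omega> * ln (X t \<omega>)) \<and>
               \<bar>enn2real (nn_cond_exp M (F t) (\<lambda>\<omega>'. ennreal ((X (Suc t) \<omega>' - X t \<omega>') ^ 2)) \<omega>) - s2\<bar>
                  \<le> \<epsilon> / ln (X t \<omega>)"
    and p: "p > 2" and \<delta>: "\<delta> > 0" and C: "C \<ge> 0"
    and moment: "t \<ge> 1 \<Longrightarrow> AE \<omega> in M.
        nn_cond_exp M (F t) (\<lambda>\<omega>'. ennreal (\<bar>X (Suc t) \<omega>' - X t \<omega>'\<bar> powr p)) \<omega>
          \<le> ennreal (C * (1 + X t \<omega>) powr (p - 2 - \<delta>))"
begin

abbreviation moments_close :: "real \<Rightarrow> nat \<Rightarrow> 'a \<Rightarrow> bool" where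
  "moments_close \<epsilon> t \<omega> \<equiv>
     nn_cond_exp M (F t) (\<lambda>\<omega>'. ennreal ((X (Suc t) \<omega>' - X t \<omega>') ^ 2)) \<omega> < \<top> \<and>
     \<bar>real_cond_exp M (F t) (\<lambda>\<omega>'. X (Suc t) \<omega>' - X t \<omega>') \<omega> - c / X t \<omega>\<bar> \<le> \<epsilon> / (X t \<omega> * ln (X t \<omega>)) \<and>
     \<bar>enn2real (nn_cond_exp M (F t) (\<lambda>\<omega>'. ennreal ((X (Suc t) \<omega>' - X t \<omega>') ^ 2)) \<omega>) - s2\<bar> \<le> \<epsilon> / ln (X t \<omega>)"

lemma countable_S: "countable S"
proof -
  have "S = (\<Union>n::nat. {x\<in>S. x \<le> real n})" using real_arch_simple by auto
  also have "countable \<dots>" by (intro countable_UN countable_finite[OF S_locfin]) auto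
  finally show ?thesis .
qed

lemma subalg: "t \<ge> 1 \<Longrightarrow> sigma_finite_subalgebra M (F t)"
proof -
  assume "t \<ge> 1"
  then interpret finite_measure_subalgebra M "F t"
    by unfold_locales (rule filt_sub)
  show ?thesis by unfold_locales
qed

lemma space_F: "t \<ge> 1 \<Longrightarrow> space (F t) = space M"
  using filt_sub by (auto simp: subalgebra_def)

lemma sets_F: "t \<ge> 1 \<Longrightarrow> A \<in> sets (F t) \<Longrightarrow> A \<in> sets M"
  using filt_sub by (auto simp: subalgebra_def)

lemma sets_F_mono: "1 \<le> s \<Longrightarrow> s \<le> t \<Longrightarrow> A \<in> sets (F s) \<Longrightarrow> A \<in> sets (F t)"
  using filt_mono by blast

lemma X_meas_F: "1 \<le> s \<Longrightarrow> s \<le> t \<Longrightarrow> X s \<in> borel_measurable (F t)"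
  using adapted[of s] filt_mono[of s t] space_F[of s] space_F[of t]
  by (auto intro!: measurable_from_subalg[of "F t" "F s"] simp: subalgebra_def)

lemma X_meas: "1 \<le> t \<Longrightarrow> X t \<in> borel_measurable M"
  using measurable_from_subalg[OF filt_sub adapted] .

lemma X_nonneg: "1 \<le> t \<Longrightarrow> \<omega> \<in> space M \<Longrightarrow> 0 \<le> X t \<omega>"
  using S_valued S_nonneg by fastforce

lemma one_step_bounded:
  assumes t: "t \<ge> 1" and B: "B \<in> sets (F t)" and Bsub: "\<And>\<omega>. \<omega> \<in> B \<Longrightarrow> x1 \<le> X t \<omega> \<and> X t \<omega> \<le> b"
    and x1: "x1 \<ge> 3" and \<epsilon>: "\<epsilon> > 0"
    and dr: "AE \<omega> in M. X t \<omega> \<ge> x1 \<longrightarrow>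
               moments_close \<epsilon> t \<omega>"
    and [measurable]: "G \<in> borel_measurable borel" "h1 \<in> borel_measurable borel"
      "h2 \<in> borel_measurable borel" "h3 \<in> borel_measurable borel"
      "w \<in> borel_measurable borel" "d \<in> borel_measurable borel"
    and G0: "\<And>y. 0 \<le> G y" and h30: "\<And>y. 0 \<le> h3 y" and w0: "\<And>y. 0 \<le> w y" and d0: "\<And>y. 0 \<le> d y"
    and bnd: "\<And>y. x1 \<le> y \<Longrightarrow> y \<le> b \<Longrightarrow> \<bar>h1 y\<bar> \<le> H \<and> \<bar>h2 y\<bar> \<le> H \<and> h3 y \<le> H \<and> G y \<le> H \<and> w y \<le> H \<and> d y \<le> H"
    and tay: "\<And>y e. x1 \<le> y \<Longrightarrow> y \<le> b \<Longrightarrow> 0 \<le> y + e \<Longrightarrow> G (y + e) \<le> G y + h1 y * e + h2 y * e\<^sup>2 + h3 y * \<bar>e\<bar> powr p"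
    and gen: "\<And>y. x1 \<le> y \<Longrightarrow> y \<le> b \<Longrightarrow> h1 y * (c / y) + h2 y * s2 + \<bar>h1 y\<bar> * (\<epsilon> / (y * ln y)) + \<bar>h2 y\<bar> * (\<epsilon> / ln y)
      + h3 y * (C * (1 + y) powr (p - 2 - \<delta>)) + w y \<le> d y"
  shows "(\<integral>\<^sup>+\<omega>\<in>B. ennreal (G (X (Suc t) \<omega>) + w (X t \<omega>)) \<partial>M) \<le> (\<integral>\<^sup>+\<omega>\<in>B. ennreal (G (X t \<omega>) + d (X t \<omega>)) \<partial>M)"
proof -
  interpret sigma_finite_subalgebra M "F t" by (rule subalg[OF t])
  have [measurable]: "X t \<in> borel_measurable M" "X (Suc t) \<in> borel_measurable M"
    "X t \<in> borel_measurable (F t)" "B \<in> sets (F t)" "B \<in> sets M"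
    using X_meas X_meas_F t B sets_F by auto
  have Bspace: "\<omega> \<in> space M" if "\<omega> \<in> B" for \<omega>
    using that \<open>B \<in> sets M\<close> sets.sets_into_space by blast
  have H0: "0 \<le> H" if "\<omega> \<in> B" for \<omega> using bnd[of "X t \<omega>"] Bsub[OF that] by auto
  define D where "D = (\<lambda>\<omega>. X (Suc t) \<omega> - X t \<omega>)"
  have [measurable]: "D \<in> borel_measurable M" unfolding D_def by measurable
  define I where "I = (indicator B :: 'a \<Rightarrow> real)"
  have [measurable]: "I \<in> borel_measurable (F t)" "I \<in> borel_measurable M" unfolding I_def by measurable
  define \<mu> where "\<mu> = real_cond_exp M (F t) D"
  define v where "v = real_cond_exp M (F t) (\<lambda>\<omega>. (D \<omega>)\<^sup>2)"
  define q where "q = real_cond_exp M (F t) (\<lambda>\<omega>. \<bar>D \<omega>\<bar> powr p)"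
  have lnx: "ln y \<ge> 1" if "y \<ge> x1" for y using ln_ge_1[of y] x1 that by linarith
  let ?N2 = "nn_cond_exp M (F t) (\<lambda>\<omega>. ennreal ((D \<omega>)\<^sup>2))"
  let ?Np = "nn_cond_exp M (F t) (\<lambda>\<omega>. ennreal (\<bar>D \<omega>\<bar> powr p))"
  have AE1: "AE \<omega> in M. v \<omega> = enn2real (?N2 \<omega>)"
    unfolding v_def by (rule real_cond_exp_nonneg_eq) auto
  have AE2: "AE \<omega> in M. q \<omega> = enn2real (?Np \<omega>)"
    unfolding q_def by (rule real_cond_exp_nonneg_eq) auto
  define Cb where "Cb = C * (1 + b) powr \<bar>p - 2 - \<delta>\<bar>"
  have Cb: "C * (1 + y) powr (p - 2 - \<delta>) \<le> Cb" if "x1 \<le> y" "y \<le> b" for y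
  proof -
    have "(1 + y) powr (p - 2 - \<delta>) \<le> (1 + y) powr \<bar>p - 2 - \<delta>\<bar>"
      using that x1 by (intro powr_mono) auto
    also have "\<dots> \<le> (1 + b) powr \<bar>p - 2 - \<delta>\<bar>"
      using that x1 by (intro powr_mono2) auto
    finally show ?thesis unfolding Cb_def using C by (intro mult_left_mono)
  qed
  have fin2: "(\<integral>\<^sup>+\<omega>. ennreal (I \<omega> * (D \<omega>)\<^sup>2) \<partial>M) < \<infinity>"
  proof -
    have "(\<integral>\<^sup>+\<omega>. ennreal (I \<omega> * (D \<omega>)\<^sup>2) \<partial>M) = (\<integral>\<^sup>+\<omega>. ennreal (I \<omega>) * ennreal ((D \<omega>)\<^sup>2) \<partial>M)"
      by (intro nn_integral_cong) (simp add: ennreal_mult I_def)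
    also have "\<dots> = (\<integral>\<^sup>+\<omega>. ennreal (I \<omega>) * ?N2 \<omega> \<partial>M)"
      by (rule nn_cond_exp_intg[symmetric]) auto
    also have "\<dots> \<le> (\<integral>\<^sup>+\<omega>. ennreal (s2 + \<epsilon>) \<partial>M)"
    proof (rule nn_integral_mono_AE)
      show "AE \<omega> in M. ennreal (I \<omega>) * ?N2 \<omega> \<le> ennreal (s2 + \<epsilon>)"
        using dr[folded D_def]
      proof eventually_elim
        case (elim \<omega>)
        show ?case
        proof (cases "\<omega> \<in> B")
          case True
          then have xx: "x1 \<le> X t \<omega>" using Bsub by auto
          have N: "?N2 \<omega> = ennreal (enn2real (?N2 \<omega>))" using elim xx by (simp add: D_def)
          have "enn2real (?N2 \<omega>) \<le> s2 + \<epsilon> / ln (X t \<omega>)"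
            using elim xx unfolding D_def by (simp add: abs_le_iff)
          also have "\<epsilon> / ln (X t \<omega>) \<le> \<epsilon> / 1"
            using lnx[OF xx] \<epsilon> by (intro divide_left_mono) auto
          finally have "?N2 \<omega> \<le> ennreal (s2 + \<epsilon>)" by (subst N) (simp add: ennreal_leI)
          then show ?thesis using True by (simp add: I_def)
        qed (simp add: I_def)
      qed
    qed
    also have "\<dots> < \<infinity>" by (simp add: emeasure_space_1)
    finally show ?thesis .
  qed
  have finp: "(\<integral>\<^sup>+\<omega>. ennreal (I \<omega> * \<bar>D \<omega>\<bar> powr p) \<partial>M) < \<infinity>"
  proof -
    have "(\<integral>\<^sup>+\<omega>. ennreal (I \<omega> * \<bar>D \<omega>\<bar> powr p) \<partial>M) = (\<integral>\<^sup>+\<omega>. ennreal (I \<omega>) * ennreal (\<bar>D \<omega>\<bar> powr p) \<partial>M)"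
      by (intro nn_integral_cong) (simp add: ennreal_mult I_def)
    also have "\<dots> = (\<integral>\<^sup>+\<omega>. ennreal (I \<omega>) * ?Np \<omega> \<partial>M)"
      by (rule nn_cond_exp_intg[symmetric]) auto
    also have "\<dots> \<le> (\<integral>\<^sup>+\<omega>. ennreal Cb \<partial>M)"
    proof (rule nn_integral_mono_AE)
      show "AE \<omega> in M. ennreal (I \<omega>) * ?Np \<omega> \<le> ennreal Cb"
        using moment[OF t, folded D_def]
      proof eventually_elim
        case (elim \<omega>)
        show ?case
        proof (cases "\<omega> \<in> B")
          case True
          then have "ennreal (C * (1 + X t \<omega>) powr (p - 2 - \<delta>)) \<le> ennreal Cb"
            using Bsub by (intro ennreal_leI Cb) auto
          then show ?thesis using True elim by (simp add: I_def D_def)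
        qed (simp add: I_def)
      qed
    qed
    also have "\<dots> < \<infinity>" by (simp add: emeasure_space_1)
    finally show ?thesis .
  qed
  have int2: "integrable M (\<lambda>\<omega>. I \<omega> * (D \<omega>)\<^sup>2)"
    using fin2 by (intro integrableI_nonneg) (auto simp: I_def)
  have intp: "integrable M (\<lambda>\<omega>. I \<omega> * \<bar>D \<omega>\<bar> powr p)"
    using finp by (intro integrableI_nonneg) (auto simp: I_def)
  have bI: "integrable M (\<lambda>\<omega>. I \<omega> * k (X t \<omega>))"
    if [measurable]: "k \<in> borel_measurable borel" and "\<And>y. x1 \<le> y \<Longrightarrow> y \<le> b \<Longrightarrow> \<bar>k y\<bar> \<le> H'" for k :: "real \<Rightarrow> real" and H'
    using that(2) Bsub by (intro integrable_const_bound[of _ "\<bar>H'\<bar>"]) (fastforce simp: I_def indicator_def)+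
  have mulI: "integrable M (\<lambda>\<omega>. (I \<omega> * k (X t \<omega>)) * Y \<omega>)"
    if [measurable]: "k \<in> borel_measurable borel" and k: "\<And>y. x1 \<le> y \<Longrightarrow> y \<le> b \<Longrightarrow> \<bar>k y\<bar> \<le> H"
      and Y: "integrable M (\<lambda>\<omega>. I \<omega> * Y' \<omega>)" and [measurable]: "Y \<in> borel_measurable M"
      and YY: "\<And>\<omega>. \<bar>Y \<omega>\<bar> \<le> Y' \<omega>"
    for k :: "real \<Rightarrow> real" and Y Y' :: "'a \<Rightarrow> real"
  proof (rule Bochner_Integration.integrable_bound[OF integrable_mult_right[OF Y, of H]])
    show "AE \<omega> in M. norm (I \<omega> * k (X t \<omega>) * Y \<omega>) \<le> norm (H * (I \<omega> * Y' \<omega>))"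
    proof (rule AE_I2)
      fix \<omega>
      show "norm (I \<omega> * k (X t \<omega>) * Y \<omega>) \<le> norm (H * (I \<omega> * Y' \<omega>))"
      proof (cases "\<omega> \<in> B")
        case True
        have "\<bar>k (X t \<omega>)\<bar> * \<bar>Y \<omega>\<bar> \<le> H * Y' \<omega>"
          using k Bsub[OF True] YY[of \<omega>] H0[OF True] by (intro mult_mono) auto
        also have "\<dots> \<le> \<bar>H\<bar> * \<bar>Y' \<omega>\<bar>" by (metis abs_ge_self abs_mult)
        finally show ?thesis using True by (simp add: I_def abs_mult)
      qed (simp add: I_def)
    qed
  qed measurable
  have int1': "integrable M (\<lambda>\<omega>. I \<omega> * (1 + (D \<omega>)\<^sup>2))"
    using Bochner_Integration.integrable_add[OF bI[of "\<lambda>_. 1" 1] int2] by (simp add: algebra_simps)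
  have le1: "\<bar>D \<omega>\<bar> \<le> 1 + (D \<omega>)\<^sup>2" for \<omega>
  proof -
    have "0 \<le> (\<bar>D \<omega>\<bar> - 1)\<^sup>2" by simp
    then have "2 * \<bar>D \<omega>\<bar> \<le> 1 + (D \<omega>)\<^sup>2" by (simp add: power2_diff)
    then show ?thesis by linarith
  qed
  have i1: "integrable M (\<lambda>\<omega>. (I \<omega> * h1 (X t \<omega>)) * D \<omega>)"
    using bnd le1 by (intro mulI[OF _ _ int1']) auto
  have i2: "integrable M (\<lambda>\<omega>. (I \<omega> * h2 (X t \<omega>)) * (D \<omega>)\<^sup>2)"
    using bnd by (intro mulI[OF _ _ int2]) auto
  have i3: "integrable M (\<lambda>\<omega>. (I \<omega> * h3 (X t \<omega>)) * \<bar>D \<omega>\<bar> powr p)"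
    using bnd h30 by (intro mulI[OF _ _ intp]) auto
  have j1: "integrable M (\<lambda>\<omega>. (I \<omega> * h1 (X t \<omega>)) * \<mu> \<omega>)"
       "(\<integral>\<omega>. (I \<omega> * h1 (X t \<omega>)) * \<mu> \<omega> \<partial>M) = (\<integral>\<omega>. (I \<omega> * h1 (X t \<omega>)) * D \<omega> \<partial>M)"
    unfolding \<mu>_def using real_cond_exp_intg[OF i1] by auto
  have j2: "integrable M (\<lambda>\<omega>. (I \<omega> * h2 (X t \<omega>)) * v \<omega>)"
       "(\<integral>\<omega>. (I \<omega> * h2 (X t \<omega>)) * v \<omega> \<partial>M) = (\<integral>\<omega>. (I \<omega> * h2 (X t \<omega>)) * (D \<omega>)\<^sup>2 \<partial>M)"
    unfolding v_def using real_cond_exp_intg[OF i2] by auto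
  have j3: "integrable M (\<lambda>\<omega>. (I \<omega> * h3 (X t \<omega>)) * q \<omega>)"
       "(\<integral>\<omega>. (I \<omega> * h3 (X t \<omega>)) * q \<omega> \<partial>M) = (\<integral>\<omega>. (I \<omega> * h3 (X t \<omega>)) * \<bar>D \<omega>\<bar> powr p \<partial>M)"
    unfolding q_def using real_cond_exp_intg[OF i3] by auto
  have iG: "integrable M (\<lambda>\<omega>. I \<omega> * G (X t \<omega>))" using bnd G0 by (intro bI[of G H]) auto
  have iw: "integrable M (\<lambda>\<omega>. I \<omega> * w (X t \<omega>))" using bnd w0 by (intro bI[of w H]) auto
  have id: "integrable M (\<lambda>\<omega>. I \<omega> * d (X t \<omega>))" using bnd d0 by (intro bI[of d H]) auto
  let ?R = "\<lambda>\<omega>. I \<omega> * G (X t \<omega>) + (I \<omega> * h1 (X t \<omega>)) * D \<omega> + (I \<omega> * h2 (X t \<omega>)) * (D \<omega>)\<^sup>2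
     + (I \<omega> * h3 (X t \<omega>)) * \<bar>D \<omega>\<bar> powr p"
  have le: "I \<omega> * G (X (Suc t) \<omega>) \<le> ?R \<omega>" for \<omega>
  proof (cases "\<omega> \<in> B")
    case True
    have "X t \<omega> + D \<omega> = X (Suc t) \<omega>" by (simp add: D_def)
    then show ?thesis using tay[of "X t \<omega>" "D \<omega>"] Bsub[OF True] X_nonneg[of "Suc t" \<omega>] Bspace[OF True] True
      by (simp add: I_def)
  qed (simp add: I_def)
  have iR: "integrable M ?R"
    by (intro Bochner_Integration.integrable_add iG i1 i2 i3)
  have iG': "integrable M (\<lambda>\<omega>. I \<omega> * G (X (Suc t) \<omega>))"
  proof (rule Bochner_Integration.integrable_bound[OF iR])
    show "AE \<omega> in M. norm (I \<omega> * G (X (Suc t) \<omega>)) \<le> norm (?R \<omega>)"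
    proof (rule AE_I2)
      fix \<omega>
      have "0 \<le> I \<omega> * G (X (Suc t) \<omega>)" using G0 by (simp add: I_def)
      then show "norm (I \<omega> * G (X (Suc t) \<omega>)) \<le> norm (?R \<omega>)"
        using le[of \<omega>] unfolding real_norm_def by linarith
    qed
  qed measurable
  have "(\<integral>\<omega>. I \<omega> * G (X (Suc t) \<omega>) \<partial>M) \<le> (\<integral>\<omega>. ?R \<omega> \<partial>M)"
    using le by (intro integral_mono iG' iR)
  also have "\<dots> = (\<integral>\<omega>. I \<omega> * G (X t \<omega>) \<partial>M) + (\<integral>\<omega>. (I \<omega> * h1 (X t \<omega>)) * \<mu> \<omega> \<partial>M)
      + (\<integral>\<omega>. (I \<omega> * h2 (X t \<omega>)) * v \<omega> \<partial>M) + (\<integral>\<omega>. (I \<omega> * h3 (X t \<omega>)) * q \<omega> \<partial>M)"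
    using iG i1 i2 i3 j1 j2 j3 by simp
  also have "\<dots> = (\<integral>\<omega>. I \<omega> * G (X t \<omega>) + (I \<omega> * h1 (X t \<omega>)) * \<mu> \<omega>
      + (I \<omega> * h2 (X t \<omega>)) * v \<omega> + (I \<omega> * h3 (X t \<omega>)) * q \<omega> \<partial>M)"
    using iG j1 j2 j3 by simp
  also have "\<dots> \<le> (\<integral>\<omega>. I \<omega> * G (X t \<omega>) + I \<omega> * d (X t \<omega>) - I \<omega> * w (X t \<omega>) \<partial>M)"
  proof (rule integral_mono_AE)
    show "AE \<omega> in M. I \<omega> * G (X t \<omega>) + (I \<omega> * h1 (X t \<omega>)) * \<mu> \<omega>
      + (I \<omega> * h2 (X t \<omega>)) * v \<omega> + (I \<omega> * h3 (X t \<omega>)) * q \<omega>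
      \<le> I \<omega> * G (X t \<omega>) + I \<omega> * d (X t \<omega>) - I \<omega> * w (X t \<omega>)"
      using dr moment[OF t] AE1 AE2
    proof eventually_elim
      case (elim \<omega>)
      show ?case
      proof (cases "\<omega> \<in> B")
        case True
        define y where "y = X t \<omega>"
        have y: "x1 \<le> y" "y \<le> b" using Bsub[OF True] by (auto simp: y_def)
        have y0: "y > 0" "ln y > 0" using y x1 lnx[OF y(1)] by auto
        have m: "\<bar>\<mu> \<omega> - c / y\<bar> \<le> \<epsilon> / (y * ln y)"
          using elim(1) y unfolding \<mu>_def y_def D_def by auto
        have v: "\<bar>v \<omega> - s2\<bar> \<le> \<epsilon> / ln y"
          using elim(1,3) y unfolding y_def D_def by auto
        have q: "q \<omega> \<le> C * (1 + y) powr (p - 2 - \<delta>)"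
        proof -
          have "enn2real (?Np \<omega>) \<le> enn2real (ennreal (C * (1 + y) powr (p - 2 - \<delta>)))"
            using elim(2) unfolding y_def D_def by (intro enn2real_mono) auto
          then show ?thesis using elim(4) C by simp
        qed
        have "h1 y * \<mu> \<omega> = h1 y * (c / y) + h1 y * (\<mu> \<omega> - c / y)" by (simp add: algebra_simps)
        also have "h1 y * (\<mu> \<omega> - c / y) \<le> \<bar>h1 y\<bar> * \<bar>\<mu> \<omega> - c / y\<bar>" by (metis abs_ge_self abs_mult)
        also have "\<dots> \<le> \<bar>h1 y\<bar> * (\<epsilon> / (y * ln y))" using m by (intro mult_left_mono) auto
        finally have 1: "h1 y * \<mu> \<omega> \<le> h1 y * (c / y) + \<bar>h1 y\<bar> * (\<epsilon> / (y * ln y))" by simp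
        have "h2 y * v \<omega> = h2 y * s2 + h2 y * (v \<omega> - s2)" by (simp add: algebra_simps)
        also have "h2 y * (v \<omega> - s2) \<le> \<bar>h2 y\<bar> * \<bar>v \<omega> - s2\<bar>" by (metis abs_ge_self abs_mult)
        also have "\<dots> \<le> \<bar>h2 y\<bar> * (\<epsilon> / ln y)" using v by (intro mult_left_mono) auto
        finally have 2: "h2 y * v \<omega> \<le> h2 y * s2 + \<bar>h2 y\<bar> * (\<epsilon> / ln y)" by simp
        have 3: "h3 y * q \<omega> \<le> h3 y * (C * (1 + y) powr (p - 2 - \<delta>))"
          using q h30 by (intro mult_left_mono) auto
        have "h1 y * \<mu> \<omega> + h2 y * v \<omega> + h3 y * q \<omega> \<le> d y - w y"
          using 1 2 3 gen[OF y] by linarith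
        then show ?thesis using True by (simp add: I_def y_def)
      qed (simp add: I_def)
    qed
  qed (use iG j1 j2 j3 id iw in \<open>auto intro!: Bochner_Integration.integrable_add Bochner_Integration.integrable_diff\<close>)
  also have "\<dots> = (\<integral>\<omega>. I \<omega> * G (X t \<omega>) + I \<omega> * d (X t \<omega>) \<partial>M) - (\<integral>\<omega>. I \<omega> * w (X t \<omega>) \<partial>M)"
    using iG id iw by simp
  finally have "(\<integral>\<omega>. I \<omega> * G (X (Suc t) \<omega>) + I \<omega> * w (X t \<omega>) \<partial>M) \<le> (\<integral>\<omega>. I \<omega> * G (X t \<omega>) + I \<omega> * d (X t \<omega>) \<partial>M)"
    using iG' iw by simp
  moreover have "(\<integral>\<^sup>+\<omega>. ennreal (I \<omega> * G (X (Suc t) \<omega>) + I \<omega> * w (X t \<omega>)) \<partial>M)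
      = ennreal (\<integral>\<omega>. I \<omega> * G (X (Suc t) \<omega>) + I \<omega> * w (X t \<omega>) \<partial>M)"
    using G0 w0 by (intro nn_integral_eq_integral Bochner_Integration.integrable_add iG' iw) (auto simp: I_def)
  moreover have "(\<integral>\<^sup>+\<omega>. ennreal (I \<omega> * G (X t \<omega>) + I \<omega> * d (X t \<omega>)) \<partial>M)
      = ennreal (\<integral>\<omega>. I \<omega> * G (X t \<omega>) + I \<omega> * d (X t \<omega>) \<partial>M)"
    using G0 d0 by (intro nn_integral_eq_integral Bochner_Integration.integrable_add iG id) (auto simp: I_def)
  ultimately have "(\<integral>\<^sup>+\<omega>. ennreal (I \<omega> * G (X (Suc t) \<omega>) + I \<omega> * w (X t \<omega>)) \<partial>M)
      \<le> (\<integral>\<^sup>+\<omega>. ennreal (I \<omega> * G (X t \<omega>) + I \<omega> * d (X t \<omega>)) \<partial>M)"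
    by (simp only: ennreal_leI)
  moreover have "ennreal (I \<omega> * a + I \<omega> * b) = ennreal (a + b) * indicator B \<omega>" for a b \<omega>
    by (auto simp: I_def indicator_def)
  ultimately show ?thesis by simp
qed

lemma one_step:
  assumes t: "t \<ge> 1" and A: "A \<in> sets (F t)" and Asub: "\<And>\<omega>. \<omega> \<in> A \<Longrightarrow> x1 \<le> X t \<omega>"
    and x1: "x1 \<ge> 3" and \<epsilon>: "\<epsilon> > 0"
    and dr: "AE \<omega> in M. X t \<omega> \<ge> x1 \<longrightarrow>
               moments_close \<epsilon> t \<omega>"
    and [measurable]: "G \<in> borel_measurable borel" "h1 \<in> borel_measurable borel"
      "h2 \<in> borel_measurable borel" "h3 \<in> borel_measurable borel"
      "w \<in> borel_measurable borel" "d \<in> borel_measurable borel"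
    and nonneg: "\<And>y. 0 \<le> G y" "\<And>y. 0 \<le> h3 y" "\<And>y. 0 \<le> w y" "\<And>y. 0 \<le> d y"
    and bnd: "\<And>b. \<exists>H. \<forall>y\<in>{x1..b}. \<bar>h1 y\<bar> \<le> H \<and> \<bar>h2 y\<bar> \<le> H \<and> h3 y \<le> H \<and> G y \<le> H \<and> w y \<le> H \<and> d y \<le> H"
    and tay: "\<And>y e. x1 \<le> y \<Longrightarrow> 0 \<le> y + e \<Longrightarrow> G (y + e) \<le> G y + h1 y * e + h2 y * e\<^sup>2 + h3 y * \<bar>e\<bar> powr p"
    and gen: "\<And>y. x1 \<le> y \<Longrightarrow> h1 y * (c / y) + h2 y * s2 + \<bar>h1 y\<bar> * (\<epsilon> / (y * ln y)) + \<bar>h2 y\<bar> * (\<epsilon> / ln y)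
      + h3 y * (C * (1 + y) powr (p - 2 - \<delta>)) + w y \<le> d y"
  shows "(\<integral>\<^sup>+\<omega>\<in>A. ennreal (G (X (Suc t) \<omega>) + w (X t \<omega>)) \<partial>M) \<le> (\<integral>\<^sup>+\<omega>\<in>A. ennreal (G (X t \<omega>) + d (X t \<omega>)) \<partial>M)"
proof -
  have [measurable]: "X t \<in> borel_measurable M" "X (Suc t) \<in> borel_measurable M"
    "X t \<in> borel_measurable (F t)" "A \<in> sets (F t)" "A \<in> sets M"
    using X_meas X_meas_F t A sets_F by auto
  define B where "B = (\<lambda>n::nat. A \<inter> {\<omega>\<in>space (F t). X t \<omega> \<le> real n})"
  have BF: "B n \<in> sets (F t)" for n unfolding B_def by measurable
  have [measurable]: "B n \<in> sets M" for n using BF t sets_F by auto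
  have Asp: "\<omega> \<in> space (F t)" if "\<omega> \<in> A" for \<omega> using A sets.sets_into_space that by blast
  have conv: "(\<lambda>n. \<integral>\<^sup>+\<omega>\<in>B n. k \<omega> \<partial>M) \<longlonglongrightarrow> (\<integral>\<^sup>+\<omega>\<in>A. k \<omega> \<partial>M)"
    if [measurable]: "k \<in> borel_measurable M" for k :: "'a \<Rightarrow> ennreal"
  proof (rule nn_integral_LIMSEQ)
    show "incseq (\<lambda>n \<omega>. k \<omega> * indicator (B n) \<omega>)"
      by (auto simp: incseq_def le_fun_def B_def indicator_def)
    show "(\<lambda>n. k \<omega> * indicator (B n) \<omega>) \<longlonglongrightarrow> k \<omega> * indicator A \<omega>" for \<omega>
    proof (rule tendsto_eventually)
      obtain n0 :: nat where n0: "X t \<omega> \<le> real n0" using real_arch_simple by blast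
      show "\<forall>\<^sub>F n in sequentially. k \<omega> * indicator (B n) \<omega> = k \<omega> * indicator A \<omega>"
        using eventually_ge_at_top[of n0]
      proof eventually_elim
        case (elim n)
        then have "X t \<omega> \<le> real n" using n0 by linarith
        then show ?case using Asp by (auto simp: B_def indicator_def)
      qed
    qed
  qed measurable
  have "(\<integral>\<^sup>+\<omega>\<in>B n. ennreal (G (X (Suc t) \<omega>) + w (X t \<omega>)) \<partial>M) \<le> (\<integral>\<^sup>+\<omega>\<in>A. ennreal (G (X t \<omega>) + d (X t \<omega>)) \<partial>M)" for n
  proof -
    obtain H where H: "\<forall>y\<in>{x1..real n}. \<bar>h1 y\<bar> \<le> H \<and> \<bar>h2 y\<bar> \<le> H \<and> h3 y \<le> H \<and> G y \<le> H \<and> w y \<le> H \<and> d y \<le> H"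
      using bnd by blast
    have "(\<integral>\<^sup>+\<omega>\<in>B n. ennreal (G (X (Suc t) \<omega>) + w (X t \<omega>)) \<partial>M) \<le> (\<integral>\<^sup>+\<omega>\<in>B n. ennreal (G (X t \<omega>) + d (X t \<omega>)) \<partial>M)"
      by (rule one_step_bounded[where ?x1.0 = x1 and b = "real n" and H = H and ?h1.0 = h1 and ?h2.0 = h2 and ?h3.0 = h3 and \<epsilon> = \<epsilon>])
        (use t BF Asub x1 \<epsilon> dr nonneg H tay gen in \<open>auto simp: B_def\<close>)
    also have "\<dots> \<le> (\<integral>\<^sup>+\<omega>\<in>A. ennreal (G (X t \<omega>) + d (X t \<omega>)) \<partial>M)"
      by (intro nn_integral_mono) (auto simp: B_def indicator_def)
    finally show ?thesis .
  qed
  then show ?thesis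
    by (intro LIMSEQ_le_const2[OF conv]) auto
qed

lemma one_step_low:
  assumes t: "t \<ge> 1" and A: "A \<in> sets (F t)" and Asub: "\<And>\<omega>. \<omega> \<in> A \<Longrightarrow> X t \<omega> \<le> x1"
    and [measurable]: "G \<in> borel_measurable borel"
    and growth: "\<And>y. y \<ge> 0 \<Longrightarrow> G y \<le> K * (1 + y)\<^sup>2" and K: "K \<ge> 0"
  shows "(\<integral>\<^sup>+\<omega>\<in>A. ennreal (G (X (Suc t) \<omega>)) \<partial>M)
    \<le> ennreal (K * (2 * (1 + x1)\<^sup>2 + 2 + 2 * (C * (1 + x1) powr \<bar>p - 2 - \<delta>\<bar>))) * emeasure M A"
proof (cases "A = {}")
  case True then show ?thesis by simp
next
  case False
  interpret sigma_finite_subalgebra M "F t" by (rule subalg[OF t])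
  have [measurable]: "X t \<in> borel_measurable M" "X (Suc t) \<in> borel_measurable M"
    "X t \<in> borel_measurable (F t)" "A \<in> sets (F t)" "A \<in> sets M"
    using X_meas X_meas_F t A sets_F by auto
  have Asp: "\<omega> \<in> space M" if "\<omega> \<in> A" for \<omega> using \<open>A \<in> sets M\<close> sets.sets_into_space that by blast
  have x1: "x1 \<ge> 0" using False Asub X_nonneg[OF t Asp] by (meson all_not_in_conv order_trans)
  let ?D = "\<lambda>\<omega>. X (Suc t) \<omega> - X t \<omega>"
  let ?Np = "nn_cond_exp M (F t) (\<lambda>\<omega>. ennreal (\<bar>?D \<omega>\<bar> powr p))"
  define Cb where "Cb = C * (1 + x1) powr \<bar>p - 2 - \<delta>\<bar>"
  have Cb0: "Cb \<ge> 0" using C by (simp add: Cb_def)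
  have mom: "(\<integral>\<^sup>+\<omega>\<in>A. ennreal (\<bar>?D \<omega>\<bar> powr p) \<partial>M) \<le> ennreal Cb * emeasure M A"
  proof -
    have "(\<integral>\<^sup>+\<omega>\<in>A. ennreal (\<bar>?D \<omega>\<bar> powr p) \<partial>M) = (\<integral>\<^sup>+\<omega>. indicator A \<omega> * ennreal (\<bar>?D \<omega>\<bar> powr p) \<partial>M)"
      by (simp add: mult.commute)
    also have "\<dots> = (\<integral>\<^sup>+\<omega>. indicator A \<omega> * ?Np \<omega> \<partial>M)"
      by (rule nn_cond_exp_intg[symmetric]) auto
    also have "\<dots> \<le> (\<integral>\<^sup>+\<omega>. ennreal Cb * indicator A \<omega> \<partial>M)"
    proof (rule nn_integral_mono_AE)
      show "AE \<omega> in M. indicator A \<omega> * ?Np \<omega> \<le> ennreal Cb * indicator A \<omega>"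
        using moment[OF t] AE_space
      proof eventually_elim
        case (elim \<omega>)
        show ?case
        proof (cases "\<omega> \<in> A")
          case True
          have y: "0 \<le> X t \<omega>" "X t \<omega> \<le> x1" using X_nonneg[OF t] Asub[OF True] elim by auto
          have "(1 + X t \<omega>) powr (p - 2 - \<delta>) \<le> (1 + X t \<omega>) powr \<bar>p - 2 - \<delta>\<bar>"
            using y by (intro powr_mono) auto
          also have "\<dots> \<le> (1 + x1) powr \<bar>p - 2 - \<delta>\<bar>"
            using y by (intro powr_mono2) auto
          finally have "C * (1 + X t \<omega>) powr (p - 2 - \<delta>) \<le> Cb"
            unfolding Cb_def using C by (intro mult_left_mono)
          then have "ennreal (C * (1 + X t \<omega>) powr (p - 2 - \<delta>)) \<le> ennreal Cb" by (rule ennreal_leI)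
          then show ?thesis using True elim by (auto intro: order_trans)
        qed simp
      qed
    qed
    also have "\<dots> = ennreal Cb * emeasure M A" by (simp add: nn_integral_cmult_indicator)
    finally show ?thesis .
  qed
  have pt: "ennreal (G (X (Suc t) \<omega>)) \<le>
      ennreal (K * (2 * (1 + x1)\<^sup>2 + 2)) + ennreal (2 * K) * ennreal (\<bar>?D \<omega>\<bar> powr p)" if "\<omega> \<in> A" for \<omega>
  proof -
    define e where "e = \<bar>?D \<omega>\<bar>"
    have X1: "0 \<le> X (Suc t) \<omega>" using X_nonneg Asp that by simp
    have "e\<^sup>2 \<le> 1 + e powr p"
    proof (cases "e \<le> 1")
      case True
      then have "e\<^sup>2 \<le> 1" by (simp add: e_def abs_square_le_1)
      then show ?thesis using powr_ge_zero[of e p] by linarith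
    next
      case False
      then have "e powr 2 \<le> e powr p" using p by (intro powr_mono) auto
      then show ?thesis using False by simp
    qed
    moreover have "(1 + X (Suc t) \<omega>)\<^sup>2 \<le> (1 + x1 + e)\<^sup>2"
      using X1 Asub[OF that] by (intro power_mono) (auto simp: e_def)
    moreover have "(1 + x1 + e)\<^sup>2 \<le> 2 * (1 + x1)\<^sup>2 + 2 * e\<^sup>2"
      using zero_le_power2[of "1 + x1 - e"] by (simp add: power2_eq_square algebra_simps)
    ultimately have "(1 + X (Suc t) \<omega>)\<^sup>2 \<le> (2 * (1 + x1)\<^sup>2 + 2) + 2 * e powr p" by linarith
    then have "K * (1 + X (Suc t) \<omega>)\<^sup>2 \<le> K * (2 * (1 + x1)\<^sup>2 + 2) + 2 * K * e powr p"
      using mult_left_mono[OF _ K] by (fastforce simp: algebra_simps)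
    then have "G (X (Suc t) \<omega>) \<le> K * (2 * (1 + x1)\<^sup>2 + 2) + 2 * K * e powr p"
      using growth[OF X1] by linarith
    then have "ennreal (G (X (Suc t) \<omega>)) \<le> ennreal (K * (2 * (1 + x1)\<^sup>2 + 2) + 2 * K * e powr p)"
      by (rule ennreal_leI)
    also have "\<dots> = ennreal (K * (2 * (1 + x1)\<^sup>2 + 2)) + ennreal (2 * K * e powr p)"
      using K by (intro ennreal_plus) auto
    also have "ennreal (2 * K * e powr p) = ennreal (2 * K) * ennreal (e powr p)"
      using K by (intro ennreal_mult) auto
    finally show ?thesis unfolding e_def .
  qed
  have "(\<integral>\<^sup>+\<omega>\<in>A. ennreal (G (X (Suc t) \<omega>)) \<partial>M) \<le>
      (\<integral>\<^sup>+\<omega>. ennreal (K * (2 * (1 + x1)\<^sup>2 + 2)) * indicator A \<omega> + ennreal (2 * K) * (ennreal (\<bar>?D \<omega>\<bar> powr p) * indicator A \<omega>) \<partial>M)"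
    using pt by (intro nn_integral_mono) (auto simp: indicator_def)
  also have "\<dots> = ennreal (K * (2 * (1 + x1)\<^sup>2 + 2)) * emeasure M A
      + ennreal (2 * K) * (\<integral>\<^sup>+\<omega>\<in>A. ennreal (\<bar>?D \<omega>\<bar> powr p) \<partial>M)"
    by (subst nn_integral_add) (auto simp: nn_integral_cmult nn_integral_cmult_indicator)
  also have "\<dots> \<le> ennreal (K * (2 * (1 + x1)\<^sup>2 + 2)) * emeasure M A + ennreal (2 * K) * (ennreal Cb * emeasure M A)"
    by (intro add_left_mono mult_left_mono mom) auto
  also have "\<dots> = ennreal (K * (2 * (1 + x1)\<^sup>2 + 2) + 2 * K * Cb) * emeasure M A"
    using K Cb0 by (simp add: ennreal_mult[symmetric] mult.assoc[symmetric] distrib_right[symmetric] ennreal_plus[symmetric] del: ennreal_plus)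
  also have "K * (2 * (1 + x1)\<^sup>2 + 2) + 2 * K * Cb = K * (2 * (1 + x1)\<^sup>2 + 2 + 2 * Cb)"
    by (simp add: algebra_simps)
  finally show ?thesis unfolding Cb_def .
qed

end

section \<open>Time spent away from the origin\<close>

lemma sum_shift_diff_le:
  fixes f :: "nat \<Rightarrow> real"
  assumes "\<And>t. 0 \<le> f t" "\<And>t. f t \<le> 1"
  shows "(\<Sum>t=1..T. f t - f (t + n)) \<le> real n"
proof (induction n)
  case (Suc n)
  have tel: "(\<Sum>t=1..T. f (t + n) - f (t + Suc n)) = f (1 + n) - f (Suc T + n)"
    by (induction T) auto
  have "(\<Sum>t=1..T. f t - f (t + Suc n)) = (\<Sum>t=1..T. f t - f (t + n)) + (\<Sum>t=1..T. f (t + n) - f (t + Suc n))"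
    by (simp add: sum.distrib[symmetric])
  also have "\<dots> \<le> real n + 1"
    using Suc assms(1)[of "Suc T + n"] assms(2)[of "1 + n"] unfolding tel by linarith
  finally show ?case by simp
qed simp

context lamperti_process
begin

text \<open>On the event that all \<open>\<tau>\<^sub>n\<close> are finite, \<open>alive t\<close> is the event \<open>\<eta>\<^sub>1 \<ge> t\<close>.\<close>

definition alive :: "nat \<Rightarrow> 'a set" where
  "alive t = {\<omega>\<in>space M. \<forall>u. 1 < u \<and> u \<le> t \<longrightarrow> X u \<omega> \<noteq> 0}"

lemma alive_F: "t \<ge> 1 \<Longrightarrow> alive t \<in> sets (F t)"
proof -
  assume t: "t \<ge> 1"
  have "{\<omega>\<in>space (F t). \<forall>u\<in>{1<..t}. X u \<omega> \<noteq> 0} \<in> sets (F t)"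
  proof (rule sets.sets_Collect_finite_All)
    fix u assume "u \<in> {1<..t}"
    then have [measurable]: "X u \<in> borel_measurable (F t)" by (intro X_meas_F) auto
    show "{\<omega>\<in>space (F t). X u \<omega> \<noteq> 0} \<in> sets (F t)" by measurable
  qed simp
  also have "{\<omega>\<in>space (F t). \<forall>u\<in>{1<..t}. X u \<omega> \<noteq> 0} = alive t"
    using space_F[OF t] by (auto simp: alive_def)
  finally show ?thesis .
qed

lemma alive_antimono: "s \<le> t \<Longrightarrow> alive t \<subseteq> alive s"
  by (auto simp: alive_def)

lemma alive_sets [measurable]: "alive t \<in> sets M"
proof (cases "t \<ge> 1")
  case True then show ?thesis using alive_F sets_F by blast
next
  case False
  then have "alive t = space M" by (auto simp: alive_def)
  then show ?thesis by simp
qed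

lemma prob_alive_antimono: "s \<le> t \<Longrightarrow> prob (alive t) \<le> prob (alive s)"
  by (intro finite_measure_mono alive_antimono alive_sets)

definition at_in :: "nat \<Rightarrow> real set \<Rightarrow> 'a set" where
  "at_in t I = {\<omega>\<in>space M. X t \<omega> \<in> I}"

lemma at_in_F: "1 \<le> s \<Longrightarrow> s \<le> t \<Longrightarrow> I \<in> sets borel \<Longrightarrow> at_in s I \<in> sets (F t)"
  using measurable_sets[OF X_meas_F, of s t I] space_F[of t]
  by (simp add: at_in_def vimage_def Int_def conj_commute)

lemma at_in_sets: "1 \<le> s \<Longrightarrow> I \<in> sets borel \<Longrightarrow> at_in s I \<in> sets M"
  using at_in_F[of s s] sets_F by blast

text \<open>
  A visit below \<open>x1\<close> at time \<open>t\<close> ends the excursion within \<open>mm\<close> steps with probability at least \<open>ph\<close>,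
  so the expected number of such visits is bounded by a telescoping sum of \<open>P(L\<^sub>t) - P(L\<^bsub>t + mm\<^esub>)\<close>.
\<close>

lemma bottom_visits: "\<exists>V\<ge>0. \<forall>T. (\<Sum>t=1..T. prob (alive t \<inter> at_in t {..x1})) \<le> V"
proof -
  define E where "E = {x\<in>S. x \<le> x1}"
  have E: "finite E" unfolding E_def by (rule S_locfin)
  define mm where "mm = Max (insert 0 (m ` E))"
  define ph where "ph = Min (insert 1 (\<phi> ` E))"
  have mm: "m x \<le> mm" if "x \<in> E" for x using that E by (simp add: mm_def)
  have ph: "ph \<le> \<phi> x" if "x \<in> E" for x using that E by (simp add: ph_def)
  have ph0: "ph > 0" using E return_pos(2) by (auto simp: ph_def E_def)
  have "ph * prob (alive t \<inter> at_in t {..x1}) \<le> prob (alive t) - prob (alive (t + mm))" if t: "t \<ge> 1" for t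
  proof -
    interpret sigma_finite_subalgebra M "F t" by (rule subalg[OF t])
    define A where "A = alive t \<inter> at_in t {..x1}"
    have AF [measurable]: "A \<in> sets (F t)"
      unfolding A_def using t by (intro sets.Int alive_F at_in_F) auto
    have [measurable]: "A \<in> sets M" using AF t sets_F by blast
    define R where "R = {\<omega>\<in>space M. X (t + m (X t \<omega>)) \<omega> = 0}"
    have "R = (\<Union>x\<in>S. at_in t {x} \<inter> at_in (t + m x) {0})"
      using S_valued[OF t] by (auto simp: R_def at_in_def)
    moreover have "\<dots> \<in> sets M"
      using t by (intro sets.countable_UN' countable_S) (auto intro!: sets.Int at_in_sets)
    ultimately have [measurable]: "R \<in> sets M" by simp
    have iAR: "integrable M (\<lambda>\<omega>. indicator A \<omega> * indicator R \<omega> :: real)"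
      by (intro integrable_const_bound[of _ 1]) (auto simp: indicator_def)
    have "ph * prob A = (\<integral>\<omega>. indicator A \<omega> * ph \<partial>M)" by (simp add: mult.commute)
    also have "\<dots> \<le> (\<integral>\<omega>. indicator A \<omega> * real_cond_exp M (F t) (indicator R) \<omega> \<partial>M)"
    proof (rule integral_mono_AE)
      show "integrable M (\<lambda>\<omega>. indicator A \<omega> * ph)"
        by (intro integrable_mult_left integrable_real_indicator) (auto simp: emeasure_eq_measure)
      show "integrable M (\<lambda>\<omega>. indicator A \<omega> * real_cond_exp M (F t) (indicator R) \<omega>)"
        by (rule real_cond_exp_intg(1)[OF iAR]) auto
      show "AE \<omega> in M. indicator A \<omega> * ph \<le> indicator A \<omega> * real_cond_exp M (F t) (indicator R) \<omega>"
        using return[OF t] AE_space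
      proof eventually_elim
        case (elim \<omega>)
        show ?case
        proof (cases "\<omega> \<in> A")
          case True
          then have "X t \<omega> \<in> E" using S_valued[OF t] elim by (auto simp: A_def at_in_def E_def)
          then show ?thesis using True ph[of "X t \<omega>"] elim by (simp add: R_def)
        qed simp
      qed
    qed
    also have "\<dots> = (\<integral>\<omega>. indicator A \<omega> * indicator R \<omega> \<partial>M)"
      by (rule real_cond_exp_intg(2)[OF iAR]) auto
    also have "\<dots> = prob (A \<inter> R)"
      by (simp add: indicator_inter_arith[symmetric])
    also have "\<dots> \<le> prob (alive t - alive (t + mm))"
    proof (intro finite_measure_mono)
      show "A \<inter> R \<subseteq> alive t - alive (t + mm)"
      proof
        fix \<omega> assume w: "\<omega> \<in> A \<inter> R"
        then have sp: "\<omega> \<in> space M" and "X t \<omega> \<le> x1" by (auto simp: A_def at_in_def)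
        then have "X t \<omega> \<in> E" "X t \<omega> \<in> S" using S_valued[OF t] by (auto simp: E_def)
        then have "m (X t \<omega>) \<le> mm" "m (X t \<omega>) \<ge> 1" using mm return_pos by auto
        then have "\<omega> \<notin> alive (t + mm)"
          using w t by (auto simp: alive_def R_def intro!: exI[of _ "t + m (X t \<omega>)"])
        then show "\<omega> \<in> alive t - alive (t + mm)" using w by (auto simp: A_def)
      qed
    qed measurable
    also have "\<dots> = prob (alive t) - prob (alive (t + mm))"
      by (intro finite_measure_Diff alive_antimono) auto
    finally show ?thesis unfolding A_def .
  qed
  then have "ph * (\<Sum>t=1..T. prob (alive t \<inter> at_in t {..x1})) \<le> (\<Sum>t=1..T. prob (alive t) - prob (alive (t + mm)))" for T
    unfolding sum_distrib_left by (intro sum_mono) auto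
  also have "\<dots> T \<le> real mm" for T
    by (rule sum_shift_diff_le) auto
  finally have "(\<Sum>t=1..T. prob (alive t \<inter> at_in t {..x1})) \<le> real mm / ph" for T
    using ph0 by (simp add: field_simps)
  then show ?thesis using ph0 by (intro exI[of _ "real mm / ph"]) auto
qed

lemma excursion_sum:
  assumes [measurable]: "G \<in> borel_measurable borel" "w \<in> borel_measurable borel"
    and G0: "\<And>y. 0 \<le> G y" and w0: "\<And>y. 0 \<le> w y"
    and high: "\<And>t A. t \<ge> 1 \<Longrightarrow> A \<in> sets (F t) \<Longrightarrow> (\<And>\<omega>. \<omega> \<in> A \<Longrightarrow> x1 \<le> X t \<omega>) \<Longrightarrow>
      (\<integral>\<^sup>+\<omega>\<in>A. ennreal (G (X (Suc t) \<omega>) + w (X t \<omega>)) \<partial>M) \<le> (\<integral>\<^sup>+\<omega>\<in>A. ennreal (G (X t \<omega>)) \<partial>M)"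
    and low: "\<And>t A. t \<ge> 1 \<Longrightarrow> A \<in> sets (F t) \<Longrightarrow> (\<And>\<omega>. \<omega> \<in> A \<Longrightarrow> X t \<omega> \<le> x1) \<Longrightarrow>
      (\<integral>\<^sup>+\<omega>\<in>A. ennreal (G (X (Suc t) \<omega>)) \<partial>M) \<le> ennreal B * emeasure M A"
    and B: "B \<ge> 0"
    and V: "\<And>T. (\<Sum>t=1..T. prob (alive t \<inter> at_in t {..x1})) \<le> V"
    and T: "T \<ge> 1"
  shows "(\<integral>\<^sup>+\<omega>\<in>alive T. ennreal (G (X T \<omega>)) \<partial>M)
      + (\<Sum>t=1..<T. \<integral>\<^sup>+\<omega>\<in>alive t \<inter> at_in t {x1<..}. ennreal (w (X t \<omega>)) \<partial>M) \<le> ennreal (G 0 + B * V)"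
proof -
  have "(\<integral>\<^sup>+\<omega>\<in>alive T. ennreal (G (X T \<omega>)) \<partial>M)
      + (\<Sum>t=1..<T. \<integral>\<^sup>+\<omega>\<in>alive t \<inter> at_in t {x1<..}. ennreal (w (X t \<omega>)) \<partial>M)
      \<le> ennreal (G 0) + ennreal (B * (\<Sum>t=1..<T. prob (alive t \<inter> at_in t {..x1})))"
    using T
  proof (induction T rule: nat_induct_at_least)
    case base
    have "(\<integral>\<^sup>+\<omega>\<in>alive 1. ennreal (G (X 1 \<omega>)) \<partial>M) \<le> (\<integral>\<^sup>+\<omega>. ennreal (G 0) \<partial>M)"
      using start by (intro nn_integral_mono_AE) (auto simp: indicator_def elim!: eventually_mono)
    then show ?case by (simp add: emeasure_space_1)
  next
    case (Suc n)
    have n: "n \<ge> 1" using Suc by simp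
    have [measurable]: "X n \<in> borel_measurable M" "X (Suc n) \<in> borel_measurable M"
      using X_meas n by auto
    define A1 A2 where "A1 = alive n \<inter> at_in n {x1<..}" and "A2 = alive n \<inter> at_in n {..x1}"
    have AF: "A1 \<in> sets (F n)" "A2 \<in> sets (F n)"
      unfolding A1_def A2_def using n by (auto intro!: alive_F at_in_F)
    then have [measurable]: "A1 \<in> sets M" "A2 \<in> sets M" using sets_F n by auto
    have un: "indicator (alive n) \<omega> = (indicator A1 \<omega> + indicator A2 \<omega> :: ennreal)" for \<omega>
      by (auto simp: A1_def A2_def alive_def at_in_def indicator_def)
    have split: "(\<integral>\<^sup>+\<omega>\<in>alive n. ennreal (G (X i \<omega>)) \<partial>M) = (\<integral>\<^sup>+\<omega>\<in>A1. ennreal (G (X i \<omega>)) \<partial>M) + (\<integral>\<^sup>+\<omega>\<in>A2. ennreal (G (X i \<omega>)) \<partial>M)"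
      if [measurable]: "X i \<in> borel_measurable M" for i
      unfolding un distrib_left by (rule nn_integral_add) measurable
    have "(\<integral>\<^sup>+\<omega>\<in>alive (Suc n). ennreal (G (X (Suc n) \<omega>)) \<partial>M) \<le> (\<integral>\<^sup>+\<omega>\<in>alive n. ennreal (G (X (Suc n) \<omega>)) \<partial>M)"
      using alive_antimono[of n "Suc n"] by (intro nn_integral_mono mult_left_mono) (auto simp: indicator_def)
    also have "\<dots> = (\<integral>\<^sup>+\<omega>\<in>A1. ennreal (G (X (Suc n) \<omega>)) \<partial>M) + (\<integral>\<^sup>+\<omega>\<in>A2. ennreal (G (X (Suc n) \<omega>)) \<partial>M)"
      by (rule split) measurable
    finally have "(\<integral>\<^sup>+\<omega>\<in>alive (Suc n). ennreal (G (X (Suc n) \<omega>)) \<partial>M) + (\<integral>\<^sup>+\<omega>\<in>A1. ennreal (w (X n \<omega>)) \<partial>M)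
      \<le> ((\<integral>\<^sup>+\<omega>\<in>A1. ennreal (G (X (Suc n) \<omega>)) \<partial>M) + (\<integral>\<^sup>+\<omega>\<in>A1. ennreal (w (X n \<omega>)) \<partial>M))
        + (\<integral>\<^sup>+\<omega>\<in>A2. ennreal (G (X (Suc n) \<omega>)) \<partial>M)"
      by (simp add: ac_simps add_mono)
    also have "(\<integral>\<^sup>+\<omega>\<in>A1. ennreal (G (X (Suc n) \<omega>)) \<partial>M) + (\<integral>\<^sup>+\<omega>\<in>A1. ennreal (w (X n \<omega>)) \<partial>M)
      = (\<integral>\<^sup>+\<omega>\<in>A1. ennreal (G (X (Suc n) \<omega>) + w (X n \<omega>)) \<partial>M)"
      using G0 w0 by (subst nn_integral_add[symmetric]) (auto simp: distrib_right intro!: nn_integral_cong)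
    also have "\<dots> \<le> (\<integral>\<^sup>+\<omega>\<in>A1. ennreal (G (X n \<omega>)) \<partial>M)"
      by (rule high[OF n AF(1)]) (auto simp: A1_def at_in_def)
    also have "(\<integral>\<^sup>+\<omega>\<in>A2. ennreal (G (X (Suc n) \<omega>)) \<partial>M) \<le> ennreal B * emeasure M A2"
      by (rule low[OF n AF(2)]) (auto simp: A2_def at_in_def)
    finally have step: "(\<integral>\<^sup>+\<omega>\<in>alive (Suc n). ennreal (G (X (Suc n) \<omega>)) \<partial>M) + (\<integral>\<^sup>+\<omega>\<in>A1. ennreal (w (X n \<omega>)) \<partial>M)
      \<le> (\<integral>\<^sup>+\<omega>\<in>A1. ennreal (G (X n \<omega>)) \<partial>M) + ennreal (B * prob A2)"
      using B by (simp add: emeasure_eq_measure ennreal_mult)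
    also have "\<dots> \<le> (\<integral>\<^sup>+\<omega>\<in>alive n. ennreal (G (X n \<omega>)) \<partial>M) + ennreal (B * prob A2)"
      by (subst split) auto
    finally have step': "(\<integral>\<^sup>+\<omega>\<in>alive (Suc n). ennreal (G (X (Suc n) \<omega>)) \<partial>M) + (\<integral>\<^sup>+\<omega>\<in>A1. ennreal (w (X n \<omega>)) \<partial>M)
      \<le> (\<integral>\<^sup>+\<omega>\<in>alive n. ennreal (G (X n \<omega>)) \<partial>M) + ennreal (B * prob A2)" .
    let ?S = "\<Sum>t=1..<n. \<integral>\<^sup>+\<omega>\<in>alive t \<inter> at_in t {x1<..}. ennreal (w (X t \<omega>)) \<partial>M"
    let ?P = "\<Sum>t=1..<n. prob (alive t \<inter> at_in t {..x1})"
    have "(\<integral>\<^sup>+\<omega>\<in>alive (Suc n). ennreal (G (X (Suc n) \<omega>)) \<partial>M)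
      + (\<Sum>t=1..<Suc n. \<integral>\<^sup>+\<omega>\<in>alive t \<inter> at_in t {x1<..}. ennreal (w (X t \<omega>)) \<partial>M)
      = ((\<integral>\<^sup>+\<omega>\<in>alive (Suc n). ennreal (G (X (Suc n) \<omega>)) \<partial>M) + (\<integral>\<^sup>+\<omega>\<in>A1. ennreal (w (X n \<omega>)) \<partial>M)) + ?S"
      using n by (simp add: A1_def ac_simps)
    also have "\<dots> \<le> ((\<integral>\<^sup>+\<omega>\<in>alive n. ennreal (G (X n \<omega>)) \<partial>M) + ennreal (B * prob A2)) + ?S"
      by (intro add_right_mono step')
    also have "\<dots> = ((\<integral>\<^sup>+\<omega>\<in>alive n. ennreal (G (X n \<omega>)) \<partial>M) + ?S) + ennreal (B * prob A2)"
      by (simp add: ac_simps)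
    also have "\<dots> \<le> (ennreal (G 0) + ennreal (B * ?P)) + ennreal (B * prob A2)"
      by (intro add_right_mono Suc.IH)
    also have "\<dots> = ennreal (G 0) + ennreal (B * ?P + B * prob A2)"
      using B by (subst ennreal_plus) (auto simp: ac_simps intro!: sum_nonneg mult_nonneg_nonneg)
    also have "B * ?P + B * prob A2 = B * (\<Sum>t=1..<Suc n. prob (alive t \<inter> at_in t {..x1}))"
      using n by (simp add: A2_def algebra_simps)
    finally show ?case .
  qed
  also have "\<dots> \<le> ennreal (G 0) + ennreal (B * V)"
  proof -
    have "{1..<T} = {1..T - 1}" using T by auto
    then have "(\<Sum>t=1..<T. prob (alive t \<inter> at_in t {..x1})) \<le> V" using V[of "T - 1"] by simp
    then show ?thesis using B by (intro add_left_mono ennreal_leI mult_left_mono)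
  qed
  also have "\<dots> = ennreal (G 0 + B * V)"
    using G0 B V[of 0] by (intro ennreal_plus[symmetric]) auto
  finally show ?thesis .
qed

lemma occupation_bounds:
  assumes [measurable]: "G \<in> borel_measurable borel" "w \<in> borel_measurable borel"
    and sum: "\<And>T. T \<ge> 1 \<Longrightarrow> (\<integral>\<^sup>+\<omega>\<in>alive T. ennreal (G (X T \<omega>)) \<partial>M)
      + (\<Sum>t=1..<T. \<integral>\<^sup>+\<omega>\<in>alive t \<inter> at_in t {x1<..}. ennreal (w (X t \<omega>)) \<partial>M) \<le> ennreal Q"
    and Q: "Q \<ge> 0" and J: "J \<in> sets borel"
  shows "\<And>\<gamma>. \<gamma> > 0 \<Longrightarrow> (\<And>y. x1 < y \<Longrightarrow> y \<in> J \<Longrightarrow> \<gamma> \<le> w y) \<Longrightarrow>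
      (\<Sum>t=1..T. prob (alive t \<inter> at_in t ({x1<..} \<inter> J))) \<le> Q / \<gamma>"
    and "\<And>\<gamma>. \<gamma> > 0 \<Longrightarrow> (\<And>y. y \<in> J \<Longrightarrow> \<gamma> \<le> G y) \<Longrightarrow> T \<ge> 1 \<Longrightarrow> prob (alive T \<inter> at_in T J) \<le> Q / \<gamma>"
proof -
  fix \<gamma> :: real assume \<gamma>: "\<gamma> > 0" and w: "\<And>y. x1 < y \<Longrightarrow> y \<in> J \<Longrightarrow> \<gamma> \<le> w y"
  have "ennreal (\<gamma> * prob (alive t \<inter> at_in t ({x1<..} \<inter> J))) \<le> (\<integral>\<^sup>+\<omega>\<in>alive t \<inter> at_in t {x1<..}. ennreal (w (X t \<omega>)) \<partial>M)"
    if t: "t \<ge> 1" for t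
  proof -
    have [measurable]: "alive t \<inter> at_in t ({x1<..} \<inter> J) \<in> sets M"
      using t J by (intro sets.Int alive_sets at_in_sets) auto
    have "ennreal (\<gamma> * prob (alive t \<inter> at_in t ({x1<..} \<inter> J))) = (\<integral>\<^sup>+\<omega>. ennreal \<gamma> * indicator (alive t \<inter> at_in t ({x1<..} \<inter> J)) \<omega> \<partial>M)"
      using \<gamma> by (subst nn_integral_cmult_indicator) (auto simp: emeasure_eq_measure ennreal_mult)
    also have "\<dots> \<le> (\<integral>\<^sup>+\<omega>\<in>alive t \<inter> at_in t {x1<..}. ennreal (w (X t \<omega>)) \<partial>M)"
      using w by (intro nn_integral_mono) (auto simp: indicator_def at_in_def intro!: ennreal_leI)
    finally show ?thesis .
  qed
  then have "(\<Sum>t=1..T. ennreal (\<gamma> * prob (alive t \<inter> at_in t ({x1<..} \<inter> J))))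
      \<le> (\<Sum>t=1..T. \<integral>\<^sup>+\<omega>\<in>alive t \<inter> at_in t {x1<..}. ennreal (w (X t \<omega>)) \<partial>M)"
    by (intro sum_mono) auto
  also have "\<dots> \<le> ennreal Q"
    using order_trans[OF _ sum[of "Suc T"]] by (simp add: atLeastLessThanSuc_atLeastAtMost)
  finally have "ennreal (\<gamma> * (\<Sum>t=1..T. prob (alive t \<inter> at_in t ({x1<..} \<inter> J)))) \<le> ennreal Q"
    using \<gamma> by (subst (asm) sum_ennreal) (auto simp: sum_distrib_left)
  then show "(\<Sum>t=1..T. prob (alive t \<inter> at_in t ({x1<..} \<inter> J))) \<le> Q / \<gamma>"
    using \<gamma> Q by (simp add: ennreal_le_iff field_simps)
next
  fix \<gamma> :: real assume \<gamma>: "\<gamma> > 0" and G: "\<And>y. y \<in> J \<Longrightarrow> \<gamma> \<le> G y" and T: "T \<ge> 1"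
  have [measurable]: "alive T \<inter> at_in T J \<in> sets M"
    using T J by (intro sets.Int alive_sets at_in_sets) auto
  have "ennreal (\<gamma> * prob (alive T \<inter> at_in T J)) = (\<integral>\<^sup>+\<omega>. ennreal \<gamma> * indicator (alive T \<inter> at_in T J) \<omega> \<partial>M)"
    using \<gamma> by (subst nn_integral_cmult_indicator) (auto simp: emeasure_eq_measure ennreal_mult)
  also have "\<dots> \<le> (\<integral>\<^sup>+\<omega>\<in>alive T. ennreal (G (X T \<omega>)) \<partial>M)"
    using G by (intro nn_integral_mono) (auto simp: indicator_def at_in_def intro!: ennreal_leI)
  also have "\<dots> \<le> ennreal Q" using order_trans[OF _ sum[OF T]] by simp
  finally show "prob (alive T \<inter> at_in T J) \<le> Q / \<gamma>"
    using \<gamma> Q by (simp add: ennreal_le_iff field_simps)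
qed

end

lemma div_ln_mono:
  fixes x y :: real
  assumes "3 \<le> x" "x \<le> y"
  shows "x / ln x \<le> y / ln y"
proof -
  have lx: "ln x \<ge> 1" "ln y \<ge> 1" using assms by (auto intro!: ln_ge_1)
  have "ln (y / x) \<le> y / x - 1" using assms by (intro ln_le_minus_one) auto
  then have "ln y \<le> ln x + (y / x - 1)" using assms by (simp add: ln_div)
  then have "x * ln y \<le> x * (ln x + (y / x - 1))" using assms by (intro mult_left_mono) auto
  also have "\<dots> = x * ln x + (y - x)" using assms by (simp add: algebra_simps)
  also have "\<dots> \<le> x * ln x + (y - x) * ln x"
    using assms lx mult_left_mono[of 1 "ln x" "y - x"] by simp
  finally have "x * ln y \<le> y * ln x" by (simp add: algebra_simps)
  then show ?thesis using lx by (simp add: field_simps)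
qed

lemma powr_ln_neg_eq:
  assumes "y > 1"
  shows "powr_ln a (- a) y = (y / ln y) powr a"
  using assms by (simp add: powr_ln_def powr_divide powr_minus_divide)

lemma powr_ln_neg_mono:
  assumes "3 \<le> x" "x \<le> y" "a \<ge> 0"
  shows "powr_ln a (- a) x \<le> powr_ln a (- a) y"
  using assms div_ln_mono[of x y] ln_ge_1[of x]
  by (auto simp: powr_ln_neg_eq intro!: powr_mono2 divide_nonneg_nonneg)

lemma powr_ln_antimono:
  assumes "3 \<le> x" "x \<le> y" "a \<le> 0" "g \<le> 0"
  shows "powr_ln a g y \<le> powr_ln a g x"
  unfolding powr_ln_def using assms ln_ge_1[of x] by (intro mult_mono powr_mono2') auto

lemma powr_ln_mono:
  assumes "3 \<le> x" "x \<le> y" "a \<ge> 0" "g \<ge> 0"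
  shows "powr_ln a g x \<le> powr_ln a g y"
  unfolding powr_ln_def using assms ln_ge_1[of x] by (intro mult_mono powr_mono2) auto

context lamperti_process
begin

lemma alive_split:
  assumes "t \<ge> 1"
  shows "prob (alive t) \<le> prob (alive t \<inter> at_in t {..x1}) + prob (alive t \<inter> at_in t ({x1<..} \<inter> {..<x}))
     + prob (alive t \<inter> at_in t {x..})"
proof -
  have "prob (alive t) \<le> prob (alive t \<inter> at_in t {..x1} \<union> (alive t \<inter> at_in t ({x1<..} \<inter> {..<x})) \<union> (alive t \<inter> at_in t {x..}))"
    using assms by (intro finite_measure_mono sets.Un sets.Int alive_sets at_in_sets)
      (auto simp: alive_def at_in_def)
  also have "\<dots> \<le> prob (alive t \<inter> at_in t {..x1} \<union> (alive t \<inter> at_in t ({x1<..} \<inter> {..<x}))) + prob (alive t \<inter> at_in t {x..})"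
    using assms by (intro measure_Un_le sets.Un sets.Int alive_sets at_in_sets) auto
  also have "prob (alive t \<inter> at_in t {..x1} \<union> (alive t \<inter> at_in t ({x1<..} \<inter> {..<x})))
     \<le> prob (alive t \<inter> at_in t {..x1}) + prob (alive t \<inter> at_in t ({x1<..} \<inter> {..<x}))"
    using assms by (intro measure_Un_le sets.Un sets.Int alive_sets at_in_sets) auto
  finally show ?thesis by simp
qed

lemma truncated_mean_bound:
  assumes a: "a > 0" "a \<le> 2" and c: "c = - (a - 1) * s2 / 2"
  shows "\<exists>K\<ge>0. \<exists>T0. \<forall>T\<ge>T0. (\<Sum>t=1..T. prob (alive t)) \<le> K * (real T powr (1 - a / 2) * ln (real T) powr (1 + a))"
proof -
  have sg: "- sgn (- a) = 1" using a by simp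
  obtain \<epsilon> x1 h1 h2 h3 where \<epsilon>: "\<epsilon> > 0" and x1: "x1 \<ge> 3"
    and [measurable]: "h1 \<in> borel_measurable borel" "h2 \<in> borel_measurable borel" "h3 \<in> borel_measurable borel"
    and h3: "\<And>y. 0 \<le> h3 y"
    and loc: "\<And>b. \<exists>H. \<forall>y\<in>{x1..b}. \<bar>h1 y\<bar> \<le> H \<and> \<bar>h2 y\<bar> \<le> H \<and> h3 y \<le> H"
    and gen: "\<And>y. y \<ge> x1 \<Longrightarrow> h1 y * (c / y) + h2 y * s2 + \<bar>h1 y\<bar> * (\<epsilon> / (y * ln y)) + \<bar>h2 y\<bar> * (\<epsilon> / ln y)
      + h3 y * (C * (1 + y) powr (p - 2 - \<delta>)) + s2 * \<bar>- a\<bar> * a / 8 * powr_ln (a - 2) (- a - 1) y \<le> 0"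
    and tay: "\<And>G y d. y \<ge> x1 \<Longrightarrow> y + d \<ge> 0 \<Longrightarrow> (\<forall>z. y / 2 \<le> z \<longrightarrow> z \<le> 3 * y / 2 \<longrightarrow> G z = powr_ln a (- a) z) \<Longrightarrow>
      (\<forall>z\<ge>0. \<bar>G z\<bar> \<le> powr_ln a (- a) (max z 3)) \<Longrightarrow>
      1 * G (y + d) \<le> 1 * G y + h1 y * d + h2 y * d\<^sup>2 + h3 y * \<bar>d\<bar> powr p"
    using powr_ln_lyapunov[of a s2 "- a" c p \<delta> C, unfolded sg] a s2_pos c p \<delta> C by auto
  obtain x0 where x0: "\<And>t. t \<ge> 1 \<Longrightarrow> AE \<omega> in M. X t \<omega> \<ge> x0 \<longrightarrow>
               moments_close \<epsilon> t \<omega>"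
    using drift[OF \<epsilon>] by blast
  define x2 where "x2 = max 6 (max x0 x1)"
  have x2: "x2 \<ge> 6" "x2 \<ge> x0" "x2 \<ge> x1" by (auto simp: x2_def)
  define G where "G y = powr_ln a (- a) (max y 3)" for y
  define q where "q = s2 * a * a / 8"
  have q: "q > 0" using s2_pos a by (simp add: q_def)
  define w where "w y = q * powr_ln (a - 2) (- a - 1) y" for y
  have [measurable]: "G \<in> borel_measurable borel" "w \<in> borel_measurable borel"
    unfolding G_def w_def by measurable
  have G0: "0 \<le> G y" and w0: "0 \<le> w y" for y using q by (auto simp: G_def w_def)
  have growth: "G y \<le> 9 * (1 + y)\<^sup>2" if "y \<ge> 0" for y
  proof -
    define z where "z = max y 3"
    have z: "z \<ge> 3" "z \<le> 3 * (1 + y)" using that by (auto simp: z_def)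
    have "G y \<le> powr_ln 2 0 z" unfolding G_def z_def[symmetric] using z a by (intro powr_ln_mono_exponent) auto
    also have "\<dots> = z\<^sup>2" using z ln_ge_1[of z] by (simp add: powr_ln_def)
    also have "\<dots> \<le> (3 * (1 + y))\<^sup>2" using z by (intro power_mono) auto
    also have "\<dots> = 9 * (1 + y)\<^sup>2" by (subst power_mult_distrib) simp
    finally show ?thesis .
  qed
  have high: "(\<integral>\<^sup>+\<omega>\<in>A. ennreal (G (X (Suc t) \<omega>) + w (X t \<omega>)) \<partial>M) \<le> (\<integral>\<^sup>+\<omega>\<in>A. ennreal (G (X t \<omega>)) \<partial>M)"
    if t: "t \<ge> 1" and A: "A \<in> sets (F t)" "\<And>\<omega>. \<omega> \<in> A \<Longrightarrow> x2 \<le> X t \<omega>" for t A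
  proof -
    have "(\<integral>\<^sup>+\<omega>\<in>A. ennreal (G (X (Suc t) \<omega>) + w (X t \<omega>)) \<partial>M) \<le> (\<integral>\<^sup>+\<omega>\<in>A. ennreal (G (X t \<omega>) + (\<lambda>_. 0) (X t \<omega>)) \<partial>M)"
    proof (rule one_step[where ?x1.0 = x2 and \<epsilon> = \<epsilon> and ?h1.0 = h1 and ?h2.0 = h2 and ?h3.0 = h3])
      show "AE \<omega> in M. X t \<omega> \<ge> x2 \<longrightarrow>
               moments_close \<epsilon> t \<omega>"
        using x0[OF t] x2 by (auto elim!: eventually_mono)
      show "\<exists>H. \<forall>y\<in>{x2..b}. \<bar>h1 y\<bar> \<le> H \<and> \<bar>h2 y\<bar> \<le> H \<and> h3 y \<le> H \<and> G y \<le> H \<and> w y \<le> H \<and> 0 \<le> H" for b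
      proof -
        obtain H where H: "\<forall>y\<in>{x1..b}. \<bar>h1 y\<bar> \<le> H \<and> \<bar>h2 y\<bar> \<le> H \<and> h3 y \<le> H" using loc by blast
        define H' where "H' = max H (max (9 * (1 + b)\<^sup>2) q)"
        have "G y \<le> H' \<and> w y \<le> H'" if "y \<in> {x2..b}" for y
        proof -
          have "G y \<le> 9 * (1 + y)\<^sup>2" using that x2 by (intro growth) auto
          also have "\<dots> \<le> 9 * (1 + b)\<^sup>2" using that x2 by (intro mult_left_mono power_mono) auto
          finally have 1: "G y \<le> H'" by (simp add: H'_def)
          have "powr_ln (a - 2) (- a - 1) y \<le> powr_ln 0 0 y" using that x2 a by (intro powr_ln_mono_exponent) auto
          also have "\<dots> \<le> 1" by (auto simp: powr_ln_def)
          finally have "w y \<le> q * 1" unfolding w_def using q by (intro mult_left_mono) auto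
          then show ?thesis using 1 by (simp add: H'_def)
        qed
        moreover have "\<bar>h1 y\<bar> \<le> H' \<and> \<bar>h2 y\<bar> \<le> H' \<and> h3 y \<le> H'" if "y \<in> {x2..b}" for y
          using H that x2 by (auto simp: H'_def le_max_iff_disj)
        moreover have "0 \<le> H'" using q by (simp add: H'_def le_max_iff_disj)
        ultimately show ?thesis by blast
      qed
      show "G (y + e) \<le> G y + h1 y * e + h2 y * e\<^sup>2 + h3 y * \<bar>e\<bar> powr p" if "x2 \<le> y" "0 \<le> y + e" for y e
        using tay[of y e G] that x2 by (auto simp: G_def)
      show "h1 y * (c / y) + h2 y * s2 + \<bar>h1 y\<bar> * (\<epsilon> / (y * ln y)) + \<bar>h2 y\<bar> * (\<epsilon> / ln y)
        + h3 y * (C * (1 + y) powr (p - 2 - \<delta>)) + w y \<le> 0" if "x2 \<le> y" for y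
        using gen[of y] that x2 a by (simp add: w_def q_def)
    qed (use t A x2 \<epsilon> G0 h3 w0 in auto)
    then show ?thesis by simp
  qed
  define B where "B = 9 * (2 * (1 + x2)\<^sup>2 + 2 + 2 * (C * (1 + x2) powr \<bar>p - 2 - \<delta>\<bar>))"
  have B: "B \<ge> 0" using C by (simp add: B_def)
  have low: "(\<integral>\<^sup>+\<omega>\<in>A. ennreal (G (X (Suc t) \<omega>)) \<partial>M) \<le> ennreal B * emeasure M A"
    if t: "t \<ge> 1" and A: "A \<in> sets (F t)" "\<And>\<omega>. \<omega> \<in> A \<Longrightarrow> X t \<omega> \<le> x2" for t A
    unfolding B_def using t A growth by (intro one_step_low) auto
  obtain V where V: "V \<ge> 0" "\<And>T. (\<Sum>t=1..T. prob (alive t \<inter> at_in t {..x2})) \<le> V"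
    using bottom_visits[of x2] by auto
  define Q where "Q = G 0 + B * V"
  have Q: "Q \<ge> 0" using G0 B V by (simp add: Q_def)
  have sum: "(\<integral>\<^sup>+\<omega>\<in>alive T. ennreal (G (X T \<omega>)) \<partial>M)
      + (\<Sum>t=1..<T. \<integral>\<^sup>+\<omega>\<in>alive t \<inter> at_in t {x2<..}. ennreal (w (X t \<omega>)) \<partial>M) \<le> ennreal Q" if "T \<ge> 1" for T
    unfolding Q_def by (rule excursion_sum[OF _ _ G0 w0 high low B V(2) that]) auto
  have main: "(\<Sum>t=1..T. prob (alive t)) \<le> (V + Q / q + Q) * (real T powr (1 - a / 2) * ln (real T) powr (1 + a))"
    if T: "real T \<ge> x2\<^sup>2" for T
  proof -
    define x where "x = sqrt (real T)"
    have x: "x \<ge> x2" using T x2 unfolding x_def by (intro real_le_rsqrt) auto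
    have x6: "x \<ge> 6" using x x2 by simp
    have T36: "real T \<ge> 36"
    proof -
      have "6\<^sup>2 \<le> x2\<^sup>2" using x2 by (intro power_mono) auto
      then show ?thesis using T by simp
    qed
    have lnT: "ln (real T) = 2 * ln x" using T36 by (simp add: x_def ln_sqrt)
    have lnx1: "ln x \<ge> 1" using x6 by (intro ln_ge_1) auto
    have xp: "x powr b = real T powr (b / 2)" for b
      using T36 by (simp add: x_def powr_half_sqrt[symmetric] powr_powr)
    define P where "P = real T powr (1 - a / 2) * ln (real T) powr (1 + a)"
    have P1: "P \<ge> 1"
      unfolding P_def using T36 lnx1 lnT a
      by (intro mult_ge1_I ge_one_powr_ge_zero) auto
    have 1: "(\<Sum>t=1..T. prob (alive t \<inter> at_in t ({x2<..} \<inter> {..<x}))) \<le> Q / q * P"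
    proof -
      have wx: "w x > 0" using q x6 by (simp add: w_def powr_ln_pos)
      have "(\<Sum>t=1..T. prob (alive t \<inter> at_in t ({x2<..} \<inter> {..<x}))) \<le> Q / w x"
      proof (rule occupation_bounds(1)[OF _ _ sum Q _ wx])
        show "w x \<le> w y" if "x2 < y" "y \<in> {..<x}" for y
          unfolding w_def using q that x2 a by (intro mult_left_mono powr_ln_antimono) auto
      qed auto
      also have "\<dots> = Q / q * (real T powr (1 - a / 2) * ln x powr (1 + a))"
      proof -
        have "inverse (powr_ln (a - 2) (- a - 1) x) = real T powr (1 - a / 2) * ln x powr (1 + a)"
        proof -
          have "inverse (x powr (a - 2)) = real T powr (1 - a / 2)"
            unfolding powr_minus[symmetric] xp by (simp add: diff_divide_distrib)
          moreover have "inverse (ln x powr (- a - 1)) = ln x powr (1 + a)"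
            unfolding powr_minus[symmetric] by (simp add: add.commute)
          ultimately show ?thesis by (simp add: powr_ln_def)
        qed
        moreover have "Q / w x = Q / q * inverse (powr_ln (a - 2) (- a - 1) x)"
          by (simp only: w_def divide_inverse inverse_mult_distrib mult.assoc)
        ultimately show ?thesis by (simp only:)
      qed
      also have "\<dots> \<le> Q / q * P"
        unfolding P_def using Q q lnx1 lnT a
        by (intro mult_left_mono powr_mono2 divide_nonneg_nonneg) auto
      finally show ?thesis .
    qed
    have 2: "(\<Sum>t=1..T. prob (alive t \<inter> at_in t {x..})) \<le> Q * P"
    proof -
      have Gx: "G x > 0" using x6 by (simp add: G_def powr_ln_pos)
      have "(\<Sum>t=1..T. prob (alive t \<inter> at_in t {x..})) \<le> (\<Sum>t=1..T. Q / G x)"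
      proof (intro sum_mono occupation_bounds(2)[OF _ _ sum Q _ Gx])
        show "G x \<le> G y" if "y \<in> {x..}" for y
          unfolding G_def using that x6 a by (intro powr_ln_neg_mono) auto
      qed auto
      also have "\<dots> = Q * (real T / G x)" by simp
      also have "real T / G x = real T powr (1 - a / 2) * ln x powr a"
      proof -
        have "G x = real T powr (a / 2) * ln x powr (- a)"
          using x6 unfolding G_def powr_ln_def by (simp add: xp)
        moreover have "ln x powr (- a) = inverse (ln x powr a)" by (rule powr_minus)
        moreover have "real T powr (1 - a / 2) = real T / real T powr (a / 2)"
          using T36 powr_diff[of "real T" 1 "a / 2"] by simp
        ultimately show ?thesis
          by (simp only: divide_inverse inverse_mult_distrib inverse_inverse_eq mult.assoc)
      qed
      also have "Q * (real T powr (1 - a / 2) * ln x powr a) \<le> Q * P"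
      proof -
        have "ln x powr a \<le> ln x powr (1 + a)" using lnx1 by (intro powr_mono) auto
        also have "\<dots> \<le> ln (real T) powr (1 + a)" using lnx1 lnT a by (intro powr_mono2) auto
        finally show ?thesis unfolding P_def using Q by (intro mult_left_mono) auto
      qed
      finally show ?thesis .
    qed
    have "(\<Sum>t=1..T. prob (alive t)) \<le> (\<Sum>t=1..T. prob (alive t \<inter> at_in t {..x2}) + prob (alive t \<inter> at_in t ({x2<..} \<inter> {..<x}))
     + prob (alive t \<inter> at_in t {x..}))"
      by (intro sum_mono alive_split) auto
    also have "\<dots> \<le> V + Q / q * P + Q * P"
      using 1 2 V(2)[of T] by (simp add: sum.distrib)
    also have "\<dots> \<le> V * P + Q / q * P + Q * P"
      using V(1) P1 mult_left_mono[of 1 P V] by simp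
    also have "\<dots> = (V + Q / q + Q) * P" by (simp add: algebra_simps)
    finally show ?thesis unfolding P_def .
  qed
  show ?thesis
  proof (intro exI[of _ "V + Q / q + Q"] conjI exI[of _ "nat \<lceil>x2\<^sup>2\<rceil>"] allI impI)
    show "0 \<le> V + Q / q + Q" using V Q q by simp
    fix T assume "nat \<lceil>x2\<^sup>2\<rceil> \<le> T"
    then have "x2\<^sup>2 \<le> real T" by linarith
    then show "(\<Sum>t=1..T. prob (alive t)) \<le> (V + Q / q + Q) * (real T powr (1 - a / 2) * ln (real T) powr (1 + a))"
      by (rule main)
  qed
qed

lemma mean_bound:
  assumes neg: "2 * c + s2 < 0"
  shows "\<exists>K. \<forall>T. (\<Sum>t=1..T. prob (alive t)) \<le> K"
proof -
  define q where "q = - (2 * c + s2) / 2"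
  have q: "q > 0" using neg by (simp add: q_def)
  define \<epsilon> where "\<epsilon> = q / 3"
  have \<epsilon>: "\<epsilon> > 0" using q by (simp add: \<epsilon>_def)
  obtain x0 where x0: "\<And>t. t \<ge> 1 \<Longrightarrow> AE \<omega> in M. X t \<omega> \<ge> x0 \<longrightarrow>
               moments_close \<epsilon> t \<omega>"
    using drift[OF \<epsilon>] by blast
  define x2 where "x2 = max 3 x0"
  have x2: "x2 \<ge> 3" "x2 \<ge> x0" by (auto simp: x2_def)
  define G where "G y = y\<^sup>2" for y :: real
  have [measurable]: "G \<in> borel_measurable borel" unfolding G_def by measurable
  have G0: "0 \<le> G y" for y by (simp add: G_def)
  have growth: "G y \<le> 1 * (1 + y)\<^sup>2" if "y \<ge> 0" for y
    using that by (simp add: G_def power_mono)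
  have high: "(\<integral>\<^sup>+\<omega>\<in>A. ennreal (G (X (Suc t) \<omega>) + (\<lambda>_. q) (X t \<omega>)) \<partial>M) \<le> (\<integral>\<^sup>+\<omega>\<in>A. ennreal (G (X t \<omega>)) \<partial>M)"
    if t: "t \<ge> 1" and A: "A \<in> sets (F t)" "\<And>\<omega>. \<omega> \<in> A \<Longrightarrow> x2 \<le> X t \<omega>" for t A
  proof -
    have "(\<integral>\<^sup>+\<omega>\<in>A. ennreal (G (X (Suc t) \<omega>) + (\<lambda>_. q) (X t \<omega>)) \<partial>M) \<le> (\<integral>\<^sup>+\<omega>\<in>A. ennreal (G (X t \<omega>) + (\<lambda>_. 0) (X t \<omega>)) \<partial>M)"
    proof (rule one_step[where ?x1.0 = x2 and \<epsilon> = \<epsilon> and ?h1.0 = "\<lambda>y. 2 * y" and ?h2.0 = "\<lambda>_. 1" and ?h3.0 = "\<lambda>_. 0"])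
      show "AE \<omega> in M. X t \<omega> \<ge> x2 \<longrightarrow>
               moments_close \<epsilon> t \<omega>"
        using x0[OF t] x2 by (auto elim!: eventually_mono)
      show "\<exists>H. \<forall>y\<in>{x2..b}. \<bar>2 * y\<bar> \<le> H \<and> \<bar>1\<bar> \<le> H \<and> 0 \<le> H \<and> G y \<le> H \<and> q \<le> H \<and> 0 \<le> H" for b
      proof (intro exI[of _ "2 * \<bar>b\<bar> + b\<^sup>2 + q + 1"] ballI)
        fix y assume y: "y \<in> {x2..b}"
        then have yb: "y\<^sup>2 \<le> b\<^sup>2" using x2 by (intro power_mono) auto
        show "\<bar>2 * y\<bar> \<le> 2 * \<bar>b\<bar> + b\<^sup>2 + q + 1 \<and> \<bar>1\<bar> \<le> 2 * \<bar>b\<bar> + b\<^sup>2 + q + 1 \<and> 0 \<le> 2 * \<bar>b\<bar> + b\<^sup>2 + q + 1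
          \<and> G y \<le> 2 * \<bar>b\<bar> + b\<^sup>2 + q + 1 \<and> q \<le> 2 * \<bar>b\<bar> + b\<^sup>2 + q + 1 \<and> 0 \<le> 2 * \<bar>b\<bar> + b\<^sup>2 + q + 1"
          using yb y x2 q zero_le_power2[of b] unfolding G_def atLeastAtMost_iff by (intro conjI) linarith+
      qed
      show "2 * y * (c / y) + 1 * s2 + \<bar>2 * y\<bar> * (\<epsilon> / (y * ln y)) + \<bar>1\<bar> * (\<epsilon> / ln y)
        + 0 * (C * (1 + y) powr (p - 2 - \<delta>)) + q \<le> 0" if "x2 \<le> y" for y
      proof -
        have y: "y \<ge> 3" "ln y \<ge> 1" using that x2 ln_ge_1[of y] by auto
        have eq: "2 * y * (c / y) + 1 * s2 + \<bar>2 * y\<bar> * (\<epsilon> / (y * ln y)) + \<bar>1\<bar> * (\<epsilon> / ln y) = 2 * c + s2 + 3 * (\<epsilon> / ln y)"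
          using y by (simp add: field_simps)
        have "\<epsilon> / ln y \<le> \<epsilon>" using y \<epsilon> by (simp add: field_simps)
        moreover have "3 * \<epsilon> = q" "2 * q = - (2 * c + s2)" by (auto simp: \<epsilon>_def q_def)
        ultimately have "2 * c + s2 + 3 * (\<epsilon> / ln y) + q \<le> 0" by linarith
        then show ?thesis unfolding eq by simp
      qed
    qed (use t A x2 \<epsilon> q in \<open>auto simp: G_def power2_eq_square algebra_simps\<close>)
    then show ?thesis by simp
  qed
  define B where "B = 1 * (2 * (1 + x2)\<^sup>2 + 2 + 2 * (C * (1 + x2) powr \<bar>p - 2 - \<delta>\<bar>))"
  have B: "B \<ge> 0" using C by (simp add: B_def)
  have low: "(\<integral>\<^sup>+\<omega>\<in>A. ennreal (G (X (Suc t) \<omega>)) \<partial>M) \<le> ennreal B * emeasure M A"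
    if t: "t \<ge> 1" and A: "A \<in> sets (F t)" "\<And>\<omega>. \<omega> \<in> A \<Longrightarrow> X t \<omega> \<le> x2" for t A
    unfolding B_def using t A growth by (intro one_step_low) auto
  obtain V where V: "V \<ge> 0" "\<And>T. (\<Sum>t=1..T. prob (alive t \<inter> at_in t {..x2})) \<le> V"
    using bottom_visits[of x2] by auto
  define Q where "Q = G 0 + B * V"
  have Q: "Q \<ge> 0" using G0 B V by (simp add: Q_def)
  have sum: "(\<integral>\<^sup>+\<omega>\<in>alive T. ennreal (G (X T \<omega>)) \<partial>M)
      + (\<Sum>t=1..<T. \<integral>\<^sup>+\<omega>\<in>alive t \<inter> at_in t {x2<..}. ennreal ((\<lambda>_. q) (X t \<omega>)) \<partial>M) \<le> ennreal Q" if "T \<ge> 1" for T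
    unfolding Q_def by (rule excursion_sum[OF _ _ G0 _ high low B V(2) that]) (use q in auto)
  have occ: "(\<Sum>t=1..T. prob (alive t \<inter> at_in t ({x2<..} \<inter> UNIV))) \<le> Q / q" for T
    by (rule occupation_bounds(1)[OF _ _ sum Q _ q]) auto
  have "(\<Sum>t=1..T. prob (alive t)) \<le> V + Q / q" for T
  proof -
    have "(\<Sum>t=1..T. prob (alive t)) \<le> (\<Sum>t=1..T. prob (alive t \<inter> at_in t {..x2}) + prob (alive t \<inter> at_in t ({x2<..} \<inter> UNIV)))"
    proof (rule sum_mono)
      fix t assume t: "t \<in> {1..T}"
      then have "prob (alive t) \<le> prob (alive t \<inter> at_in t {..x2} \<union> alive t \<inter> at_in t ({x2<..} \<inter> UNIV))"
        by (intro finite_measure_mono sets.Un sets.Int alive_sets at_in_sets) (auto simp: alive_def at_in_def)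
      also have "\<dots> \<le> prob (alive t \<inter> at_in t {..x2}) + prob (alive t \<inter> at_in t ({x2<..} \<inter> UNIV))"
        using t by (intro measure_Un_le sets.Int alive_sets at_in_sets) auto
      finally show "prob (alive t) \<le> prob (alive t \<inter> at_in t {..x2}) + prob (alive t \<inter> at_in t ({x2<..} \<inter> UNIV))" .
    qed
    also have "\<dots> \<le> V + Q / q"
      using V(2)[of T] occ[of T] by (simp add: sum.distrib)
    finally show ?thesis .
  qed
  then show ?thesis by blast
qed

end

section \<open>Lower bound for the survival probability\<close>

context lamperti_process
begin

definition confined :: "nat \<Rightarrow> 'a set \<Rightarrow> real set \<Rightarrow> nat \<Rightarrow> 'a set" where
  "confined k A I t = {\<omega>\<in>A. \<forall>u. k \<le> u \<and> u \<le> t \<longrightarrow> X u \<omega> \<in> I}"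

lemma confined_F:
  assumes "1 \<le> k" "k \<le> t" "A \<in> sets (F k)" "I \<in> sets borel"
  shows "confined k A I t \<in> sets (F t)"
proof -
  have "{\<omega>\<in>space (F t). \<forall>u\<in>{k..t}. X u \<omega> \<in> I} \<in> sets (F t)"
  proof (rule sets.sets_Collect_finite_All)
    fix u assume "u \<in> {k..t}"
    then have "at_in u I \<in> sets (F t)" using assms by (intro at_in_F) auto
    then show "{\<omega>\<in>space (F t). X u \<omega> \<in> I} \<in> sets (F t)"
      using space_F[of t] assms by (simp add: at_in_def)
  qed simp
  then have "A \<inter> {\<omega>\<in>space (F t). \<forall>u\<in>{k..t}. X u \<omega> \<in> I} \<in> sets (F t)"
    using assms sets_F_mono[of k t A] by (intro sets.Int) auto
  moreover have "A \<subseteq> space (F t)"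
    using assms sets_F_mono[of k t A] sets.sets_into_space[of A "F t"] by auto
  then have "A \<inter> {\<omega>\<in>space (F t). \<forall>u\<in>{k..t}. X u \<omega> \<in> I} = confined k A I t"
    by (auto simp: confined_def)
  ultimately show ?thesis by simp
qed

lemma confined_sets:
  "1 \<le> k \<Longrightarrow> k \<le> t \<Longrightarrow> A \<in> sets (F k) \<Longrightarrow> I \<in> sets borel \<Longrightarrow> confined k A I t \<in> sets M"
  using confined_F sets_F[of t] by auto

lemma confined_Suc: "k \<le> t \<Longrightarrow> A \<subseteq> space M \<Longrightarrow> confined k A I (Suc t) = confined k A I t \<inter> at_in (Suc t) I"
  by (auto simp: confined_def at_in_def le_Suc_eq)

lemma prob_confined_decomp:
  assumes k: "1 \<le> k" and A: "A \<in> sets (F k)" "\<And>\<omega>. \<omega> \<in> A \<Longrightarrow> X k \<omega> \<in> I" and I: "I \<in> sets borel"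
    and T: "T \<ge> k"
  shows "prob A = prob (confined k A I T) + (\<Sum>t=k..<T. prob (confined k A I t \<inter> at_in (Suc t) (- I)))"
  using T
proof (induction T rule: nat_induct_at_least)
  case base
  have "confined k A I k = A" using A(2) by (auto simp: confined_def)
  then show ?case by simp
next
  case (Suc n)
  have sp: "A \<subseteq> space M" using A k sets_F sets.sets_into_space by blast
  have meas: "confined k A I n \<in> sets M" using k Suc A I by (intro confined_sets) auto
  have "prob (confined k A I n) = prob (confined k A I n \<inter> at_in (Suc n) I \<union> confined k A I n \<inter> at_in (Suc n) (- I))"
    using sp by (intro arg_cong[where f = prob]) (auto simp: confined_def at_in_def)
  also have "\<dots> = prob (confined k A I n \<inter> at_in (Suc n) I) + prob (confined k A I n \<inter> at_in (Suc n) (- I))"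
    using meas I by (intro finite_measure_Union sets.Int at_in_sets) (auto simp: at_in_def)
  finally show ?case using Suc confined_Suc[OF _ sp, of k n I] by simp
qed

lemma exit_bound:
  assumes k: "1 \<le> k" and A: "A \<in> sets (F k)" and IE: "I \<in> sets borel" "E \<in> sets borel" "E \<inter> I = {}"
    and [measurable]: "G \<in> borel_measurable borel" and G0: "\<And>y. 0 \<le> G y"
    and nn: "0 \<le> d" "0 \<le> \<gamma>" "0 \<le> g0"
    and step: "\<And>t A. t \<ge> 1 \<Longrightarrow> A \<in> sets (F t) \<Longrightarrow> (\<And>\<omega>. \<omega> \<in> A \<Longrightarrow> X t \<omega> \<in> I) \<Longrightarrow>
      (\<integral>\<^sup>+\<omega>\<in>A. ennreal (G (X (Suc t) \<omega>)) \<partial>M) \<le> (\<integral>\<^sup>+\<omega>\<in>A. ennreal (G (X t \<omega>) + d) \<partial>M)"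
    and init: "\<And>\<omega>. \<omega> \<in> A \<Longrightarrow> G (X k \<omega>) \<le> g0"
    and exit: "\<And>y. y \<in> E \<Longrightarrow> \<gamma> \<le> G y"
    and T: "T \<ge> k"
  shows "\<gamma> * (\<Sum>t=k..<T. prob (confined k A I t \<inter> at_in (Suc t) E)) \<le> (g0 + real (T - k) * d) * prob A"
proof -
  have [measurable]: "A \<in> sets M" using A k sets_F by blast
  have sp: "A \<subseteq> space M" using sets.sets_into_space[OF \<open>A \<in> sets M\<close>] .
  let ?E = "\<lambda>t. confined k A I t \<inter> at_in (Suc t) E"
  have "(\<integral>\<^sup>+\<omega>\<in>confined k A I T. ennreal (G (X T \<omega>)) \<partial>M) + ennreal (\<gamma> * (\<Sum>t=k..<T. prob (?E t)))
      \<le> ennreal ((g0 + real (T - k) * d) * prob A)"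
    using T
  proof (induction T rule: nat_induct_at_least)
    case base
    have "(\<integral>\<^sup>+\<omega>\<in>confined k A I k. ennreal (G (X k \<omega>)) \<partial>M) \<le> (\<integral>\<^sup>+\<omega>. ennreal g0 * indicator A \<omega> \<partial>M)"
      using init by (intro nn_integral_mono) (auto simp: confined_def indicator_def intro!: ennreal_leI)
    also have "\<dots> = ennreal (g0 * prob A)"
      using nn by (subst nn_integral_cmult_indicator) (auto simp: emeasure_eq_measure ennreal_mult)
    finally show ?case by simp
  next
    case (Suc n)
    have n: "n \<ge> 1" using Suc k by simp
    have [measurable]: "X n \<in> borel_measurable M" "X (Suc n) \<in> borel_measurable M"
      using X_meas n by auto
    let ?B = "confined k A I n"
    have BF: "?B \<in> sets (F n)" using k Suc A IE by (intro confined_F) auto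
    have [measurable]: "?B \<in> sets M" using BF n sets_F by blast
    have [measurable]: "?E n \<in> sets M" "?B \<inter> at_in (Suc n) I \<in> sets M"
      using IE by (auto intro!: sets.Int at_in_sets)
    have "(\<integral>\<^sup>+\<omega>\<in>?B \<inter> at_in (Suc n) I. ennreal (G (X (Suc n) \<omega>)) \<partial>M) + ennreal (\<gamma> * prob (?E n))
      = (\<integral>\<^sup>+\<omega>\<in>?B \<inter> at_in (Suc n) I. ennreal (G (X (Suc n) \<omega>)) \<partial>M) + (\<integral>\<^sup>+\<omega>. ennreal \<gamma> * indicator (?E n) \<omega> \<partial>M)"
      using nn by (subst nn_integral_cmult_indicator) (auto simp: emeasure_eq_measure ennreal_mult)
    also have "\<dots> = (\<integral>\<^sup>+\<omega>. ennreal (G (X (Suc n) \<omega>)) * indicator (?B \<inter> at_in (Suc n) I) \<omega> + ennreal \<gamma> * indicator (?E n) \<omega> \<partial>M)"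
      by (rule nn_integral_add[symmetric]) measurable
    also have "\<dots> \<le> (\<integral>\<^sup>+\<omega>\<in>?B. ennreal (G (X (Suc n) \<omega>)) \<partial>M)"
    proof (rule nn_integral_mono)
      fix \<omega>
      show "ennreal (G (X (Suc n) \<omega>)) * indicator (?B \<inter> at_in (Suc n) I) \<omega> + ennreal \<gamma> * indicator (?E n) \<omega>
          \<le> ennreal (G (X (Suc n) \<omega>)) * indicator ?B \<omega>"
        using exit[of "X (Suc n) \<omega>"] IE(3)
        by (cases "X (Suc n) \<omega> \<in> I") (auto simp: indicator_def at_in_def intro!: ennreal_leI)
    qed
    also have "\<dots> \<le> (\<integral>\<^sup>+\<omega>\<in>?B. ennreal (G (X n \<omega>) + d) \<partial>M)"
      using Suc.hyps by (intro step[OF n BF]) (auto simp: confined_def)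
    also have "\<dots> = (\<integral>\<^sup>+\<omega>. ennreal (G (X n \<omega>)) * indicator ?B \<omega> + ennreal d * indicator ?B \<omega> \<partial>M)"
      using G0 nn by (intro nn_integral_cong) (auto simp: distrib_right)
    also have "\<dots> = (\<integral>\<^sup>+\<omega>\<in>?B. ennreal (G (X n \<omega>)) \<partial>M) + ennreal (d * prob ?B)"
      using nn by (subst nn_integral_add) (auto simp: nn_integral_cmult_indicator emeasure_eq_measure ennreal_mult)
    also have "\<dots> \<le> (\<integral>\<^sup>+\<omega>\<in>?B. ennreal (G (X n \<omega>)) \<partial>M) + ennreal (d * prob A)"
      using nn by (intro add_left_mono ennreal_leI mult_left_mono finite_measure_mono) (auto simp: confined_def)
    finally have step': "(\<integral>\<^sup>+\<omega>\<in>?B \<inter> at_in (Suc n) I. ennreal (G (X (Suc n) \<omega>)) \<partial>M) + ennreal (\<gamma> * prob (?E n))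
      \<le> (\<integral>\<^sup>+\<omega>\<in>?B. ennreal (G (X n \<omega>)) \<partial>M) + ennreal (d * prob A)" .
    have "(\<integral>\<^sup>+\<omega>\<in>confined k A I (Suc n). ennreal (G (X (Suc n) \<omega>)) \<partial>M) + ennreal (\<gamma> * (\<Sum>t=k..<Suc n. prob (?E t)))
      = ((\<integral>\<^sup>+\<omega>\<in>?B \<inter> at_in (Suc n) I. ennreal (G (X (Suc n) \<omega>)) \<partial>M) + ennreal (\<gamma> * prob (?E n))) + ennreal (\<gamma> * (\<Sum>t=k..<n. prob (?E t)))"
    proof -
      have "\<gamma> * (\<Sum>t=k..<Suc n. prob (?E t)) = \<gamma> * prob (?E n) + \<gamma> * (\<Sum>t=k..<n. prob (?E t))"
        using Suc.hyps by (simp add: algebra_simps)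
      then have "ennreal (\<gamma> * (\<Sum>t=k..<Suc n. prob (?E t))) = ennreal (\<gamma> * prob (?E n)) + ennreal (\<gamma> * (\<Sum>t=k..<n. prob (?E t)))"
        using nn by (simp add: ennreal_plus sum_nonneg)
      then show ?thesis using confined_Suc[OF Suc.hyps sp, of I] by (simp add: ac_simps)
    qed
    also have "\<dots> \<le> ((\<integral>\<^sup>+\<omega>\<in>?B. ennreal (G (X n \<omega>)) \<partial>M) + ennreal (d * prob A)) + ennreal (\<gamma> * (\<Sum>t=k..<n. prob (?E t)))"
      by (intro add_right_mono step')
    also have "\<dots> = ((\<integral>\<^sup>+\<omega>\<in>?B. ennreal (G (X n \<omega>)) \<partial>M) + ennreal (\<gamma> * (\<Sum>t=k..<n. prob (?E t)))) + ennreal (d * prob A)"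
      by (simp add: ac_simps)
    also have "\<dots> \<le> ennreal ((g0 + real (n - k) * d) * prob A) + ennreal (d * prob A)"
      by (intro add_right_mono Suc.IH)
    also have "\<dots> = ennreal ((g0 + real (n - k) * d) * prob A + d * prob A)"
      using nn by (intro ennreal_plus[symmetric]) auto
    also have "(g0 + real (n - k) * d) * prob A + d * prob A = (g0 + real (Suc n - k) * d) * prob A"
      using Suc.hyps by (simp add: Suc_diff_le algebra_simps)
    finally show ?case .
  qed
  then have "ennreal (\<gamma> * (\<Sum>t=k..<T. prob (?E t))) \<le> ennreal ((g0 + real (T - k) * d) * prob A)"
    by (rule order_trans[rotated]) simp
  then show ?thesis using nn by (subst (asm) ennreal_le_iff) auto
qed

lemma stay_bound:
  "\<exists>D>0. \<exists>x0. \<forall>x\<ge>x0. \<forall>k\<ge>1. \<forall>A\<in>sets (F k). (\<forall>\<omega>\<in>A. x \<le> X k \<omega>) \<longrightarrow>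
     (\<forall>s::nat. real s * D \<le> x\<^sup>2 \<longrightarrow> prob A / 2 \<le> prob (confined k A {x / 2..} (k + s)))"
proof -
  obtain x0 where x0: "\<And>t. t \<ge> 1 \<Longrightarrow> AE \<omega> in M. X t \<omega> \<ge> x0 \<longrightarrow>
               moments_close 1 t \<omega>"
    using drift[of 1] by auto
  define D0 where "D0 = 2 * \<bar>c\<bar> + s2 + 3"
  have D0: "D0 > 0" using s2_pos by (simp add: D0_def)
  have main: "prob A / 2 \<le> prob (confined k A {x / 2..} (k + s))"
    if x: "x \<ge> max 6 (2 * x0)" and k: "k \<ge> 1" and A: "A \<in> sets (F k)" "\<And>\<omega>. \<omega> \<in> A \<Longrightarrow> x \<le> X k \<omega>"
      and s: "real s * (8 * D0) \<le> x\<^sup>2" for x k A and s :: nat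
  proof -
    define G where "G y = (max 0 (1 - y / x))\<^sup>2" for y
    have [measurable]: "G \<in> borel_measurable borel" unfolding G_def by measurable
    have G0: "0 \<le> G y" for y by (simp add: G_def)
    define d where "d = D0 / x\<^sup>2"
    have x6: "x \<ge> 6" using x by simp
    have d0: "d \<ge> 0" using D0 by (simp add: d_def)
    define h1 where "h1 y = - 2 * max 0 (1 - y / x) / x" for y
    have [measurable]: "h1 \<in> borel_measurable borel" unfolding h1_def by measurable
    have h1b: "\<bar>h1 y\<bar> \<le> 1 / x" if "y \<ge> x / 2" for y
    proof -
      have "1 - y / x \<le> 1 / 2" using that x6 by (simp add: field_simps)
      then have "max 0 (1 - y / x) \<le> 1 / 2" unfolding max.bounded_iff by simp
      then have "\<bar>h1 y\<bar> \<le> 2 * (1 / 2) / x"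
        unfolding h1_def using x6 by (simp add: abs_mult divide_right_mono)
      then show ?thesis by simp
    qed
    have step: "(\<integral>\<^sup>+\<omega>\<in>A. ennreal (G (X (Suc t) \<omega>)) \<partial>M) \<le> (\<integral>\<^sup>+\<omega>\<in>A. ennreal (G (X t \<omega>) + d) \<partial>M)"
      if t: "t \<ge> 1" and A: "A \<in> sets (F t)" "\<And>\<omega>. \<omega> \<in> A \<Longrightarrow> X t \<omega> \<in> {x / 2..}" for t A
    proof -
      have "(\<integral>\<^sup>+\<omega>\<in>A. ennreal (G (X (Suc t) \<omega>) + (\<lambda>_. 0) (X t \<omega>)) \<partial>M) \<le> (\<integral>\<^sup>+\<omega>\<in>A. ennreal (G (X t \<omega>) + (\<lambda>_. d) (X t \<omega>)) \<partial>M)"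
      proof (rule one_step[where ?x1.0 = "x / 2" and \<epsilon> = 1 and ?h1.0 = h1 and ?h2.0 = "\<lambda>_. 1 / x\<^sup>2" and ?h3.0 = "\<lambda>_. 0"])
        show "AE \<omega> in M. X t \<omega> \<ge> x / 2 \<longrightarrow>
               moments_close 1 t \<omega>"
          using x0[OF t]
        proof eventually_elim
          case (elim \<omega>)
          then show ?case using x by fastforce
        qed
        show "\<exists>H. \<forall>y\<in>{x / 2..b}. \<bar>h1 y\<bar> \<le> H \<and> \<bar>1 / x\<^sup>2\<bar> \<le> H \<and> 0 \<le> H \<and> G y \<le> H \<and> 0 \<le> H \<and> d \<le> H" for b
        proof (intro exI[of _ "1 / x + 1 / x\<^sup>2 + 1 + d"] ballI)
          fix y assume y: "y \<in> {x / 2..b}"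
          have "G y \<le> 1\<^sup>2" unfolding G_def using y x6 by (intro power_mono) auto
          then have "G y \<le> 1" by simp
          moreover have "0 \<le> 1 / x\<^sup>2" "0 \<le> 1 / x" using x6 by auto
          moreover have "\<bar>h1 y\<bar> \<le> 1 / x" using y by (intro h1b) auto
          ultimately show "\<bar>h1 y\<bar> \<le> 1 / x + 1 / x\<^sup>2 + 1 + d \<and> \<bar>1 / x\<^sup>2\<bar> \<le> 1 / x + 1 / x\<^sup>2 + 1 + d \<and> 0 \<le> 1 / x + 1 / x\<^sup>2 + 1 + d
             \<and> G y \<le> 1 / x + 1 / x\<^sup>2 + 1 + d \<and> 0 \<le> 1 / x + 1 / x\<^sup>2 + 1 + d \<and> d \<le> 1 / x + 1 / x\<^sup>2 + 1 + d"
            using d0 by (intro conjI) linarith+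
        qed
        show "G (y + e) \<le> G y + h1 y * e + 1 / x\<^sup>2 * e\<^sup>2 + 0 * \<bar>e\<bar> powr p" for y e
        proof -
          define u v where "u = max 0 (1 - y / x)" and "v = - e / x"
          have "1 - (y + e) / x = (1 - y / x) + v" by (simp add: v_def add_divide_distrib)
          then have "0 \<le> max 0 (1 - (y + e) / x)" "max 0 (1 - (y + e) / x) \<le> \<bar>u + v\<bar>"
            unfolding u_def by linarith+
          then have "G (y + e) \<le> \<bar>u + v\<bar>\<^sup>2" unfolding G_def by (intro power_mono)
          also have "\<dots> = u\<^sup>2 + 2 * u * v + v\<^sup>2" by (simp add: power2_sum)
          also have "\<dots> = G y + h1 y * e + 1 / x\<^sup>2 * e\<^sup>2"
            by (simp add: G_def h1_def u_def v_def power_divide)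
          finally show ?thesis by simp
        qed
        show "h1 y * (c / y) + 1 / x\<^sup>2 * s2 + \<bar>h1 y\<bar> * (1 / (y * ln y)) + \<bar>1 / x\<^sup>2\<bar> * (1 / ln y)
          + 0 * (C * (1 + y) powr (p - 2 - \<delta>)) + 0 \<le> d" if y: "x / 2 \<le> y" for y
        proof -
          have y3: "y \<ge> 3" "ln y \<ge> 1" using y x6 ln_ge_1[of y] by auto
          have iy: "1 / y \<le> 2 / x" using y x6 y3 by (simp add: field_simps)
          have "h1 y * (c / y) \<le> \<bar>h1 y\<bar> * (\<bar>c\<bar> * (1 / y))"
          proof -
            have "h1 y * (c / y) \<le> \<bar>h1 y * (c / y)\<bar>" by (rule abs_ge_self)
            also have "\<dots> = \<bar>h1 y\<bar> * (\<bar>c\<bar> * (1 / y))" using y3 by (simp add: abs_mult abs_divide)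
            finally show ?thesis .
          qed
          also have "\<dots> \<le> 1 / x * (\<bar>c\<bar> * (2 / x))"
            using h1b[OF y] iy y3 x6 by (intro mult_mono mult_left_mono) auto
          finally have 1: "h1 y * (c / y) \<le> 2 * \<bar>c\<bar> / x\<^sup>2" by (simp add: power2_eq_square mult.commute)
          have "1 / (y * ln y) \<le> 1 / (y * 1)"
            using y3 by (intro divide_left_mono mult_left_mono) auto
          then have "1 / (y * ln y) \<le> 2 / x" using iy by simp
          then have "\<bar>h1 y\<bar> * (1 / (y * ln y)) \<le> 1 / x * (2 / x)"
            using h1b[OF y] y3 x6 by (intro mult_mono) auto
          then have 2: "\<bar>h1 y\<bar> * (1 / (y * ln y)) \<le> 2 / x\<^sup>2" by (simp add: power2_eq_square)
          have "1 / ln y \<le> 1" using y3 by simp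
          then have 3: "\<bar>1 / x\<^sup>2\<bar> * (1 / ln y) \<le> 1 / x\<^sup>2 * 1"
            using y3 by (intro mult_mono) auto
          have "d = 2 * \<bar>c\<bar> / x\<^sup>2 + 1 / x\<^sup>2 * s2 + 2 / x\<^sup>2 + 1 / x\<^sup>2"
            by (simp add: d_def D0_def add_divide_distrib)
          then show ?thesis using 1 2 3 by linarith
        qed
      qed (use t A x6 G0 d0 in auto)
      then show ?thesis by simp
    qed
    have init: "G (X k \<omega>) \<le> 0" if "\<omega> \<in> A" for \<omega>
      using A(2)[OF that] x6 by (simp add: G_def)
    have exit: "1 / 4 \<le> G y" if "y \<in> {..<x / 2}" for y
    proof -
      have "1 / 2 \<le> max 0 (1 - y / x)" using that x6 by (simp add: field_simps max_def)
      then have "(1 / 2)\<^sup>2 \<le> G y" unfolding G_def by (rule power_mono) simp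
      then show ?thesis by (simp add: power_divide)
    qed
    have "1 / 4 * (\<Sum>t=k..<k + s. prob (confined k A {x / 2..} t \<inter> at_in (Suc t) {..<x / 2})) \<le> (0 + real (k + s - k) * d) * prob A"
      by (rule exit_bound[OF k A(1) _ _ _ _ G0 d0 _ _ step init exit]) auto
    moreover have "prob A = prob (confined k A {x / 2..} (k + s)) + (\<Sum>t=k..<k + s. prob (confined k A {x / 2..} t \<inter> at_in (Suc t) (- {x / 2..})))"
    proof (rule prob_confined_decomp[OF k A(1)])
      show "X k \<omega> \<in> {x / 2..}" if "\<omega> \<in> A" for \<omega> using A(2)[OF that] x6 by simp
    qed auto
    moreover have "- {x / 2..} = {..<x / 2}" by auto
    moreover have "real s * d * prob A \<le> 1 / 8 * prob A"
    proof -
      have "real s * D0 \<le> x\<^sup>2 / 8" using s by simp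
      then have "real s * d \<le> 1 / 8" unfolding d_def using x6 by (simp add: field_simps)
      then show ?thesis by (intro mult_right_mono) auto
    qed
    ultimately show ?thesis by simp
  qed
  show ?thesis
  proof (rule exI[of _ "8 * D0"], rule conjI)
    show "0 < 8 * D0" using D0 by simp
  qed (rule exI[of _ "max 6 (2 * x0)"], use main in blast)
qed

lemma reach_bound:
  assumes a: "a > 0" "a \<le> 2" and c: "c = - (a - 1) * s2 / 2"
    and visit: "\<And>y. \<exists>y0>y. \<exists>k\<ge>1. prob (alive k \<inter> at_in k {y0}) > 0"
    and recur: "(\<lambda>t. prob (alive t)) \<longlonglongrightarrow> 0"
  shows "\<exists>\<gamma>>0. \<exists>x0. \<exists>k\<ge>1. \<exists>A\<in>sets (F k). \<exists>x1\<ge>0. A \<subseteq> alive k \<and>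
    (\<forall>x\<ge>x0. \<exists>T\<ge>k. (\<Sum>t=k..<T. prob (confined k A {x1<..<x} t \<inter> at_in (Suc t) {x..})) \<ge> \<gamma> / powr_ln a 1 (2 * x))"
proof -
  have sg: "- sgn (1::real) = -1" by simp
  obtain \<epsilon> x1 h1 h2 h3 where \<epsilon>: "\<epsilon> > 0" and x1: "x1 \<ge> 3"
    and [measurable]: "h1 \<in> borel_measurable borel" "h2 \<in> borel_measurable borel" "h3 \<in> borel_measurable borel"
    and h3: "\<And>y. 0 \<le> h3 y"
    and loc: "\<And>b. \<exists>H. \<forall>y\<in>{x1..b}. \<bar>h1 y\<bar> \<le> H \<and> \<bar>h2 y\<bar> \<le> H \<and> h3 y \<le> H"
    and gen: "\<And>y. y \<ge> x1 \<Longrightarrow> h1 y * (c / y) + h2 y * s2 + \<bar>h1 y\<bar> * (\<epsilon> / (y * ln y)) + \<bar>h2 y\<bar> * (\<epsilon> / ln y)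
      + h3 y * (C * (1 + y) powr (p - 2 - \<delta>)) + s2 * \<bar>1\<bar> * a / 8 * powr_ln (a - 2) (1 - 1) y \<le> 0"
    and tay: "\<And>G y d. y \<ge> x1 \<Longrightarrow> y + d \<ge> 0 \<Longrightarrow> (\<forall>z. y / 2 \<le> z \<longrightarrow> z \<le> 3 * y / 2 \<longrightarrow> G z = powr_ln a 1 z) \<Longrightarrow>
      (\<forall>z\<ge>0. \<bar>G z\<bar> \<le> powr_ln a 1 (max z 3)) \<Longrightarrow>
      - 1 * G (y + d) \<le> - 1 * G y + h1 y * d + h2 y * d\<^sup>2 + h3 y * \<bar>d\<bar> powr p"
    using powr_ln_lyapunov[of a s2 1 c p \<delta> C, unfolded sg] a s2_pos c p \<delta> C by auto
  obtain x0 where x0: "\<And>t. t \<ge> 1 \<Longrightarrow> AE \<omega> in M. X t \<omega> \<ge> x0 \<longrightarrow>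
               moments_close \<epsilon> t \<omega>"
    using drift[OF \<epsilon>] by blast
  define x2 where "x2 = max 6 (max x0 x1)"
  have x2: "x2 \<ge> 6" "x2 \<ge> x0" "x2 \<ge> x1" by (auto simp: x2_def)
  obtain y0 k where y0: "y0 > x2" and k: "k \<ge> 1" and pos: "prob (alive k \<inter> at_in k {y0}) > 0"
    using visit by blast
  define A where "A = alive k \<inter> at_in k {y0}"
  have AF: "A \<in> sets (F k)" unfolding A_def using k by (intro sets.Int alive_F at_in_F) auto
  have Ay: "X k \<omega> = y0" if "\<omega> \<in> A" for \<omega> using that by (simp add: A_def at_in_def)
  let ?f = "powr_ln a 1"
  have fmono: "?f y \<le> ?f z" if "3 \<le> y" "y \<le> z" for y z
    using that a by (intro powr_ln_mono) auto
  have fstrict: "?f x2 < ?f y0"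
    unfolding powr_ln_def using x2 y0 a ln_ge_1[of x2]
    by (intro mult_strict_mono powr_less_mono2) auto
  define \<gamma> where "\<gamma> = prob A * (?f y0 - ?f x2) / 2"
  have \<gamma>: "\<gamma> > 0" using pos fstrict by (simp add: \<gamma>_def A_def)
  have main: "\<exists>T\<ge>k. (\<Sum>t=k..<T. prob (confined k A {x2<..<x} t \<inter> at_in (Suc t) {x..})) \<ge> \<gamma> / ?f (2 * x)"
    if x: "x > y0" for x
  proof -
    let ?I = "{x2<..<x}"
    \<comment> \<open>Capping at \<open>2 * x\<close> makes the overshoot harmless and does not affect the Taylor bound below \<open>x\<close>.\<close>
    define Fc where "Fc y = ?f (min (max y 3) (2 * x))" for y
    define G where "G y = ?f (2 * x) - Fc y" for y
    have xx: "x \<ge> 6" using x x2 y0 by simp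
    have f2x: "?f (2 * x) > 0" using xx by (simp add: powr_ln_pos)
    have [measurable]: "G \<in> borel_measurable borel" unfolding G_def Fc_def by measurable
    have G0: "0 \<le> G y" for y
      unfolding G_def Fc_def using fmono[of "min (max y 3) (2 * x)" "2 * x"] xx by simp
    have step: "(\<integral>\<^sup>+\<omega>\<in>B. ennreal (G (X (Suc t) \<omega>)) \<partial>M) \<le> (\<integral>\<^sup>+\<omega>\<in>B. ennreal (G (X t \<omega>) + 0) \<partial>M)"
      if t: "t \<ge> 1" and B: "B \<in> sets (F t)" "\<And>\<omega>. \<omega> \<in> B \<Longrightarrow> X t \<omega> \<in> ?I" for t B
    proof -
      obtain H where H: "\<forall>y\<in>{x1..x}. \<bar>h1 y\<bar> \<le> H \<and> \<bar>h2 y\<bar> \<le> H \<and> h3 y \<le> H" using loc by blast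
      have "(\<integral>\<^sup>+\<omega>\<in>B. ennreal (G (X (Suc t) \<omega>) + (\<lambda>_. 0) (X t \<omega>)) \<partial>M) \<le> (\<integral>\<^sup>+\<omega>\<in>B. ennreal (G (X t \<omega>) + (\<lambda>_. 0) (X t \<omega>)) \<partial>M)"
      proof (rule one_step_bounded[where ?x1.0 = x2 and b = x and H = "max H (?f (2 * x))" and \<epsilon> = \<epsilon> and ?h1.0 = h1 and ?h2.0 = h2 and ?h3.0 = h3])
        show "AE \<omega> in M. X t \<omega> \<ge> x2 \<longrightarrow>
               moments_close \<epsilon> t \<omega>"
          using x0[OF t] x2 by (auto elim!: eventually_mono)
        show "\<bar>h1 y\<bar> \<le> max H (?f (2 * x)) \<and> \<bar>h2 y\<bar> \<le> max H (?f (2 * x)) \<and> h3 y \<le> max H (?f (2 * x)) \<and> G y \<le> max H (?f (2 * x))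
          \<and> 0 \<le> max H (?f (2 * x)) \<and> 0 \<le> max H (?f (2 * x))" if "x2 \<le> y" "y \<le> x" for y
        proof -
          have "\<bar>h1 y\<bar> \<le> H \<and> \<bar>h2 y\<bar> \<le> H \<and> h3 y \<le> H" using H that x2 by auto
          moreover have "G y \<le> ?f (2 * x)" by (simp add: G_def Fc_def)
          ultimately show ?thesis using f2x by (auto simp: le_max_iff_disj)
        qed
        show "G (y + e) \<le> G y + h1 y * e + h2 y * e\<^sup>2 + h3 y * \<bar>e\<bar> powr p"
          if "x2 \<le> y" "y \<le> x" "0 \<le> y + e" for y e
        proof -
          have "- 1 * Fc (y + e) \<le> - 1 * Fc y + h1 y * e + h2 y * e\<^sup>2 + h3 y * \<bar>e\<bar> powr p"
          proof (rule tay)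
            show "\<forall>z. y / 2 \<le> z \<longrightarrow> z \<le> 3 * y / 2 \<longrightarrow> Fc z = ?f z"
            proof (intro allI impI)
              fix z assume "y / 2 \<le> z" "z \<le> 3 * y / 2"
              then have "z \<ge> 3" "z \<le> 2 * x" using that x2 by linarith+
              then show "Fc z = ?f z" by (simp add: Fc_def)
            qed
            show "\<forall>z\<ge>0. \<bar>Fc z\<bar> \<le> ?f (max z 3)"
            proof (intro allI impI)
              fix z :: real
              have "Fc z \<le> ?f (max z 3)" unfolding Fc_def using xx by (intro fmono) auto
              then show "\<bar>Fc z\<bar> \<le> ?f (max z 3)" by (simp add: Fc_def)
            qed
          qed (use that x2 in auto)
          then show ?thesis by (simp add: G_def)
        qed
        show "h1 y * (c / y) + h2 y * s2 + \<bar>h1 y\<bar> * (\<epsilon> / (y * ln y)) + \<bar>h2 y\<bar> * (\<epsilon> / ln y)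
          + h3 y * (C * (1 + y) powr (p - 2 - \<delta>)) + 0 \<le> 0" if "x2 \<le> y" "y \<le> x" for y
        proof -
          have "0 \<le> s2 * \<bar>1\<bar> * a / 8 * powr_ln (a - 2) (1 - 1) y" using s2_pos a by simp
          then show ?thesis using gen[of y] that x2 by linarith
        qed
      qed (use t B x2 \<epsilon> G0 h3 in \<open>auto simp: less_imp_le\<close>)
      then show ?thesis by simp
    qed
    have init: "G (X k \<omega>) \<le> ?f (2 * x) - ?f y0" if "\<omega> \<in> A" for \<omega>
      using Ay[OF that] x x2 y0 by (simp add: G_def Fc_def max_def min_def)
    have exit: "?f (2 * x) - ?f x2 \<le> G y" if "y \<in> {..x2}" for y
      unfolding G_def Fc_def using fmono[of "min (max y 3) (2 * x)" x2] that x2 xx by simp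
    have g1: "0 \<le> ?f (2 * x) - ?f x2" using fmono[of x2 "2 * x"] x2 x y0 by simp
    have g2: "0 \<le> ?f (2 * x) - ?f y0" using fmono[of y0 "2 * x"] x2 x y0 by simp
    have "(\<lambda>t. prob (alive t) * ?f (2 * x)) \<longlonglongrightarrow> 0 * ?f (2 * x)"
      by (intro tendsto_intros recur)
    then have "\<forall>\<^sub>F t in sequentially. prob (alive t) * ?f (2 * x) < \<gamma>"
      using \<gamma> by (intro order_tendstoD) auto
    then obtain T where T: "T \<ge> k" "prob (alive T) * ?f (2 * x) < \<gamma>"
      unfolding eventually_sequentially by (meson nat_le_linear order_refl)
    let ?u = "\<Sum>t=k..<T. prob (confined k A ?I t \<inter> at_in (Suc t) {..x2})"
    let ?v = "\<Sum>t=k..<T. prob (confined k A ?I t \<inter> at_in (Suc t) {x..})"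
    have u: "(?f (2 * x) - ?f x2) * ?u \<le> (?f (2 * x) - ?f y0 + real (T - k) * 0) * prob A"
      by (rule exit_bound[OF k AF _ _ _ _ G0 _ g1 g2 step init exit T(1)]) auto
    have "prob A = prob (confined k A ?I T) + (\<Sum>t=k..<T. prob (confined k A ?I t \<inter> at_in (Suc t) (- ?I)))"
      using Ay y0 x by (intro prob_confined_decomp[OF k AF _ _ T(1)]) auto
    also have "(\<Sum>t=k..<T. prob (confined k A ?I t \<inter> at_in (Suc t) (- ?I))) = ?u + ?v"
    proof -
      have "prob (confined k A ?I t \<inter> at_in (Suc t) (- ?I)) =
          prob (confined k A ?I t \<inter> at_in (Suc t) {..x2}) + prob (confined k A ?I t \<inter> at_in (Suc t) {x..})"
        if "t \<in> {k..<T}" for t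
      proof -
        have "confined k A ?I t \<inter> at_in (Suc t) (- ?I) =
            (confined k A ?I t \<inter> at_in (Suc t) {..x2}) \<union> (confined k A ?I t \<inter> at_in (Suc t) {x..})"
          by (auto simp: at_in_def)
        then show ?thesis
          using that k AF x y0 confined_sets[of k t A ?I]
          by (simp only:) (intro finite_measure_Union sets.Int at_in_sets; auto simp: at_in_def)
      qed
      then show ?thesis by (simp add: sum.distrib)
    qed
    finally have dec: "prob A = prob (confined k A ?I T) + (?u + ?v)" .
    have "confined k A ?I T \<subseteq> alive T"
    proof
      fix \<omega> assume w: "\<omega> \<in> confined k A ?I T"
      then have "\<omega> \<in> alive k" by (simp add: confined_def A_def)
      moreover have "X u \<omega> > x2" if "k \<le> u" "u \<le> T" for u
        using w that by (auto simp: confined_def)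
      ultimately show "\<omega> \<in> alive T" using x2 unfolding alive_def
        by (smt (verit) mem_Collect_eq nat_le_linear)
    qed
    then have cT: "prob (confined k A ?I T) \<le> prob (alive T)"
      by (intro finite_measure_mono alive_sets)
    have "prob A * (?f y0 - ?f x2) = prob A * (?f (2 * x) - ?f x2) - prob A * (?f (2 * x) - ?f y0)"
      by (simp add: algebra_simps)
    also have "\<dots> \<le> prob A * (?f (2 * x) - ?f x2) - (?f (2 * x) - ?f x2) * ?u"
      using u by (simp add: mult.commute)
    also have "\<dots> = (?f (2 * x) - ?f x2) * (prob (confined k A ?I T) + ?v)"
      by (subst (1) dec) (simp add: algebra_simps)
    also have "\<dots> \<le> ?f (2 * x) * (prob (alive T) + ?v)"
      using cT g1 by (intro mult_mono add_mono add_nonneg_nonneg sum_nonneg) auto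
    also have "\<dots> \<le> \<gamma> + ?f (2 * x) * ?v" using T(2) by (simp add: algebra_simps)
    finally have "\<gamma> \<le> ?f (2 * x) * ?v" by (simp add: \<gamma>_def)
    then have "\<gamma> / ?f (2 * x) \<le> ?v" using f2x by (simp add: pos_divide_le_eq mult.commute)
    then show ?thesis using T(1) by blast
  qed
  show ?thesis
  proof (rule exI[of _ \<gamma>], rule conjI, rule \<gamma>, rule exI[of _ "y0 + 1"], rule exI[of _ k], rule conjI,
      rule k, rule bexI[OF _ AF], rule exI[of _ x2], intro conjI allI impI)
    show "0 \<le> x2" using x2 by simp
    show "A \<subseteq> alive k" by (auto simp: A_def)
  qed (use main in auto)
qed

lemma tail_lower_bound:
  assumes a: "a > 0" "a \<le> 2" and c: "c = - (a - 1) * s2 / 2"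
    and visit: "\<And>y. \<exists>y0>y. \<exists>k\<ge>1. prob (alive k \<inter> at_in k {y0}) > 0"
    and recur: "(\<lambda>t. prob (alive t)) \<longlonglongrightarrow> 0"
  shows "\<exists>\<gamma>>0. \<exists>s0. \<forall>s\<ge>s0. prob (alive s) \<ge> \<gamma> * (real s powr (- a / 2) / ln (real s))"
proof -
  obtain D xs where D: "D > 0" and st: "\<forall>x\<ge>xs. \<forall>k\<ge>1. \<forall>A\<in>sets (F k). (\<forall>\<omega>\<in>A. x \<le> X k \<omega>) \<longrightarrow>
     (\<forall>s::nat. real s * D \<le> x\<^sup>2 \<longrightarrow> prob A / 2 \<le> prob (confined k A {x / 2..} (k + s)))"
    using stay_bound by (elim exE conjE)
  have stay: "prob A / 2 \<le> prob (confined k A {x / 2..} (k + s))"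
    if "x \<ge> xs" "k \<ge> 1" "A \<in> sets (F k)" "\<forall>\<omega>\<in>A. x \<le> X k \<omega>" "real s * D \<le> x\<^sup>2" for x k A s
    using st[rule_format, OF that(1-3)] that(4,5) by blast
  obtain \<gamma> x0 k A x1 where \<gamma>: "\<gamma> > 0" and k: "k \<ge> 1" and A: "A \<in> sets (F k)" "A \<subseteq> alive k" and x1: "x1 \<ge> 0"
    and reach: "\<forall>x\<ge>x0. \<exists>T\<ge>k. (\<Sum>t=k..<T. prob (confined k A {x1<..<x} t \<inter> at_in (Suc t) {x..})) \<ge> \<gamma> / powr_ln a 1 (2 * x)"
    using reach_bound[OF a c visit recur] by (elim exE conjE bexE)
  have main: "prob (alive s) \<ge> \<gamma> / 2 / powr_ln a 1 (2 * x)"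
    if x: "x \<ge> max 1 (max xs x0)" "real s * D \<le> x\<^sup>2" for x s
  proof -
    obtain T where T: "T \<ge> k" and v: "(\<Sum>t=k..<T. prob (confined k A {x1<..<x} t \<inter> at_in (Suc t) {x..})) \<ge> \<gamma> / powr_ln a 1 (2 * x)"
      using reach[rule_format, of x] x by auto
    define E where "E t = confined k A {x1<..<x} t \<inter> at_in (Suc t) {x..}" for t
    define E' where "E' t = confined (Suc t) (E t) {x / 2..} (Suc t + s)" for t
    have EF: "E t \<in> sets (F (Suc t))" if "t \<ge> k" for t
      unfolding E_def using that k A
      by (intro sets.Int at_in_F sets_F_mono[of t "Suc t", OF _ _ confined_F]) auto
    have E'F: "E' t \<in> sets M" if "t \<ge> k" for t
      unfolding E'_def using EF[OF that] by (intro confined_sets) auto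
    have st: "prob (E t) / 2 \<le> prob (E' t)" if "t \<ge> k" for t
      unfolding E'_def using EF[OF that] x by (intro stay) (auto simp: E_def at_in_def)
    have disj: "disjoint_family_on E' {k..<T}"
      unfolding disjoint_family_on_def
    proof (intro ballI impI)
      have *: "E' i \<inter> E' j = {}" if "i < j" "k \<le> i" for i j
      proof -
        have "X (Suc i) \<omega> \<ge> x" if "\<omega> \<in> E' i" for \<omega> using that by (auto simp: E'_def confined_def E_def at_in_def)
        moreover have "X (Suc i) \<omega> < x" if "\<omega> \<in> E' j" for \<omega>
          using that \<open>i < j\<close> \<open>k \<le> i\<close> by (auto simp: E'_def confined_def E_def at_in_def)
        ultimately show ?thesis by fastforce
      qed
      show "E' i \<inter> E' j = {}" if "i \<in> {k..<T}" "j \<in> {k..<T}" "i \<noteq> j" for i j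
        using that *[of i j] *[of j i] by (cases "i < j") auto
    qed
    have sub: "E' t \<subseteq> alive s" if "t \<ge> k" for t
    proof
      fix \<omega> assume w: "\<omega> \<in> E' t"
      then have wk: "\<omega> \<in> alive k" using A by (auto simp: E'_def E_def confined_def)
      have w1: "X u \<omega> > x1" if "k \<le> u" "u \<le> t" for u
        using w that by (auto simp: E'_def E_def confined_def)
      have w2: "X u \<omega> \<ge> x / 2" if "Suc t \<le> u" "u \<le> Suc t + s" for u
        using w that by (auto simp: E'_def confined_def)
      have "X u \<omega> \<noteq> 0" if "1 < u" "u \<le> s" for u
      proof -
        consider "u \<le> k" | "k \<le> u" "u \<le> t" | "Suc t \<le> u" by linarith
        then show ?thesis
        proof cases
          case 1 then show ?thesis using wk that by (auto simp: alive_def)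
        next
          case 2 then show ?thesis using w1[of u] x1 by auto
        next
          case 3 then show ?thesis using w2[of u] that x by auto
        qed
      qed
      then show "\<omega> \<in> alive s" using wk by (auto simp: alive_def)
    qed
    have "\<gamma> / 2 / powr_ln a 1 (2 * x) = (\<gamma> / powr_ln a 1 (2 * x)) / 2" by simp
    also have "\<dots> \<le> (\<Sum>t=k..<T. prob (E t)) / 2" using v by (simp add: E_def)
    also have "\<dots> = (\<Sum>t=k..<T. prob (E t) / 2)" by (simp add: sum_divide_distrib)
    also have "\<dots> \<le> (\<Sum>t=k..<T. prob (E' t))" using st by (intro sum_mono) auto
    also have "\<dots> = prob (\<Union>t\<in>{k..<T}. E' t)"
      using E'F disj by (intro finite_measure_finite_Union[symmetric]) auto
    also have "\<dots> \<le> prob (alive s)" by (intro finite_measure_mono alive_sets UN_least sub) auto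
    finally show ?thesis .
  qed
  define L where "L = max 1 (2 * sqrt D)"
  have L: "L \<ge> 1" "2 * sqrt D \<le> L" by (auto simp: L_def)
  define \<gamma>' where "\<gamma>' = \<gamma> / 2 / L powr a"
  have \<gamma>': "\<gamma>' > 0" using \<gamma> L by (simp add: \<gamma>'_def)
  have "\<forall>\<^sub>F s::nat in sequentially. sqrt (real s * D) \<ge> max 3 (max xs x0)"
  proof -
    have "filterlim (\<lambda>s::nat. sqrt (real s * D)) at_top sequentially" using D by real_asymp
    then show ?thesis unfolding filterlim_at_top by blast
  qed
  moreover have "\<forall>\<^sub>F s::nat in sequentially. real s \<ge> L\<^sup>2 \<and> real s \<ge> 3"
  proof -
    have "\<forall>\<^sub>F s::nat in sequentially. real s \<ge> max (L\<^sup>2) 3"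
      using filterlim_real_sequentially unfolding filterlim_at_top by blast
    then show ?thesis by (rule eventually_mono) auto
  qed
  ultimately have "\<forall>\<^sub>F s in sequentially. prob (alive s) \<ge> \<gamma>' * (real s powr (- a / 2) / ln (real s))"
  proof eventually_elim
    case (elim s)
    define x where "x = sqrt (real s * D)"
    have x: "x \<ge> 3" "x \<ge> xs" "x \<ge> x0" using elim(1) by (auto simp: x_def)
    have x2: "x\<^sup>2 = real s * D" using D by (simp add: x_def)
    have s3: "real s \<ge> 3" "ln (real s) \<ge> 1" using elim(2) ln_ge_1 by auto
    have "2 * x \<le> L * sqrt (real s)"
    proof -
      have "2 * x = 2 * sqrt D * sqrt (real s)" by (simp add: x_def real_sqrt_mult)
      also have "\<dots> \<le> L * sqrt (real s)" using L by (intro mult_right_mono) auto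
      finally show ?thesis .
    qed
    then have "powr_ln a 1 (2 * x) \<le> powr_ln a 1 (L * sqrt (real s))"
      using x a by (intro powr_ln_mono) auto
    also have "\<dots> \<le> L powr a * (real s powr (a / 2) * ln (real s))"
    proof -
      have Ls: "L * sqrt (real s) \<ge> 1"
        using \<open>2 * x \<le> L * sqrt (real s)\<close> x by simp
      have "L \<le> sqrt (real s)" using elim(2) L by (intro real_le_rsqrt) auto
      then have "L * sqrt (real s) \<le> sqrt (real s) * sqrt (real s)" by (intro mult_right_mono) auto
      then have "L * sqrt (real s) \<le> real s" by simp
      then have "ln (L * sqrt (real s)) \<le> ln (real s)" using Ls by simp
      moreover have "0 \<le> ln (L * sqrt (real s))" using Ls by simp
      moreover have "(L * sqrt (real s)) powr a = L powr a * real s powr (a / 2)"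
        using s3 L by (simp add: powr_mult powr_half_sqrt[symmetric] powr_powr)
      ultimately show ?thesis by (simp add: powr_ln_def mult.assoc mult_left_mono)
    qed
    finally have le: "powr_ln a 1 (2 * x) \<le> L powr a * (real s powr (a / 2) * ln (real s))" .
    have pos: "powr_ln a 1 (2 * x) > 0" using x by (simp add: powr_ln_pos)
    have e: "real s powr (- a / 2) = inverse (real s powr (a / 2))"
      using powr_minus[of "real s" "a / 2"] by simp
    have "\<gamma>' * (real s powr (- a / 2) / ln (real s)) = (\<gamma> / 2) / (L powr a * (real s powr (a / 2) * ln (real s)))"
      unfolding e \<gamma>'_def by (simp only: divide_inverse inverse_mult_distrib mult.assoc)
    also have "\<dots> \<le> \<gamma> / 2 / powr_ln a 1 (2 * x)"
      using \<gamma> le pos s3 L by (intro divide_left_mono mult_pos_pos) auto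
    also have "\<dots> \<le> prob (alive s)" using x x2 by (intro main) auto
    finally show ?case .
  qed
  then obtain s0 where "\<forall>s\<ge>s0. prob (alive s) \<ge> \<gamma>' * (real s powr (- a / 2) / ln (real s))"
    unfolding eventually_sequentially by blast
  then show ?thesis using \<gamma>' by blast
qed

end

section \<open>The strong law for non-negative i.i.d. variables\<close>

lemma geometric_sum_below:
  fixes \<alpha> x :: real
  assumes "\<alpha> > 1" "x \<ge> 0"
  shows "(\<Sum>n<N. if \<alpha> ^ n < x then \<alpha> ^ n else 0) \<le> \<alpha> / (\<alpha> - 1) * x"
proof (induction N)
  case 0
  then show ?case using assms by simp
next
  case (Suc N)
  show ?case
  proof (cases "\<alpha> ^ N < x")
    case True
    have "(\<Sum>n<Suc N. if \<alpha> ^ n < x then \<alpha> ^ n else 0) \<le> (\<Sum>n<Suc N. \<alpha> ^ n)"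
      using assms by (intro sum_mono) auto
    also have "\<dots> = (\<alpha> ^ Suc N - 1) / (\<alpha> - 1)"
      using assms by (subst geometric_sum) auto
    also have "\<dots> \<le> (\<alpha> * x) / (\<alpha> - 1)"
    proof (rule divide_right_mono)
      have "\<alpha> * \<alpha> ^ N \<le> \<alpha> * x" using True assms by (intro mult_left_mono) auto
      then show "\<alpha> ^ Suc N - 1 \<le> \<alpha> * x" by simp
    qed (use assms in simp)
    finally show ?thesis by simp
  qed (use Suc in simp)
qed

lemma geometric_sum_above:
  fixes \<alpha> x :: real
  assumes "\<alpha> > 1" "x > 0"
  shows "(\<Sum>n<N. if x \<le> \<alpha> ^ n then 1 / \<alpha> ^ n else 0) \<le> \<alpha> / (\<alpha> - 1) / x"
proof -
  have "(\<Sum>n<N. if x \<le> \<alpha> ^ n then 1 / \<alpha> ^ n else 0)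
      + (if x \<le> \<alpha> ^ N then \<alpha> / (\<alpha> - 1) / \<alpha> ^ N else 0) \<le> \<alpha> / (\<alpha> - 1) / x"
  proof (induction N)
    case 0
    have "\<alpha> / (\<alpha> - 1) / 1 \<le> \<alpha> / (\<alpha> - 1) / x" if "x \<le> 1"
      using assms that by (intro divide_left_mono divide_nonneg_nonneg) auto
    then show ?case using assms by auto
  next
    case (Suc N)
    consider "x \<le> \<alpha> ^ N" | "\<alpha> ^ N < x" "x \<le> \<alpha> ^ Suc N" | "\<alpha> ^ Suc N < x" by linarith
    then show ?case
    proof cases
      case 1
      have le: "\<alpha> ^ N \<le> \<alpha> ^ Suc N" using assms by (intro power_increasing) auto
      have "1 / \<alpha> ^ N + \<alpha> / (\<alpha> - 1) / \<alpha> ^ Suc N = \<alpha> / (\<alpha> - 1) / \<alpha> ^ N"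
        using assms by (simp add: field_simps)
      then show ?thesis using Suc 1 le by simp
    next
      case 2
      have "x > \<alpha> ^ n" if "n \<le> N" for n
        using power_increasing[of n N \<alpha>] that assms 2(1) by linarith
      then have "(\<Sum>n<Suc N. if x \<le> \<alpha> ^ n then 1 / \<alpha> ^ n else 0) = 0"
        by (intro sum.neutral ballI if_not_P) (simp add: not_le)
      moreover have "\<alpha> / (\<alpha> - 1) / \<alpha> ^ Suc N \<le> \<alpha> / (\<alpha> - 1) / x"
        using assms 2 by (intro divide_left_mono divide_nonneg_nonneg mult_pos_pos) auto
      ultimately show ?thesis using 2 by simp
    next
      case 3
      have le: "\<alpha> ^ N \<le> \<alpha> ^ Suc N" using assms by (intro power_increasing) auto
      show ?thesis using Suc 3 le by simp
    qed
  qed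
  moreover have "0 \<le> (if x \<le> \<alpha> ^ N then \<alpha> / (\<alpha> - 1) / \<alpha> ^ N else 0)" using assms by auto
  ultimately show ?thesis by linarith
qed

context prob_space
begin

lemma second_moment_indep_sum:
  fixes W :: "nat \<Rightarrow> 'a \<Rightarrow> real"
  assumes indep: "indep_vars (\<lambda>_. borel) W UNIV"
    and int: "\<And>i. integrable M (W i)" and sq: "\<And>i. integrable M (\<lambda>\<omega>. (W i \<omega>)\<^sup>2)"
    and mean: "\<And>i. expectation (W i) = 0" and var: "\<And>i. expectation (\<lambda>\<omega>. (W i \<omega>)\<^sup>2) \<le> v"
  shows "integrable M (\<lambda>\<omega>. (\<Sum>i<k. W i \<omega>)\<^sup>2)" "expectation (\<lambda>\<omega>. (\<Sum>i<k. W i \<omega>)\<^sup>2) \<le> real k * v"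
proof -
  have "integrable M (\<lambda>\<omega>. (\<Sum>i<k. W i \<omega>)\<^sup>2) \<and> expectation (\<lambda>\<omega>. (\<Sum>i<k. W i \<omega>)\<^sup>2) \<le> real k * v"
  proof (induction k)
    case (Suc k)
    have iv: "indep_var borel (W k) borel (\<lambda>\<omega>. \<Sum>i<k. W i \<omega>)"
      using indep_vars_subset[OF indep] by (intro indep_vars_sum) auto
    have intS: "integrable M (\<lambda>\<omega>. \<Sum>i<k. W i \<omega>)" using int by auto
    have c1: "integrable M (\<lambda>\<omega>. W k \<omega> * (\<Sum>i<k. W i \<omega>))"
      by (rule indep_var_integrable[OF iv int intS])
    have c2: "expectation (\<lambda>\<omega>. W k \<omega> * (\<Sum>i<k. W i \<omega>)) = 0"
      using indep_var_lebesgue_integral[OF iv int intS] mean by simp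
    have eq: "(\<Sum>i<Suc k. W i \<omega>)\<^sup>2 = (\<Sum>i<k. W i \<omega>)\<^sup>2 + (W k \<omega>)\<^sup>2 + 2 * (W k \<omega> * (\<Sum>i<k. W i \<omega>))" for \<omega>
      by (simp add: power2_sum)
    have "integrable M (\<lambda>\<omega>. (\<Sum>i<Suc k. W i \<omega>)\<^sup>2)"
      unfolding eq using Suc sq c1 by auto
    moreover have "expectation (\<lambda>\<omega>. (\<Sum>i<Suc k. W i \<omega>)\<^sup>2) = expectation (\<lambda>\<omega>. (\<Sum>i<k. W i \<omega>)\<^sup>2) + expectation (\<lambda>\<omega>. (W k \<omega>)\<^sup>2)"
      unfolding eq using Suc sq c1 c2 by simp
    ultimately show ?case using Suc var[of k] by (simp add: algebra_simps)
  qed simp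
  then show "integrable M (\<lambda>\<omega>. (\<Sum>i<k. W i \<omega>)\<^sup>2)" "expectation (\<lambda>\<omega>. (\<Sum>i<k. W i \<omega>)\<^sup>2) \<le> real k * v"
    by auto
qed

end

locale iid_nonneg = prob_space M for M :: "'a measure" +
  fixes Y :: "nat \<Rightarrow> 'a \<Rightarrow> real"
  assumes indep: "indep_vars (\<lambda>_. borel) Y UNIV"
    and ident: "distr M borel (Y n) = distr M borel (Y 0)"
    and nonneg: "0 \<le> Y n \<omega>"
    and integrable_Y0: "integrable M (Y 0)"
begin

lemma meas_Y [measurable]: "Y n \<in> borel_measurable M"
  using indep by (auto simp: indep_vars_def)

lemma expectation_ident:
  assumes [measurable]: "h \<in> borel_measurable borel"
  shows "expectation (\<lambda>\<omega>. h (Y n \<omega>)) = expectation (\<lambda>\<omega>. h (Y 0 \<omega>) :: real)"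
proof -
  have "expectation (\<lambda>\<omega>. h (Y n \<omega>)) = integral\<^sup>L (distr M borel (Y n)) h"
    by (rule integral_distr[symmetric]) auto
  also have "\<dots> = expectation (\<lambda>\<omega>. h (Y 0 \<omega>))"
    unfolding ident[of n] by (rule integral_distr) auto
  finally show ?thesis .
qed

lemma prob_ident:
  assumes "A \<in> sets borel"
  shows "prob (Y n -` A \<inter> space M) = prob (Y 0 -` A \<inter> space M)"
proof -
  have "prob (Y n -` A \<inter> space M) = measure (distr M borel (Y n)) A"
    using assms by (subst measure_distr) auto
  also have "\<dots> = prob (Y 0 -` A \<inter> space M)"
    unfolding ident[of n] using assms by (subst measure_distr) auto
  finally show ?thesis .
qed

text \<open>
  Truncating all summands of the \<open>k\<close>-th partial sum at the same level \<open>k\<close> is enough, since the error is only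
  summed over a geometric sequence of \<open>k\<close>.
\<close>

lemma deviation_bound:
  assumes \<epsilon>: "\<epsilon> > 0" and k: "k > 0"
  defines "trunc \<equiv> \<lambda>y::real. if y \<le> real k then y else 0"
  shows "prob {\<omega>\<in>space M. \<bar>(\<Sum>i<k. Y i \<omega>) - real k * expectation (\<lambda>\<omega>. trunc (Y 0 \<omega>))\<bar> \<ge> \<epsilon> * real k}
    \<le> real k * prob {\<omega>\<in>space M. real k < Y 0 \<omega>} + expectation (\<lambda>\<omega>. (trunc (Y 0 \<omega>))\<^sup>2) / (\<epsilon>\<^sup>2 * real k)"
proof -
  have [measurable]: "trunc \<in> borel_measurable borel" unfolding trunc_def by measurable
  define \<mu> where "\<mu> = expectation (\<lambda>\<omega>. trunc (Y 0 \<omega>))"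
  define W where "W i \<omega> = trunc (Y i \<omega>) - \<mu>" for i \<omega>
  have [measurable]: "W i \<in> borel_measurable M" for i unfolding W_def by measurable
  have trb: "\<bar>trunc (Y i \<omega>)\<bar> \<le> real k" for i \<omega> using nonneg[of i \<omega>] by (auto simp: trunc_def)
  have intT: "integrable M (\<lambda>\<omega>. trunc (Y i \<omega>))" for i
    using trb by (intro integrable_const_bound[of _ "real k"]) auto
  have intT2: "integrable M (\<lambda>\<omega>. (trunc (Y i \<omega>))\<^sup>2)" for i
    using trb by (intro integrable_const_bound[of _ "(real k)\<^sup>2"]) (auto simp: abs_le_square_iff[symmetric])
  have intW: "integrable M (W i)" for i unfolding W_def using intT by auto
  have intW2: "integrable M (\<lambda>\<omega>. (W i \<omega>)\<^sup>2)" for i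
    unfolding W_def power2_diff using intT intT2 by auto
  have meanW: "expectation (W i) = 0" for i
    unfolding W_def using intT[of i] expectation_ident[of trunc i] by (simp add: \<mu>_def prob_space)
  have varW: "expectation (\<lambda>\<omega>. (W i \<omega>)\<^sup>2) \<le> expectation (\<lambda>\<omega>. (trunc (Y 0 \<omega>))\<^sup>2)" for i
  proof -
    have "expectation (\<lambda>\<omega>. (W i \<omega>)\<^sup>2) = expectation (\<lambda>\<omega>. (trunc (Y i \<omega>))\<^sup>2) - \<mu>\<^sup>2"
      unfolding W_def power2_diff using intT[of i] intT2[of i] expectation_ident[of trunc i]
      by (simp add: \<mu>_def prob_space power2_eq_square)
    then show ?thesis using expectation_ident[of "\<lambda>y. (trunc y)\<^sup>2" i] by simp
  qed
  have indepW: "indep_vars (\<lambda>_. borel) W UNIV"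
    unfolding W_def by (rule indep_vars_compose2[OF indep]) auto
  note sm = second_moment_indep_sum[OF indepW intW intW2 meanW varW, of k]
  have "prob {\<omega>\<in>space M. \<bar>\<Sum>i<k. W i \<omega>\<bar> \<ge> \<epsilon> * real k} \<le> prob {\<omega>\<in>space M. (\<Sum>i<k. W i \<omega>)\<^sup>2 \<ge> (\<epsilon> * real k)\<^sup>2}"
  proof (rule finite_measure_mono)
    show "{\<omega>\<in>space M. \<bar>\<Sum>i<k. W i \<omega>\<bar> \<ge> \<epsilon> * real k} \<subseteq> {\<omega>\<in>space M. (\<Sum>i<k. W i \<omega>)\<^sup>2 \<ge> (\<epsilon> * real k)\<^sup>2}"
      using \<epsilon> by (auto simp: abs_le_square_iff[symmetric])
  qed measurable
  also have "\<dots> \<le> expectation (\<lambda>\<omega>. (\<Sum>i<k. W i \<omega>)\<^sup>2) / (\<epsilon> * real k)\<^sup>2"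
    using sm(1) \<epsilon> k by (intro integral_Markov_inequality_measure[where A = "{}"]) auto
  also have "\<dots> \<le> (real k * expectation (\<lambda>\<omega>. (trunc (Y 0 \<omega>))\<^sup>2)) / (\<epsilon> * real k)\<^sup>2"
    using sm(2) by (intro divide_right_mono) auto
  also have "\<dots> = expectation (\<lambda>\<omega>. (trunc (Y 0 \<omega>))\<^sup>2) / (\<epsilon>\<^sup>2 * real k)"
    using k by (simp add: power2_eq_square)
  finally have 1: "prob {\<omega>\<in>space M. \<bar>\<Sum>i<k. W i \<omega>\<bar> \<ge> \<epsilon> * real k} \<le> expectation (\<lambda>\<omega>. (trunc (Y 0 \<omega>))\<^sup>2) / (\<epsilon>\<^sup>2 * real k)" .
  have "prob (\<Union>i<k. {\<omega>\<in>space M. real k < Y i \<omega>}) \<le> (\<Sum>i<k. prob {\<omega>\<in>space M. real k < Y i \<omega>})"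
    by (intro finite_measure_subadditive_finite) auto
  also have "\<dots> = (\<Sum>i<k. prob {\<omega>\<in>space M. real k < Y 0 \<omega>})"
  proof (rule sum.cong[OF refl])
    fix i
    have "{\<omega>\<in>space M. real k < Y j \<omega>} = Y j -` {real k<..} \<inter> space M" for j by auto
    then show "prob {\<omega>\<in>space M. real k < Y i \<omega>} = prob {\<omega>\<in>space M. real k < Y 0 \<omega>}"
      using prob_ident[of "{real k<..}" i] by simp
  qed
  finally have 2: "prob (\<Union>i<k. {\<omega>\<in>space M. real k < Y i \<omega>}) \<le> real k * prob {\<omega>\<in>space M. real k < Y 0 \<omega>}" by simp
  have "prob {\<omega>\<in>space M. \<bar>(\<Sum>i<k. Y i \<omega>) - real k * \<mu>\<bar> \<ge> \<epsilon> * real k}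
    \<le> prob ((\<Union>i<k. {\<omega>\<in>space M. real k < Y i \<omega>}) \<union> {\<omega>\<in>space M. \<bar>\<Sum>i<k. W i \<omega>\<bar> \<ge> \<epsilon> * real k})"
  proof (rule finite_measure_mono)
    show "{\<omega>\<in>space M. \<bar>(\<Sum>i<k. Y i \<omega>) - real k * \<mu>\<bar> \<ge> \<epsilon> * real k}
      \<subseteq> (\<Union>i<k. {\<omega>\<in>space M. real k < Y i \<omega>}) \<union> {\<omega>\<in>space M. \<bar>\<Sum>i<k. W i \<omega>\<bar> \<ge> \<epsilon> * real k}"
    proof
      fix \<omega> assume w: "\<omega> \<in> {\<omega>\<in>space M. \<bar>(\<Sum>i<k. Y i \<omega>) - real k * \<mu>\<bar> \<ge> \<epsilon> * real k}"
      show "\<omega> \<in> (\<Union>i<k. {\<omega>\<in>space M. real k < Y i \<omega>}) \<union> {\<omega>\<in>space M. \<bar>\<Sum>i<k. W i \<omega>\<bar> \<ge> \<epsilon> * real k}"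
      proof (cases "\<exists>i<k. real k < Y i \<omega>")
        case True then show ?thesis using w by auto
      next
        case False
        have "(\<Sum>i<k. W i \<omega>) = (\<Sum>i<k. Y i \<omega> - \<mu>)"
        proof (rule sum.cong[OF refl])
          fix i assume "i \<in> {..<k}"
          then have "Y i \<omega> \<le> real k" using False by (meson lessThan_iff not_le)
          then show "W i \<omega> = Y i \<omega> - \<mu>" by (simp add: W_def trunc_def)
        qed
        also have "\<dots> = (\<Sum>i<k. Y i \<omega>) - real k * \<mu>" by (simp add: sum_subtractf)
        finally show ?thesis using w by auto
      qed
    qed
  qed measurable
  also have "\<dots> \<le> prob (\<Union>i<k. {\<omega>\<in>space M. real k < Y i \<omega>}) + prob {\<omega>\<in>space M. \<bar>\<Sum>i<k. W i \<omega>\<bar> \<ge> \<epsilon> * real k}"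
    by (intro measure_Un_le) measurable
  also have "\<dots> \<le> real k * prob {\<omega>\<in>space M. real k < Y 0 \<omega>} + expectation (\<lambda>\<omega>. (trunc (Y 0 \<omega>))\<^sup>2) / (\<epsilon>\<^sup>2 * real k)"
    using 1 2 by linarith
  finally show ?thesis unfolding \<mu>_def .
qed

lemma summable_deviation:
  assumes \<epsilon>: "\<epsilon> > 0" and \<alpha>: "\<alpha> > (1::real)"
  defines "k \<equiv> \<lambda>n::nat. nat \<lfloor>\<alpha> ^ n\<rfloor>"
  shows "summable (\<lambda>n. prob {\<omega>\<in>space M. \<bar>(\<Sum>i<k n. Y i \<omega>) - real (k n) * expectation (\<lambda>\<omega>. if Y 0 \<omega> \<le> real (k n) then Y 0 \<omega> else 0)\<bar> \<ge> \<epsilon> * real (k n)})"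
    (is "summable (\<lambda>n. prob (?B n))")
proof -
  have an: "\<alpha> ^ n \<ge> 1" for n using \<alpha> by (intro one_le_power) auto
  have kb: "real (k n) \<le> \<alpha> ^ n" "\<alpha> ^ n \<le> 2 * real (k n)" "k n > 0" for n
  proof -
    have f: "\<lfloor>\<alpha> ^ n\<rfloor> \<ge> 1" using an[of n] by simp
    then have "real (k n) = of_int \<lfloor>\<alpha> ^ n\<rfloor>" by (simp add: k_def)
    then show "real (k n) \<le> \<alpha> ^ n" "\<alpha> ^ n \<le> 2 * real (k n)" "k n > 0"
      using f by linarith+
  qed
  define K where "K = \<alpha> / (\<alpha> - 1)"
  have K: "K \<ge> 0" using \<alpha> by (simp add: K_def)
  let ?tr = "\<lambda>n y. if y \<le> real (k n) then y else (0::real)"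
  define U where "U n \<omega> = real (k n) * indicator {\<omega>. real (k n) < Y 0 \<omega>} \<omega> + (?tr n (Y 0 \<omega>))\<^sup>2 / (\<epsilon>\<^sup>2 * real (k n))" for n \<omega>
  have U0: "0 \<le> U n \<omega>" for n \<omega> by (simp add: U_def)
  have [measurable]: "U n \<in> borel_measurable M" for n unfolding U_def by measurable
  have intU1: "integrable M (\<lambda>\<omega>. real (k n) * indicator {\<omega>. real (k n) < Y 0 \<omega>} \<omega>)" for n
    by (intro integrable_const_bound[of _ "real (k n)"]) (auto simp: indicator_def)
  have intU2: "integrable M (\<lambda>\<omega>. (?tr n (Y 0 \<omega>))\<^sup>2)" for n
  proof (intro integrable_const_bound[of _ "(real (k n))\<^sup>2"])
    show "AE \<omega> in M. norm ((?tr n (Y 0 \<omega>))\<^sup>2) \<le> (real (k n))\<^sup>2"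
      using nonneg[of 0] by (intro AE_I2) (auto intro!: power_mono)
  qed measurable
  have intU: "integrable M (U n)" for n
    unfolding U_def using intU1[of n] intU2[of n] by auto
  have pU: "prob (?B n) \<le> expectation (U n)" for n
  proof -
    have "prob (?B n) \<le> real (k n) * prob {\<omega>\<in>space M. real (k n) < Y 0 \<omega>} + expectation (\<lambda>\<omega>. (?tr n (Y 0 \<omega>))\<^sup>2) / (\<epsilon>\<^sup>2 * real (k n))"
      using deviation_bound[OF \<epsilon> kb(3)[of n]] .
    also have "\<dots> = expectation (U n)"
    proof -
      have "prob {\<omega>\<in>space M. real (k n) < Y 0 \<omega>} = expectation (indicator {\<omega>\<in>space M. real (k n) < Y 0 \<omega>})" by simp
      also have "\<dots> = expectation (indicator {\<omega>. real (k n) < Y 0 \<omega>})"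
        by (intro Bochner_Integration.integral_cong) (auto simp: indicator_def)
      finally show ?thesis unfolding U_def using intU1[of n] intU2[of n] by simp
    qed
    finally show ?thesis .
  qed
  have sumU: "(\<Sum>n<N. U n \<omega>) \<le> (2 * K + 2 * K / \<epsilon>\<^sup>2) * Y 0 \<omega>" for N \<omega>
  proof -
    define y where "y = Y 0 \<omega>"
    have y: "y \<ge> 0" using nonneg by (simp add: y_def)
    have "(\<Sum>n<N. real (k n) * indicator {\<omega>. real (k n) < Y 0 \<omega>} \<omega>) \<le> (\<Sum>n<N. if \<alpha> ^ n < 2 * y then \<alpha> ^ n else 0)"
    proof (rule sum_mono)
      fix n
      show "real (k n) * indicator {\<omega>. real (k n) < Y 0 \<omega>} \<omega> \<le> (if \<alpha> ^ n < 2 * y then \<alpha> ^ n else 0)"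
        using kb[of n] an[of n] by (auto simp: indicator_def y_def)
    qed
    also have "\<dots> \<le> K * (2 * y)" unfolding K_def using \<alpha> y by (intro geometric_sum_below) auto
    finally have 1: "(\<Sum>n<N. real (k n) * indicator {\<omega>. real (k n) < Y 0 \<omega>} \<omega>) \<le> 2 * K * y" by simp
    have 2: "(\<Sum>n<N. (?tr n (Y 0 \<omega>))\<^sup>2 / (\<epsilon>\<^sup>2 * real (k n))) \<le> 2 * K / \<epsilon>\<^sup>2 * y"
    proof (cases "y = 0")
      case True
      then show ?thesis by (simp add: y_def cong: if_cong)
    next
      case False
      then have y': "y > 0" using y by simp
      have "(\<Sum>n<N. (?tr n (Y 0 \<omega>))\<^sup>2 / (\<epsilon>\<^sup>2 * real (k n))) \<le> (\<Sum>n<N. 2 * y\<^sup>2 / \<epsilon>\<^sup>2 * (if y \<le> \<alpha> ^ n then 1 / \<alpha> ^ n else 0))"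
      proof (rule sum_mono)
        fix n
        show "(?tr n (Y 0 \<omega>))\<^sup>2 / (\<epsilon>\<^sup>2 * real (k n)) \<le> 2 * y\<^sup>2 / \<epsilon>\<^sup>2 * (if y \<le> \<alpha> ^ n then 1 / \<alpha> ^ n else 0)"
        proof (cases "y \<le> real (k n)")
          case True
          then have "y \<le> \<alpha> ^ n" using kb[of n] by simp
          have "1 / real (k n) \<le> 2 / \<alpha> ^ n" using kb[of n] an[of n] by (simp add: field_simps)
          then have "y\<^sup>2 / \<epsilon>\<^sup>2 * (1 / real (k n)) \<le> y\<^sup>2 / \<epsilon>\<^sup>2 * (2 / \<alpha> ^ n)"
            by (intro mult_left_mono) auto
          then show ?thesis using True \<open>y \<le> \<alpha> ^ n\<close> by (simp add: y_def mult.commute)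
        next
          case False
          then show ?thesis using an[of n] by (simp add: y_def)
        qed
      qed
      also have "\<dots> = 2 * y\<^sup>2 / \<epsilon>\<^sup>2 * (\<Sum>n<N. if y \<le> \<alpha> ^ n then 1 / \<alpha> ^ n else 0)"
        by (simp add: sum_distrib_left)
      also have "\<dots> \<le> 2 * y\<^sup>2 / \<epsilon>\<^sup>2 * (K / y)"
        unfolding K_def using \<alpha> y' by (intro mult_left_mono geometric_sum_above) auto
      also have "\<dots> = 2 * K / \<epsilon>\<^sup>2 * y" using y' by (simp add: power2_eq_square)
      finally show ?thesis .
    qed
    show ?thesis using 1 2 unfolding U_def sum.distrib y_def[symmetric] by (simp add: algebra_simps)
  qed
  have "summable (\<lambda>n. expectation (U n))"
  proof (rule summableI_nonneg_bounded)
    show "0 \<le> expectation (U n)" for n using U0 by simp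
    fix N
    have "(\<Sum>n<N. expectation (U n)) = expectation (\<lambda>\<omega>. \<Sum>n<N. U n \<omega>)"
      using intU by simp
    also have "\<dots> \<le> expectation (\<lambda>\<omega>. (2 * K + 2 * K / \<epsilon>\<^sup>2) * Y 0 \<omega>)"
      using intU integrable_Y0 sumU by (intro integral_mono) auto
    finally show "(\<Sum>n<N. expectation (U n)) \<le> expectation (\<lambda>\<omega>. (2 * K + 2 * K / \<epsilon>\<^sup>2) * Y 0 \<omega>)" .
  qed
  then show ?thesis
  proof (rule summable_comparison_test')
    show "norm (prob (?B n)) \<le> expectation (U n)" for n
      unfolding real_norm_def abs_of_nonneg[OF measure_nonneg] by (rule pU)
  qed
qed

lemma truncated_expectation_tendsto:
  assumes k: "filterlim k at_top sequentially"
  shows "(\<lambda>n. expectation (\<lambda>\<omega>. if Y 0 \<omega> \<le> real (k n) then Y 0 \<omega> else 0)) \<longlonglongrightarrow> expectation (Y 0)"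
proof (rule integral_dominated_convergence[where w = "Y 0"])
  show "AE \<omega> in M. (\<lambda>n. if Y 0 \<omega> \<le> real (k n) then Y 0 \<omega> else 0) \<longlonglongrightarrow> Y 0 \<omega>"
  proof (rule AE_I2)
    fix \<omega>
    have "filterlim (\<lambda>n. real (k n)) at_top sequentially"
      by (rule filterlim_compose[OF filterlim_real_sequentially k])
    then have "\<forall>\<^sub>F n in sequentially. Y 0 \<omega> \<le> real (k n)" by (simp add: filterlim_at_top)
    then show "(\<lambda>n. if Y 0 \<omega> \<le> real (k n) then Y 0 \<omega> else 0) \<longlonglongrightarrow> Y 0 \<omega>"
      by (intro tendsto_eventually) (auto elim: eventually_mono)
  qed
  show "AE \<omega> in M. norm (if Y 0 \<omega> \<le> real (k n) then Y 0 \<omega> else 0) \<le> Y 0 \<omega>" for n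
    using nonneg[of 0] by (intro AE_I2) auto
qed (use integrable_Y0 in auto)

lemma geometric_subsequence_LLN:
  assumes \<alpha>: "\<alpha> > (1::real)"
  defines "k \<equiv> \<lambda>n::nat. nat \<lfloor>\<alpha> ^ n\<rfloor>"
  shows "AE \<omega> in M. (\<lambda>n. (\<Sum>i<k n. Y i \<omega>) / real (k n)) \<longlonglongrightarrow> expectation (Y 0)"
proof -
  define e where "e n = expectation (\<lambda>\<omega>. if Y 0 \<omega> \<le> real (k n) then Y 0 \<omega> else 0)" for n
  have kpos: "real (k n) > 0" for n
    using one_le_power[of \<alpha> n] \<alpha> unfolding k_def by simp
  have "filterlim (\<lambda>n. \<alpha> ^ n) at_top sequentially" using \<alpha> by real_asymp
  then have "filterlim k at_top sequentially"
    unfolding k_def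
    by (intro filterlim_compose[OF filterlim_nat_sequentially] filterlim_compose[OF filterlim_floor_sequentially])
  then have e: "e \<longlonglongrightarrow> expectation (Y 0)"
    unfolding e_def by (rule truncated_expectation_tendsto)
  have "AE \<omega> in M. \<forall>j::nat. \<forall>\<^sub>F n in sequentially. \<bar>(\<Sum>i<k n. Y i \<omega>) - real (k n) * e n\<bar> < (1 / real (Suc j)) * real (k n)"
    unfolding AE_all_countable
  proof
    fix j :: nat
    have "AE \<omega> in M. \<forall>\<^sub>F n in sequentially. \<omega> \<in> space M - {\<omega>\<in>space M. \<bar>(\<Sum>i<k n. Y i \<omega>) - real (k n) * e n\<bar> \<ge> (1 / real (Suc j)) * real (k n)}"
      using summable_deviation[of "1 / real (Suc j)" \<alpha>] \<alpha> unfolding e_def k_def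
      by (intro borel_cantelli_AE1) (auto simp: emeasure_eq_measure)
    then show "AE \<omega> in M. \<forall>\<^sub>F n in sequentially. \<bar>(\<Sum>i<k n. Y i \<omega>) - real (k n) * e n\<bar> < (1 / real (Suc j)) * real (k n)"
      by (rule AE_mp) (auto intro!: AE_I2 elim!: eventually_mono simp: not_le)
  qed
  then show ?thesis
  proof (rule AE_mp, intro AE_I2 impI)
    fix \<omega> assume w: "\<forall>j::nat. \<forall>\<^sub>F n in sequentially. \<bar>(\<Sum>i<k n. Y i \<omega>) - real (k n) * e n\<bar> < (1 / real (Suc j)) * real (k n)"
    have "(\<lambda>n. (\<Sum>i<k n. Y i \<omega>) / real (k n) - e n) \<longlonglongrightarrow> 0"
    proof (rule tendstoI)
      fix r :: real assume "r > 0"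
      then obtain j where j: "1 / real (Suc j) < r" using nat_approx_posE by blast
      show "\<forall>\<^sub>F n in sequentially. dist ((\<Sum>i<k n. Y i \<omega>) / real (k n) - e n) 0 < r"
        using w[rule_format, of j]
      proof eventually_elim
        case (elim n)
        have "\<bar>(\<Sum>i<k n. Y i \<omega>) / real (k n) - e n\<bar> = \<bar>(\<Sum>i<k n. Y i \<omega>) - real (k n) * e n\<bar> / real (k n)"
        proof -
          have "(\<Sum>i<k n. Y i \<omega>) / real (k n) - e n = ((\<Sum>i<k n. Y i \<omega>) - real (k n) * e n) / real (k n)"
            using kpos[of n] by (simp add: diff_divide_distrib)
          then show ?thesis using kpos[of n] by (simp add: abs_divide)
        qed
        also have "\<dots> < 1 / real (Suc j)" using elim kpos[of n] by (simp only: pos_divide_less_eq)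
        finally show ?case using j by simp
      qed
    qed
    from tendsto_add[OF this e] show "(\<lambda>n. (\<Sum>i<k n. Y i \<omega>) / real (k n)) \<longlonglongrightarrow> expectation (Y 0)" by simp
  qed
qed

theorem strong_law_of_large_numbers:
  "AE \<omega> in M. (\<lambda>n. (\<Sum>i<n. Y i \<omega>) / real n) \<longlonglongrightarrow> expectation (Y 0)"
proof -
  define \<mu> where "\<mu> = expectation (Y 0)"
  have \<mu>: "\<mu> \<ge> 0" unfolding \<mu>_def using nonneg by simp
  define al where "al j = 1 + 1 / real (Suc j)" for j
  have al: "al j > 1" for j by (simp add: al_def)
  have "AE \<omega> in M. \<forall>j. (\<lambda>n. (\<Sum>i<nat \<lfloor>al j ^ n\<rfloor>. Y i \<omega>) / real (nat \<lfloor>al j ^ n\<rfloor>)) \<longlonglongrightarrow> \<mu>"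
    unfolding AE_all_countable \<mu>_def using geometric_subsequence_LLN[OF al] by blast
  then show ?thesis
  proof (rule AE_mp, intro AE_I2 impI)
    fix \<omega> assume w: "\<forall>j. (\<lambda>n. (\<Sum>i<nat \<lfloor>al j ^ n\<rfloor>. Y i \<omega>) / real (nat \<lfloor>al j ^ n\<rfloor>)) \<longlonglongrightarrow> \<mu>"
    define S where "S n = (\<Sum>i<n. Y i \<omega>)" for n
    have Smono: "S m \<le> S n" if "m \<le> n" for m n
      unfolding S_def using that nonneg by (intro sum_mono2) auto
    have S0: "S n \<ge> 0" for n unfolding S_def using nonneg by (intro sum_nonneg) auto
    have "(\<lambda>n. S n / real n) \<longlonglongrightarrow> \<mu>"
    proof (rule LIMSEQ_I)
      fix r :: real assume r: "r > 0"
      have "((\<lambda>x::real. x * x * (\<mu> + (x - 1)) - \<mu>) \<longlongrightarrow> 1 * 1 * (\<mu> + (1 - 1)) - \<mu>) (at 1)"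
        by (intro tendsto_intros)
      moreover have "filterlim al (at 1) sequentially"
        unfolding al_def by (intro filterlim_atI) (real_asymp, auto)
      ultimately have "(\<lambda>j. al j * al j * (\<mu> + (al j - 1)) - \<mu>) \<longlonglongrightarrow> 0"
        using filterlim_compose by force
      moreover have "(\<lambda>j. \<mu> - (\<mu> - (al j - 1)) / (al j * al j)) \<longlonglongrightarrow> 0"
      proof -
        have "((\<lambda>x::real. \<mu> - (\<mu> - (x - 1)) / (x * x)) \<longlongrightarrow> \<mu> - (\<mu> - (1 - 1)) / (1 * 1)) (at 1)"
          by (intro tendsto_intros) auto
        then show ?thesis using \<open>filterlim al (at 1) sequentially\<close> filterlim_compose by force
      qed
      ultimately have "\<forall>\<^sub>F j in sequentially. al j * al j * (\<mu> + (al j - 1)) - \<mu> < r \<and> \<mu> - (\<mu> - (al j - 1)) / (al j * al j) < r"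
        using r by (intro eventually_conj order_tendstoD) auto
      then obtain j where j': "al j * al j * (\<mu> + (al j - 1)) - \<mu> < r" "\<mu> - (\<mu> - (al j - 1)) / (al j * al j) < r"
        using eventually_happens'[OF sequentially_bot] by blast
      have j: "al j * al j * (\<mu> + (al j - 1)) < \<mu> + r" "\<mu> - r < (\<mu> - (al j - 1)) / (al j * al j)"
        using j' by linarith+
      define a where "a = al j"
      define k where "k n = nat \<lfloor>a ^ n\<rfloor>" for n
      have a1: "a > 1" using al by (simp add: a_def)
      have lim: "(\<lambda>n. S (k n) / real (k n)) \<longlonglongrightarrow> \<mu>" using w unfolding S_def k_def a_def by blast
      have kreal: "real (k n) = of_int \<lfloor>a ^ n\<rfloor>" "k n > 0" for n
        using one_le_power[of a n] a1 by (auto simp: k_def)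
      have ktop: "filterlim k at_top sequentially"
      proof -
        have "filterlim (\<lambda>n. a ^ n) at_top sequentially" using a1 by real_asymp
        then show ?thesis unfolding k_def
          by (intro filterlim_compose[OF filterlim_nat_sequentially] filterlim_compose[OF filterlim_floor_sequentially])
      qed
      have ev: "\<forall>\<^sub>F n in sequentially. real (k (Suc n)) \<le> a * a * real (k n)"
      proof -
        have "filterlim (\<lambda>n. a ^ n) at_top sequentially" using a1 by real_asymp
        then have "\<forall>\<^sub>F n in sequentially. a ^ n \<ge> a / (a - 1)" by (simp add: filterlim_at_top)
        then show ?thesis
        proof eventually_elim
          case (elim n)
          have "a \<le> (a - 1) * a ^ n" using elim a1 by (simp add: field_simps)
          then have "a ^ n \<le> a * (a ^ n - 1)" by (simp add: algebra_simps)
          also have "\<dots> \<le> a * real (k n)" unfolding kreal using a1 by (intro mult_left_mono) linarith+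
          finally have "a * a ^ n \<le> a * (a * real (k n))" using a1 by (intro mult_left_mono) auto
          moreover have "real (k (Suc n)) \<le> a ^ Suc n" unfolding kreal by linarith
          ultimately show ?case by (simp add: mult.assoc)
        qed
      qed
      have "\<forall>\<^sub>F n in sequentially. S (k n) / real (k n) < \<mu> + (a - 1) \<and> S (k n) / real (k n) > \<mu> - (a - 1)"
        using a1 by (intro eventually_conj order_tendstoD[OF lim]) auto
      with ev have "\<forall>\<^sub>F n in sequentially. real (k (Suc n)) \<le> a * a * real (k n) \<and>
          S (k n) / real (k n) < \<mu> + (a - 1) \<and> S (k n) / real (k n) > \<mu> - (a - 1)"
        by (rule eventually_conj)
      then obtain n0 where n0: "\<And>n. n \<ge> n0 \<Longrightarrow> real (k (Suc n)) \<le> a * a * real (k n)"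
        "\<And>n. n \<ge> n0 \<Longrightarrow> S (k n) / real (k n) < \<mu> + (a - 1)" "\<And>n. n \<ge> n0 \<Longrightarrow> S (k n) / real (k n) > \<mu> - (a - 1)"
        unfolding eventually_sequentially by blast
      show "\<exists>no. \<forall>m\<ge>no. norm (S m / real m - \<mu>) < r"
      proof (intro exI[of _ "k n0"] allI impI)
        fix m assume m: "m \<ge> k n0"
        define n1 where "n1 = (LEAST n. n \<ge> n0 \<and> m < k n)"
        have "\<exists>n. n \<ge> n0 \<and> m < k n"
        proof -
          have "\<forall>\<^sub>F n in sequentially. n \<ge> n0 \<and> m < k n"
          proof (intro eventually_conj eventually_ge_at_top)
            have "\<forall>\<^sub>F n in sequentially. Suc m \<le> k n" using ktop unfolding filterlim_at_top by blast
            then show "\<forall>\<^sub>F n in sequentially. m < k n" by (rule eventually_mono) simp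
          qed
          then show ?thesis using eventually_happens'[OF sequentially_bot] by blast
        qed
        then have "n1 \<ge> n0 \<and> m < k n1" unfolding n1_def by (rule LeastI_ex)
        then have n1: "n1 \<ge> n0" "m < k n1" by auto
        have "n1 \<noteq> n0" using n1 m by auto
        then obtain n where n: "n1 = Suc n" "n \<ge> n0" using n1 by (cases n1) auto
        have mk: "k n \<le> m" using not_less_Least[of n "\<lambda>n. n \<ge> n0 \<and> m < k n"] n unfolding n1_def[symmetric] by auto
        have mk': "m \<le> k (Suc n)" using n1 n by simp
        have mpos: "real m > 0" using mk kreal(2)[of n] by simp
        have kn: "real (k n) > 0" "real (k (Suc n)) > 0" using kreal(2) by auto
        have ratio: "real (k (Suc n)) \<le> a * a * real (k n)" using n0(1) n by simp
        have "S m / real m \<le> S (k (Suc n)) / real (k n)"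
          using Smono[OF mk'] S0 mk kn by (intro frac_le) auto
        also have "\<dots> = S (k (Suc n)) / real (k (Suc n)) * (real (k (Suc n)) / real (k n))" using kn by simp
        also have "\<dots> \<le> (\<mu> + (a - 1)) * (a * a)"
        proof (rule mult_mono)
          show "S (k (Suc n)) / real (k (Suc n)) \<le> \<mu> + (a - 1)" using n0(2)[of "Suc n"] n by simp
          show "real (k (Suc n)) / real (k n) \<le> a * a" using ratio kn by (simp add: pos_divide_le_eq)
        qed (use \<mu> a1 kn in auto)
        also have "\<dots> < \<mu> + r" using j unfolding a_def by (simp add: mult.commute)
        finally have up: "S m / real m < \<mu> + r" .
        have "\<mu> - r < (\<mu> - (a - 1)) / (a * a)" using j unfolding a_def by simp
        also have "\<dots> \<le> (S (k n) / real (k n)) / (a * a)"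
          using n0(3)[of n] n a1 by (intro divide_right_mono) auto
        also have "\<dots> = S (k n) / (a * a * real (k n))" by (simp add: mult.commute)
        also have "\<dots> \<le> S (k n) / real (k (Suc n))"
          using ratio kn S0 a1 by (intro divide_left_mono) auto
        also have "\<dots> \<le> S m / real m"
          using Smono[OF mk] S0 mk' mpos by (intro frac_le) auto
        finally show "norm (S m / real m - \<mu>) < r" using up by (simp add: abs_less_iff)
      qed
    qed
    then show "(\<lambda>n. (\<Sum>i<n. Y i \<omega>) / real n) \<longlonglongrightarrow> expectation (Y 0)" unfolding S_def \<mu>_def .
  qed
qed

end

section \<open>Growth of the renewal counting process\<close>

lemma min_eq_sum_indicator: "real (min l t) = (\<Sum>s=1..t. indicator {..l} s)"
  by (induction t) (auto simp: indicator_def min_def)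

lemma dyadic_bracket:
  assumes "t \<ge> 1"
  shows "\<exists>k. 2 ^ k \<le> t \<and> t < 2 ^ Suc k \<and> real k \<ge> ln (real t) / ln 2 - 1"
proof -
  define k where "k = nat \<lfloor>log 2 (real t)\<rfloor>"
  have l0: "log 2 (real t) \<ge> 0" using assms by simp
  have k: "real k \<le> log 2 (real t)" "log 2 (real t) < real k + 1"
    using l0 unfolding k_def by linarith+
  have "2 powr real k \<le> real t" using k(1) assms by (simp add: le_log_iff)
  then have "real (2 ^ k) \<le> real t" by (simp add: powr_realpow)
  moreover have "real t < 2 powr (real (Suc k))" using k(2) assms by (simp add: log_less_iff add.commute)
  then have "real t < real (2 ^ Suc k)" by (simp only: powr_realpow) (simp add: powr_realpow)
  moreover have "real k \<ge> ln (real t) / ln 2 - 1" using k(2) by (simp add: log_def)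
  ultimately show ?thesis by (intro exI[of _ k]) (simp only: of_nat_le_iff of_nat_less_iff simp_thms)
qed

locale renewal_process = prob_space M for M :: "'a measure" +
  fixes l :: "nat \<Rightarrow> 'a \<Rightarrow> nat"
  assumes indep: "indep_vars (\<lambda>_. count_space UNIV) l UNIV"
    and ident: "distr M (count_space UNIV) (l n) = distr M (count_space UNIV) (l 0)"
    and l_pos: "AE \<omega> in M. \<forall>n. l n \<omega> \<ge> 1"
begin

definition S :: "nat \<Rightarrow> 'a \<Rightarrow> nat" where
  "S n \<omega> = (\<Sum>i<n. l i \<omega>)"

definition N :: "nat \<Rightarrow> 'a \<Rightarrow> nat" where
  "N t \<omega> = Max {n. n \<ge> 1 \<and> 1 + S n \<omega> \<le> t}"

definition tail :: "nat \<Rightarrow> real" where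
  "tail s = prob {\<omega>\<in>space M. s \<le> l 0 \<omega>}"

lemma meas_l [measurable]: "l n \<in> measurable M (count_space UNIV)"
  using indep by (auto simp: indep_vars_def)

lemma meas_S [measurable]: "S n \<in> measurable M (count_space UNIV)"
  unfolding S_def by measurable

lemma prob_ident: "prob {\<omega>\<in>space M. P (l n \<omega>)} = prob {\<omega>\<in>space M. P (l 0 \<omega>)}"
proof -
  have "prob {\<omega>\<in>space M. P (l j \<omega>)} = measure (distr M (count_space UNIV) (l j)) {x. P x}" for j
    by (subst measure_distr) (auto intro!: arg_cong[where f = prob])
  then show ?thesis using ident[of n] by simp
qed

lemma tail_ident: "prob {\<omega>\<in>space M. s \<le> l n \<omega>} = tail s"
  unfolding tail_def by (rule prob_ident)

lemma expectation_min: "expectation (\<lambda>\<omega>. real (min (l n \<omega>) t)) = (\<Sum>s=1..t. tail s)"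
proof -
  have "expectation (\<lambda>\<omega>. real (min (l n \<omega>) t)) = expectation (\<lambda>\<omega>. \<Sum>s=1..t. indicator {\<omega>\<in>space M. s \<le> l n \<omega>} \<omega>)"
    unfolding min_eq_sum_indicator by (intro Bochner_Integration.integral_cong refl sum.cong) (auto simp: indicator_def)
  also have "\<dots> = (\<Sum>s=1..t. tail s)"
    by (subst Bochner_Integration.integral_sum) (auto simp: tail_ident emeasure_eq_measure)
  finally show ?thesis .
qed

lemma prob_S_ge:
  assumes t: "t \<ge> 1"
  shows "prob {\<omega>\<in>space M. t \<le> S n \<omega>} \<le> real n * (\<Sum>s=1..t. tail s) / real t"
proof -
  let ?u = "\<lambda>\<omega>. \<Sum>i<n. real (min (l i \<omega>) t)"
  have int: "integrable M (\<lambda>\<omega>. real (min (l i \<omega>) t))" for i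
    by (intro integrable_const_bound[of _ "real t"]) auto
  have "prob {\<omega>\<in>space M. t \<le> S n \<omega>} \<le> prob {\<omega>\<in>space M. ?u \<omega> \<ge> real t}"
  proof (rule finite_measure_mono)
    show "{\<omega>\<in>space M. t \<le> S n \<omega>} \<subseteq> {\<omega>\<in>space M. ?u \<omega> \<ge> real t}"
    proof safe
      fix \<omega> assume le: "t \<le> S n \<omega>"
      show "?u \<omega> \<ge> real t"
      proof (cases "\<exists>i<n. l i \<omega> \<ge> t")
        case True
        then obtain i where i: "i < n" "l i \<omega> \<ge> t" by blast
        have "real (min (l i \<omega>) t) \<le> ?u \<omega>" using i by (intro member_le_sum) auto
        then show ?thesis using i by simp
      next
        case False
        then have "?u \<omega> = (\<Sum>i<n. real (l i \<omega>))" by (intro sum.cong) (auto simp: not_le min_def)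
        then show ?thesis using le by (simp add: S_def flip: of_nat_sum)
      qed
    qed
  qed measurable
  also have "\<dots> \<le> expectation ?u / real t"
    using t int by (intro integral_Markov_inequality_measure[where A = "{}"]) (auto intro!: sum_nonneg)
  also have "expectation ?u = (\<Sum>i<n. \<Sum>s=1..t. tail s)"
    using int by (subst Bochner_Integration.integral_sum) (auto simp: expectation_min simp del: of_nat_min)
  finally show ?thesis by simp
qed

lemma prob_S_less: "prob {\<omega>\<in>space M. S n \<omega> < s} \<le> exp (- real n * tail s)"
proof (cases "n = 0")
  case False
  have "prob {\<omega>\<in>space M. S n \<omega> < s} \<le> prob (\<Inter>i\<in>{..<n}. l i -` {..<s} \<inter> space M)"
  proof (rule finite_measure_mono)
    show "{\<omega>\<in>space M. S n \<omega> < s} \<subseteq> (\<Inter>i\<in>{..<n}. l i -` {..<s} \<inter> space M)"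
    proof (intro subsetI INT_I)
      fix \<omega> i assume w: "\<omega> \<in> {\<omega>\<in>space M. S n \<omega> < s}" and i: "i \<in> {..<n}"
      have "l i \<omega> \<le> S n \<omega>" unfolding S_def using i by (intro member_le_sum) auto
      then show "\<omega> \<in> l i -` {..<s} \<inter> space M" using w by auto
    qed
    show "(\<Inter>i\<in>{..<n}. l i -` {..<s} \<inter> space M) \<in> events"
      using False by (intro sets.finite_INT measurable_sets[OF meas_l]) auto
  qed
  also have "\<dots> = (\<Prod>i\<in>{..<n}. prob (l i -` {..<s} \<inter> space M))"
    using False by (intro indep_varsD[OF indep]) auto
  also have "\<dots> = (\<Prod>i\<in>{..<n}. 1 - tail s)"
  proof (rule prod.cong[OF refl])
    fix i
    have "l i -` {..<s} \<inter> space M = space M - {\<omega>\<in>space M. s \<le> l i \<omega>}" by auto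
    then show "prob (l i -` {..<s} \<inter> space M) = 1 - tail s"
      by (simp add: prob_compl tail_ident)
  qed
  also have "\<dots> = (1 - tail s) ^ n" by simp
  also have "\<dots> \<le> exp (- tail s) ^ n"
    using exp_ge_add_one_self[of "- tail s"] by (intro power_mono) (auto simp: tail_def)
  also have "\<dots> = exp (- real n * tail s)" by (simp add: exp_of_nat_mult[symmetric])
  finally show ?thesis .
qed (use prob_le_1 in auto)

lemma S_mono: "m \<le> n \<Longrightarrow> S m \<omega> \<le> S n \<omega>"
  unfolding S_def by (intro sum_mono2) auto

lemma S_ge:
  assumes "\<forall>n. l n \<omega> \<ge> 1"
  shows "n \<le> S n \<omega>"
  using sum_mono[of "{..<n}" "\<lambda>_. 1" "\<lambda>i. l i \<omega>"] assms by (simp add: S_def)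

lemma finite_N_set:
  assumes "\<forall>n. l n \<omega> \<ge> 1"
  shows "finite {n. n \<ge> 1 \<and> 1 + S n \<omega> \<le> t}"
proof (rule finite_subset)
  show "{n. n \<ge> 1 \<and> 1 + S n \<omega> \<le> t} \<subseteq> {..t}"
  proof
    fix n assume "n \<in> {n. n \<ge> 1 \<and> 1 + S n \<omega> \<le> t}"
    then show "n \<in> {..t}" using S_ge[OF assms, of n] by auto
  qed
qed simp

lemma N_ge:
  assumes "\<forall>n. l n \<omega> \<ge> 1" "n \<ge> 1" "1 + S n \<omega> \<le> t"
  shows "n \<le> N t \<omega>"
  unfolding N_def using assms finite_N_set[OF assms(1)] by (intro Max_ge) auto

lemma N_props:
  assumes "\<forall>n. l n \<omega> \<ge> 1" "1 + l 0 \<omega> \<le> t"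
  shows "N t \<omega> \<ge> 1" "1 + S (N t \<omega>) \<omega> \<le> t" "t < 1 + S (Suc (N t \<omega>)) \<omega>"
proof -
  have "1 \<in> {n. n \<ge> 1 \<and> 1 + S n \<omega> \<le> t}" using assms(2) by (simp add: S_def)
  then have "N t \<omega> \<in> {n. n \<ge> 1 \<and> 1 + S n \<omega> \<le> t}"
    unfolding N_def using finite_N_set[OF assms(1)] by (intro Max_in) auto
  then show 1: "N t \<omega> \<ge> 1" "1 + S (N t \<omega>) \<omega> \<le> t" by auto
  show "t < 1 + S (Suc (N t \<omega>)) \<omega>"
  proof (rule ccontr)
    assume "\<not> t < 1 + S (Suc (N t \<omega>)) \<omega>"
    then have "Suc (N t \<omega>) \<le> N t \<omega>" by (intro N_ge[OF assms(1)]) auto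
    then show False by simp
  qed
qed

lemma N_less:
  assumes "\<forall>n. l n \<omega> \<ge> 1" "1 + l 0 \<omega> \<le> t" "t < 1 + S m \<omega>"
  shows "N t \<omega> < m"
proof (rule ccontr)
  assume "\<not> N t \<omega> < m"
  then have "S m \<omega> \<le> S (N t \<omega>) \<omega>" by (intro S_mono) auto
  then show False using N_props(2)[OF assms(1,2)] assms(3) by linarith
qed

lemma lower_growth:
  fixes \<alpha> K \<epsilon> :: real
  assumes \<alpha>: "0 < \<alpha>" "\<alpha> \<le> 1" and K: "K \<ge> 0" and \<epsilon>: "\<epsilon> > 0"
    and mean: "\<And>T. T \<ge> T0 \<Longrightarrow> (\<Sum>s=1..T. tail s) \<le> K * (real T powr (1 - \<alpha>) * ln (real T) powr (1 + 2 * \<alpha>))"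
  shows "AE \<omega> in M. \<forall>\<^sub>F t in sequentially. real t powr \<alpha> * ln (real t) powr (- 2 - 2 * \<alpha> - \<epsilon>) \<le> real (N t \<omega>)"
proof -
  define q where "q = 2 + 2 * \<alpha> + \<epsilon>"
  define n where "n k = nat \<lceil>2 powr (real (Suc k) * \<alpha>) * (real k * ln 2) powr (- q)\<rceil>" for k :: nat
  define B where "B k = {\<omega>\<in>space M. 2 ^ k \<le> S (n k) \<omega>}" for k
  have [measurable]: "B k \<in> sets M" for k unfolding B_def by measurable
  have Bk: "prob (B k) \<le> (2 powr (real (Suc k) * \<alpha>) * (real k * ln 2) powr (- q) + 1) * (K * (2 powr (- real k * \<alpha>) * (real k * ln 2) powr (1 + 2 * \<alpha>)))"
    if k: "k \<ge> T0" for k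
  proof -
    have k2: "2 ^ k \<ge> T0" using le_trans[OF k less_imp_le[OF less_exp]] .
    have "prob (B k) \<le> real (n k) * (\<Sum>s=1..2 ^ k. tail s) / real (2 ^ k)"
      unfolding B_def by (rule prob_S_ge) simp
    also have "\<dots> \<le> real (n k) * (K * (real (2 ^ k) powr (1 - \<alpha>) * ln (real (2 ^ k)) powr (1 + 2 * \<alpha>))) / real (2 ^ k)"
      using mean[OF k2] by (intro divide_right_mono mult_left_mono) auto
    also have "\<dots> = real (n k) * (K * (2 powr (- real k * \<alpha>) * (real k * ln 2) powr (1 + 2 * \<alpha>)))"
    proof -
      have r: "real (2 ^ k) = 2 powr real k" by (simp add: powr_realpow)
      have "real (2 ^ k) powr (1 - \<alpha>) / real (2 ^ k) = 2 powr (real k * (1 - \<alpha>) - real k)"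
        unfolding r powr_powr by (rule powr_diff[symmetric])
      also have "real k * (1 - \<alpha>) - real k = - real k * \<alpha>" by (simp add: algebra_simps)
      finally have e: "real (2 ^ k) powr (1 - \<alpha>) / real (2 ^ k) = 2 powr (- real k * \<alpha>)" .
      have "ln (real (2 ^ k)) = real k * ln 2" by (simp add: ln_realpow)
      then have "real (n k) * (K * (real (2 ^ k) powr (1 - \<alpha>) * ln (real (2 ^ k)) powr (1 + 2 * \<alpha>))) / real (2 ^ k)
        = real (n k) * (K * ((real (2 ^ k) powr (1 - \<alpha>) / real (2 ^ k)) * (real k * ln 2) powr (1 + 2 * \<alpha>)))"
        by (simp only: times_divide_eq_right times_divide_eq_left)
      then show ?thesis unfolding e .
    qed
    also have "\<dots> \<le> (2 powr (real (Suc k) * \<alpha>) * (real k * ln 2) powr (- q) + 1) * (K * (2 powr (- real k * \<alpha>) * (real k * ln 2) powr (1 + 2 * \<alpha>)))"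
    proof (rule mult_right_mono)
      have "0 \<le> 2 powr (real (Suc k) * \<alpha>) * (real k * ln 2) powr (- q)" by simp
      then show "real (n k) \<le> 2 powr (real (Suc k) * \<alpha>) * (real k * ln 2) powr (- q) + 1"
        unfolding n_def by linarith
    qed (use K in simp)
    finally show ?thesis .
  qed
  have "summable (\<lambda>k. prob (B k))"
  proof (rule summable_comparison_test_ev)
    show "\<forall>\<^sub>F k in sequentially. norm (prob (B k)) \<le>
      (2 powr (real (Suc k) * \<alpha>) * (real k * ln 2) powr (- q) + 1) * (K * (2 powr (- real k * \<alpha>) * (real k * ln 2) powr (1 + 2 * \<alpha>)))"
      using eventually_ge_at_top[of T0]
    proof eventually_elim
      case (elim k)
      show ?case unfolding real_norm_def abs_of_nonneg[OF measure_nonneg] by (rule Bk[OF elim])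
    qed
    show "summable (\<lambda>k. (2 powr (real (Suc k) * \<alpha>) * (real k * ln 2) powr (- q) + 1) * (K * (2 powr (- real k * \<alpha>) * (real k * ln 2) powr (1 + 2 * \<alpha>))))"
    proof (rule summable_comparison_test_bigo)
      show "summable (\<lambda>k. norm (real k powr (- 1 - \<epsilon>)))"
        using \<epsilon> by (simp add: summable_real_powr_iff)
      show "(\<lambda>k. (2 powr (real (Suc k) * \<alpha>) * (real k * ln 2) powr (- q) + 1) * (K * (2 powr (- real k * \<alpha>) * (real k * ln 2) powr (1 + 2 * \<alpha>))))
        \<in> O(\<lambda>k. real k powr (- 1 - \<epsilon>))"
        unfolding q_def using \<alpha> \<epsilon> by real_asymp
    qed
  qed
  then have "AE \<omega> in M. \<forall>\<^sub>F k in sequentially. \<omega> \<in> space M - B k"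
    by (intro borel_cantelli_AE1) (auto simp: emeasure_eq_measure)
  then show ?thesis using l_pos
  proof eventually_elim
    case (elim \<omega>)
    then obtain k0 where k0: "\<And>k. k \<ge> k0 \<Longrightarrow> \<omega> \<in> space M - B k" unfolding eventually_sequentially by blast
    have "filterlim (\<lambda>t::nat. ln (real t) / ln 2 - 1) at_top sequentially" by real_asymp
    then have "\<forall>\<^sub>F t::nat in sequentially. ln (real t) / ln 2 - 1 \<ge> real (max k0 1)" by (simp only: filterlim_at_top)
    then show ?case using eventually_ge_at_top[of 1]
    proof eventually_elim
      case (elim t)
      obtain k where k: "2 ^ k \<le> t" "t < 2 ^ Suc k" "real k \<ge> ln (real t) / ln 2 - 1"
        using dyadic_bracket[OF elim(2)] by blast
      have kk: "k \<ge> k0" "k \<ge> 1" using k(3) elim(1) by linarith+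
      have k1: "real k * ln 2 > 0" using kk by simp
      have rk: "real (2 ^ j) = 2 powr real j" for j by (simp add: powr_realpow)
      have "0 < 2 powr (real (Suc k) * \<alpha>) * (real k * ln 2) powr (- q)" using kk by simp
      then have n1: "n k \<ge> 1" unfolding n_def by linarith
      have "1 + S (n k) \<omega> \<le> 2 ^ k" using k0[OF kk(1)] unfolding B_def by auto
      then have "n k \<le> N t \<omega>" using k(1) n1 \<open>\<forall>n. 1 \<le> l n \<omega>\<close> by (intro N_ge) auto
      moreover have "2 powr (real (Suc k) * \<alpha>) * (real k * ln 2) powr (- q) \<le> real (n k)"
        unfolding n_def by linarith
      moreover have "real t powr \<alpha> * ln (real t) powr (- q) \<le> 2 powr (real (Suc k) * \<alpha>) * (real k * ln 2) powr (- q)"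
      proof (rule mult_mono)
        have "real t \<le> real (2 ^ Suc k)" using k(2) by (simp only: of_nat_le_iff less_imp_le)
        then have "real t powr \<alpha> \<le> real (2 ^ Suc k) powr \<alpha>" using \<alpha> by (intro powr_mono2) auto
        then show "real t powr \<alpha> \<le> 2 powr (real (Suc k) * \<alpha>)" unfolding rk powr_powr .
        have "real (2 ^ k) \<le> real t" using k(1) by (simp only: of_nat_le_iff)
        then have "ln (real (2 ^ k)) \<le> ln (real t)" by (intro ln_mono) auto
        then have "real k * ln 2 \<le> ln (real t)" by (simp add: ln_realpow)
        then show "ln (real t) powr (- q) \<le> (real k * ln 2) powr (- q)"
          using k1 \<alpha> \<epsilon> by (intro powr_mono2') (auto simp: q_def)
      qed auto
      moreover have "- 2 - 2 * \<alpha> - \<epsilon> = - q" by (simp add: q_def)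
      ultimately show ?case by (simp only:)
    qed
  qed
qed

lemma upper_growth:
  fixes \<alpha> \<gamma> \<epsilon> :: real
  assumes \<alpha>: "0 < \<alpha>" "\<alpha> \<le> 1" and \<gamma>: "\<gamma> > 0" and \<epsilon>: "\<epsilon> > 0"
    and low: "\<And>s. s \<ge> s0 \<Longrightarrow> \<gamma> * (real s powr (- \<alpha>) / ln (real s)) \<le> tail s"
  shows "AE \<omega> in M. \<forall>\<^sub>F t in sequentially. real (N t \<omega>) \<le> real t powr \<alpha> * ln (real t) powr (1 + \<epsilon>)"
proof -
  define m where "m k = nat \<lfloor>2 powr (real k * \<alpha>) * (real k * ln 2) powr (1 + \<epsilon>)\<rfloor>" for k :: nat
  define B where "B k = {\<omega>\<in>space M. S (m k) \<omega> < 2 ^ Suc k}" for k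
  have [measurable]: "B k \<in> sets M" for k unfolding B_def by measurable
  define h where "h k = (2 powr (real k * \<alpha>) * (real k * ln 2) powr (1 + \<epsilon>) - 1) * (\<gamma> * (2 powr (- real (Suc k) * \<alpha>) / (real (Suc k) * ln 2)))" for k :: nat
  have Bk: "prob (B k) \<le> exp (- h k)" if k: "k \<ge> s0" for k
  proof -
    have k2: "2 ^ Suc k \<ge> s0" using le_trans[OF le_SucI[OF k] less_imp_le[OF less_exp]] .
    have "prob (B k) \<le> exp (- real (m k) * tail (2 ^ Suc k))"
      unfolding B_def by (rule prob_S_less)
    also have "\<dots> \<le> exp (- h k)"
    proof -
      have r: "real (2 ^ Suc k) = 2 powr real (Suc k)" by (simp only: powr_realpow) simp
      have "ln (real (2 ^ Suc k)) = real (Suc k) * ln 2" by (simp only: ln_realpow of_nat_power) (simp add: ln_realpow del: power_Suc)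
      moreover have "real (2 ^ Suc k) powr (- \<alpha>) = 2 powr (- real (Suc k) * \<alpha>)"
        unfolding r powr_powr by (simp add: algebra_simps)
      ultimately have t: "\<gamma> * (2 powr (- real (Suc k) * \<alpha>) / (real (Suc k) * ln 2)) \<le> tail (2 ^ Suc k)"
        using low[OF k2] by (simp only:)
      have "2 powr (real k * \<alpha>) * (real k * ln 2) powr (1 + \<epsilon>) - 1 \<le> real (m k)"
      proof -
        have "0 \<le> 2 powr (real k * \<alpha>) * (real k * ln 2) powr (1 + \<epsilon>)" by simp
        then show ?thesis unfolding m_def by linarith
      qed
      then have "h k \<le> real (m k) * (\<gamma> * (2 powr (- real (Suc k) * \<alpha>) / (real (Suc k) * ln 2)))"
        unfolding h_def using \<gamma> by (intro mult_right_mono) auto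
      also have "\<dots> \<le> real (m k) * tail (2 ^ Suc k)" using t by (intro mult_left_mono) auto
      finally show ?thesis by simp
    qed
    finally show ?thesis .
  qed
  have "\<forall>\<^sub>F k in sequentially. h k \<ge> 2 * ln (real k)"
    unfolding h_def using \<alpha> \<gamma> \<epsilon> by real_asymp
  then have "\<forall>\<^sub>F k in sequentially. norm (prob (B k)) \<le> real k powr (- 2)"
    using eventually_ge_at_top[of s0] eventually_ge_at_top[of 1]
  proof eventually_elim
    case (elim k)
    have "prob (B k) \<le> exp (- h k)" using elim by (intro Bk) auto
    also have "\<dots> \<le> exp (- (2 * ln (real k)))" using elim by simp
    also have "\<dots> = real k powr (- 2)" using elim by (simp add: powr_def)
    finally show ?case by simp
  qed
  then have "summable (\<lambda>k. prob (B k))"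
    by (rule summable_comparison_test_ev) (simp add: summable_real_powr_iff)
  then have "AE \<omega> in M. \<forall>\<^sub>F k in sequentially. \<omega> \<in> space M - B k"
    by (intro borel_cantelli_AE1) (auto simp: emeasure_eq_measure)
  then show ?thesis using l_pos
  proof eventually_elim
    case (elim \<omega>)
    then obtain k0 where k0: "\<And>k. k \<ge> k0 \<Longrightarrow> \<omega> \<in> space M - B k" unfolding eventually_sequentially by blast
    have "filterlim (\<lambda>t::nat. ln (real t) / ln 2 - 1) at_top sequentially" by real_asymp
    then have "\<forall>\<^sub>F t::nat in sequentially. ln (real t) / ln 2 - 1 \<ge> real (max k0 1)" by (simp only: filterlim_at_top)
    then show ?case using eventually_ge_at_top[of "1 + l 0 \<omega>"]
    proof eventually_elim
      case (elim t)
      obtain k where k: "2 ^ k \<le> t" "t < 2 ^ Suc k" "real k \<ge> ln (real t) / ln 2 - 1"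
        using dyadic_bracket[of t] elim(2) by auto
      have kk: "k \<ge> k0" "k \<ge> 1" using k(3) elim(1) by linarith+
      have rk: "real (2 ^ j) = 2 powr real j" for j by (simp add: powr_realpow)
      have "2 ^ Suc k \<le> S (m k) \<omega>" using k0[OF kk(1)] unfolding B_def by auto
      then have "N t \<omega> < m k" using k(2) elim(2) \<open>\<forall>n. 1 \<le> l n \<omega>\<close> by (intro N_less) auto
      moreover have "real (m k) \<le> 2 powr (real k * \<alpha>) * (real k * ln 2) powr (1 + \<epsilon>)"
        unfolding m_def by (simp add: of_nat_nat)
      moreover have "2 powr (real k * \<alpha>) * (real k * ln 2) powr (1 + \<epsilon>) \<le> real t powr \<alpha> * ln (real t) powr (1 + \<epsilon>)"
      proof (rule mult_mono)
        have le: "real (2 ^ k) \<le> real t" using k(1) by (simp only: of_nat_le_iff)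
        then have "real (2 ^ k) powr \<alpha> \<le> real t powr \<alpha>" using \<alpha> by (intro powr_mono2) auto
        then show "2 powr (real k * \<alpha>) \<le> real t powr \<alpha>" unfolding rk powr_powr .
        have "ln (real (2 ^ k)) \<le> ln (real t)" using le by (intro ln_mono) auto
        then have "real k * ln 2 \<le> ln (real t)" by (simp add: ln_realpow)
        then show "(real k * ln 2) powr (1 + \<epsilon>) \<le> ln (real t) powr (1 + \<epsilon>)"
          using \<epsilon> by (intro powr_mono2) auto
      qed auto
      ultimately show ?case by linarith
    qed
  qed
qed

lemma integrable_l:
  assumes mean: "\<And>T. (\<Sum>s=1..T. tail s) \<le> K"
  shows "integrable M (\<lambda>\<omega>. real (l 0 \<omega>))"
proof (rule integrableI_nonneg)
  have "(\<integral>\<^sup>+\<omega>. ennreal (real (l 0 \<omega>)) \<partial>M) \<le> ennreal K"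
  proof (rule LIMSEQ_le_const2)
    show "(\<lambda>T. \<integral>\<^sup>+\<omega>. ennreal (real (min (l 0 \<omega>) T)) \<partial>M) \<longlonglongrightarrow> (\<integral>\<^sup>+\<omega>. ennreal (real (l 0 \<omega>)) \<partial>M)"
    proof (rule nn_integral_LIMSEQ)
      show "incseq (\<lambda>T \<omega>. ennreal (real (min (l 0 \<omega>) T)))"
        by (auto simp: incseq_def le_fun_def intro!: ennreal_leI)
      show "(\<lambda>T. ennreal (real (min (l 0 \<omega>) T))) \<longlonglongrightarrow> ennreal (real (l 0 \<omega>))" for \<omega>
      proof (rule tendsto_eventually)
        show "\<forall>\<^sub>F T in sequentially. ennreal (real (min (l 0 \<omega>) T)) = ennreal (real (l 0 \<omega>))"
          using eventually_ge_at_top[of "l 0 \<omega>"] by eventually_elim (simp add: min_absorb1)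
      qed
    qed measurable
    have "(\<integral>\<^sup>+\<omega>. ennreal (real (min (l 0 \<omega>) T)) \<partial>M) \<le> ennreal K" for T
    proof -
      have "(\<integral>\<^sup>+\<omega>. ennreal (real (min (l 0 \<omega>) T)) \<partial>M) = ennreal (expectation (\<lambda>\<omega>. real (min (l 0 \<omega>) T)))"
        by (intro nn_integral_eq_integral integrable_const_bound[of _ "real T"]) auto
      then show ?thesis unfolding expectation_min using mean[of T] by (simp add: ennreal_leI)
    qed
    then show "\<exists>N. \<forall>T\<ge>N. (\<integral>\<^sup>+\<omega>. ennreal (real (min (l 0 \<omega>) T)) \<partial>M) \<le> ennreal K" by blast
  qed
  then show "(\<integral>\<^sup>+\<omega>. ennreal (real (l 0 \<omega>)) \<partial>M) < \<infinity>" by (rule le_less_trans) simp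
qed auto

lemma counting_LLN:
  assumes mean: "\<And>T. (\<Sum>s=1..T. tail s) \<le> K"
  shows "AE \<omega> in M. (\<lambda>t. real (N t \<omega>) / real t) \<longlonglongrightarrow> 1 / expectation (\<lambda>\<omega>. real (l 0 \<omega>))"
    and "expectation (\<lambda>\<omega>. real (l 0 \<omega>)) \<ge> 1"
proof -
  define \<mu> where "\<mu> = expectation (\<lambda>\<omega>. real (l 0 \<omega>))"
  have int: "integrable M (\<lambda>\<omega>. real (l 0 \<omega>))" by (rule integrable_l[OF mean])
  have "expectation (\<lambda>_. 1) \<le> \<mu>"
    unfolding \<mu>_def using l_pos int by (intro integral_mono_AE) (auto elim!: eventually_mono)
  then show \<mu>1: "expectation (\<lambda>\<omega>. real (l 0 \<omega>)) \<ge> 1" by (simp add: \<mu>_def prob_space)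
  interpret Y: iid_nonneg M "\<lambda>n \<omega>. real (l n \<omega>)"
  proof
    show "indep_vars (\<lambda>_. borel) (\<lambda>n \<omega>. real (l n \<omega>)) UNIV"
      by (rule indep_vars_compose2[OF indep]) auto
    have "distr M borel (\<lambda>\<omega>. real (l n \<omega>)) = distr (distr M (count_space UNIV) (l n)) borel real" for n
      by (subst distr_distr) (auto simp: comp_def)
    then show "distr M borel (\<lambda>\<omega>. real (l n \<omega>)) = distr M borel (\<lambda>\<omega>. real (l 0 \<omega>))" for n
      using ident[of n] by simp
  qed (use int in auto)
  from Y.strong_law_of_large_numbers have "AE \<omega> in M. (\<lambda>n. real (S n \<omega>) / real n) \<longlonglongrightarrow> \<mu>"
    by (simp add: S_def \<mu>_def)
  then show "AE \<omega> in M. (\<lambda>t. real (N t \<omega>) / real t) \<longlonglongrightarrow> 1 / expectation (\<lambda>\<omega>. real (l 0 \<omega>))"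
    using l_pos
  proof eventually_elim
    case (elim \<omega>)
    note lp = elim(2)
    have Ntop: "filterlim (\<lambda>t. N t \<omega>) at_top sequentially"
      unfolding filterlim_at_top
    proof
      fix n
      show "\<forall>\<^sub>F t in sequentially. n \<le> N t \<omega>"
        using eventually_ge_at_top[of "1 + S (Suc n) \<omega>"]
      proof eventually_elim
        case (elim t)
        then have "Suc n \<le> N t \<omega>" using lp by (intro N_ge) auto
        then show ?case by simp
      qed
    qed
    have lim1: "(\<lambda>t. real (S (N t \<omega>) \<omega>) / real (N t \<omega>)) \<longlonglongrightarrow> \<mu>"
      by (rule filterlim_compose[OF elim(1) Ntop])
    have "filterlim (\<lambda>t. Suc (N t \<omega>)) at_top sequentially"
      by (rule filterlim_compose[OF filterlim_Suc Ntop])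
    from filterlim_compose[OF elim(1) this]
    have lim2: "(\<lambda>t. real (S (Suc (N t \<omega>)) \<omega>) / real (Suc (N t \<omega>))) \<longlonglongrightarrow> \<mu>" .
    have lim3: "(\<lambda>t. real (Suc (N t \<omega>)) / real (N t \<omega>)) \<longlonglongrightarrow> 1"
      by (rule filterlim_compose[OF LIMSEQ_Suc_n_over_n Ntop])
    have "(\<lambda>t. real t / real (N t \<omega>)) \<longlonglongrightarrow> \<mu>"
    proof (rule tendsto_sandwich[OF _ _ lim1])
      show "(\<lambda>t. real (S (Suc (N t \<omega>)) \<omega>) / real (Suc (N t \<omega>)) * (real (Suc (N t \<omega>)) / real (N t \<omega>))) \<longlonglongrightarrow> \<mu>"
        using tendsto_mult[OF lim2 lim3] by simp
      show "\<forall>\<^sub>F t in sequentially. real (S (N t \<omega>) \<omega>) / real (N t \<omega>) \<le> real t / real (N t \<omega>)"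
        using eventually_ge_at_top[of "1 + l 0 \<omega>"]
      proof eventually_elim
        case (elim t)
        show ?case using N_props[OF lp elim] by (intro divide_right_mono) auto
      qed
      show "\<forall>\<^sub>F t in sequentially. real t / real (N t \<omega>) \<le> real (S (Suc (N t \<omega>)) \<omega>) / real (Suc (N t \<omega>)) * (real (Suc (N t \<omega>)) / real (N t \<omega>))"
        using eventually_ge_at_top[of "1 + l 0 \<omega>"]
      proof eventually_elim
        case (elim t)
        have "real t \<le> real (S (Suc (N t \<omega>)) \<omega>)" using N_props[OF lp elim] by linarith
        then have "real t / real (N t \<omega>) \<le> real (S (Suc (N t \<omega>)) \<omega>) / real (N t \<omega>)" by (intro divide_right_mono) auto
        then show ?case by simp
      qed
    qed
    then have "(\<lambda>t. 1 / (real t / real (N t \<omega>))) \<longlonglongrightarrow> 1 / \<mu>"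
      using \<mu>1 by (intro tendsto_intros) (auto simp: \<mu>_def)
    then show ?case by (simp add: \<mu>_def)
  qed
qed

end

section \<open>Decomposition into excursions\<close>

lemma tau_Suc_eq_enat_iff:
  "tau X (Suc n) \<omega> = enat b \<longleftrightarrow>
    (\<exists>a<b. tau X n \<omega> = enat a \<and> X b \<omega> = 0 \<and> (\<forall>u. a < u \<and> u < b \<longrightarrow> X u \<omega> \<noteq> 0))"
proof (cases "tau X n \<omega>")
  case (enat a)
  show ?thesis
  proof (cases "\<exists>t>a. X t \<omega> = 0")
    case True
    have "(LEAST t. t > a \<and> X t \<omega> = 0) = b \<longleftrightarrow> a < b \<and> X b \<omega> = 0 \<and> (\<forall>u. a < u \<and> u < b \<longrightarrow> X u \<omega> \<noteq> 0)"
    proof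
      assume b: "(LEAST t. t > a \<and> X t \<omega> = 0) = b"
      show "a < b \<and> X b \<omega> = 0 \<and> (\<forall>u. a < u \<and> u < b \<longrightarrow> X u \<omega> \<noteq> 0)"
        using LeastI_ex[of "\<lambda>t. t > a \<and> X t \<omega> = 0"] True not_less_Least[of _ "\<lambda>t. t > a \<and> X t \<omega> = 0"]
        unfolding b by blast
    next
      assume "a < b \<and> X b \<omega> = 0 \<and> (\<forall>u. a < u \<and> u < b \<longrightarrow> X u \<omega> \<noteq> 0)"
      then show "(LEAST t. t > a \<and> X t \<omega> = 0) = b"
        by (intro Least_equality) (auto simp: not_less[symmetric])
    qed
    then show ?thesis using enat True by auto
  next
    case False
    then show ?thesis using enat by auto
  qed
qed simp

lemma tau_finite_mono: "tau X n \<omega> \<noteq> \<infinity> \<Longrightarrow> m \<le> n \<Longrightarrow> tau X m \<omega> \<noteq> \<infinity>"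
proof (induction n)
  case (Suc n)
  then show ?case by (cases "m = Suc n") (auto split: enat.splits)
qed simp

lemma excursion_length_eq:
  assumes "tau X n \<omega> = enat a" "tau X (Suc n) \<omega> = enat b"
  shows "excursion X (Suc n) \<omega> = map (\<lambda>t. X t \<omega>) [a..<b]" "length (excursion X (Suc n) \<omega>) = b - a"
  using assms by (auto simp: excursion_def simp del: tau.simps)

lemma tau_eq_sum_length:
  assumes fin: "\<And>n. tau X n \<omega> \<noteq> \<infinity>"
  shows "tau X n \<omega> = enat (1 + (\<Sum>i<n. length (excursion X (Suc i) \<omega>)))"
    and "length (excursion X (Suc n) \<omega>) \<ge> 1"
proof -
  have step: "\<exists>a b. tau X n \<omega> = enat a \<and> tau X (Suc n) \<omega> = enat b \<and> a < b" for n
  proof -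
    obtain b where b: "tau X (Suc n) \<omega> = enat b" using fin[of "Suc n"] by (cases "tau X (Suc n) \<omega>") auto
    then show ?thesis using tau_Suc_eq_enat_iff[of X n \<omega> b] by auto
  qed
  show "tau X n \<omega> = enat (1 + (\<Sum>i<n. length (excursion X (Suc i) \<omega>)))"
  proof (induction n)
    case 0
    then show ?case by (simp add: one_enat_def)
  next
    case (Suc n)
    obtain a b where ab: "tau X n \<omega> = enat a" "tau X (Suc n) \<omega> = enat b" "a < b" using step by blast
    then show ?case using Suc excursion_length_eq(2)[OF ab(1,2)] by simp
  qed
  obtain a b where ab: "tau X n \<omega> = enat a" "tau X (Suc n) \<omega> = enat b" "a < b" using step by blast
  then show "length (excursion X (Suc n) \<omega>) \<ge> 1" using excursion_length_eq(2)[OF ab(1,2)] by simp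
qed

lemma mem_excursion:
  assumes fin: "\<And>n. tau X n \<omega> \<noteq> \<infinity>" and T: "T \<ge> 1"
  shows "\<exists>n. X T \<omega> \<in> set (excursion X (Suc n) \<omega>)"
proof -
  define s where "s n = 1 + (\<Sum>i<n. length (excursion X (Suc i) \<omega>))" for n
  have tau: "tau X n \<omega> = enat (s n)" for n unfolding s_def by (rule tau_eq_sum_length(1)[OF fin])
  have sn: "n < s n" for n
    using sum_mono[of "{..<n}" "\<lambda>_. 1" "\<lambda>i. length (excursion X (Suc i) \<omega>)"] tau_eq_sum_length(2)[OF fin]
    by (simp add: s_def)
  define n where "n = (LEAST n. T < s n)"
  have ex: "T < s n" unfolding n_def by (rule LeastI[of "\<lambda>n. T < s n" T]) (rule sn)
  have "n \<noteq> 0" using ex T by (auto simp: s_def intro: ccontr)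
  then obtain n' where n': "n = Suc n'" by (cases n) auto
  have "s n' \<le> T" using not_less_Least[of n' "\<lambda>n. T < s n"] n' unfolding n_def[symmetric] by auto
  then have "X T \<omega> \<in> set (excursion X (Suc n') \<omega>)"
    using ex n' excursion_length_eq(1)[OF tau[of n'] tau[of "Suc n'"]] by auto
  then show ?thesis by blast
qed

lemma tau_sets:
  assumes X: "\<And>t. t \<ge> 1 \<Longrightarrow> X t \<in> borel_measurable M"
  shows "{\<omega>\<in>space M. tau X n \<omega> = enat b} \<in> sets M"
proof (induction n arbitrary: b)
  case 0
  then show ?case by (cases "enat b = 1") auto
next
  case (Suc n)
  have Z: "{\<omega>\<in>space M. X u \<omega> = 0} \<in> sets M" if "u \<ge> 1" for u
    using X[OF that] by measurable
  have "{\<omega>\<in>space M. tau X (Suc n) \<omega> = enat b} = (\<Union>a\<in>{..<b}. {\<omega>\<in>space M. tau X n \<omega> = enat a} \<inter>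
      ({\<omega>\<in>space M. X b \<omega> = 0} \<inter> {\<omega>\<in>space M. \<forall>u\<in>{a<..<b}. X u \<omega> \<noteq> 0}))"
    unfolding tau_Suc_eq_enat_iff by auto
  also have "\<dots> \<in> sets M"
  proof (intro sets.finite_UN sets.Int Suc.IH)
    fix a assume a: "a \<in> {..<b}"
    show "{\<omega>\<in>space M. X b \<omega> = 0} \<in> sets M" using a by (intro Z) auto
    show "{\<omega>\<in>space M. \<forall>u\<in>{a<..<b}. X u \<omega> \<noteq> 0} \<in> sets M"
    proof (rule sets.sets_Collect_finite_All)
      fix u assume "u \<in> {a<..<b}"
      then have [measurable]: "X u \<in> borel_measurable M" by (intro X) auto
      show "{\<omega>\<in>space M. X u \<omega> \<noteq> 0} \<in> sets M" by measurable
    qed simp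
  qed simp
  finally show ?case .
qed

lemma tau_finite_sets:
  assumes X: "\<And>t. t \<ge> 1 \<Longrightarrow> X t \<in> borel_measurable M"
  shows "{\<omega>\<in>space M. tau X n \<omega> < \<infinity>} \<in> sets M"
proof -
  have "{\<omega>\<in>space M. tau X n \<omega> < \<infinity>} = (\<Union>b. {\<omega>\<in>space M. tau X n \<omega> = enat b})"
    by (auto simp del: tau.simps)
  also have "\<dots> \<in> sets M" by (intro sets.countable_UN) (auto intro: tau_sets[OF X])
  finally show ?thesis .
qed

lemma eta_1_finite_iff: "eta X 1 \<omega> < \<infinity> \<longleftrightarrow> tau X 1 \<omega> < \<infinity>"
  by (cases "tau X 1 \<omega>") (auto simp: eta_def one_enat_def simp del: tau.simps(2))

lemma eta_Suc_finite_iff: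
  "eta X (n + 1) \<omega> < \<infinity> \<and> tau X n \<omega> < \<infinity> \<longleftrightarrow> tau X (n + 1) \<omega> < \<infinity>"
proof -
  have "tau X n \<omega> \<noteq> \<infinity>" if "tau X (n + 1) \<omega> \<noteq> \<infinity>" using tau_finite_mono[OF that, of n] by simp
  then show ?thesis
    by (cases "tau X (n + 1) \<omega>"; cases "tau X n \<omega>") (auto simp: eta_def simp del: tau.simps)
qed

lemma (in prob_space) indep_vars_Suc:
  assumes "indep_vars M' Z {1..}"
  shows "indep_vars (\<lambda>i. M' (Suc i)) (\<lambda>i. Z (Suc i)) UNIV"
  unfolding indep_vars_def2
proof (intro conjI ballI)
  show "random_variable (M' (Suc i)) (Z (Suc i))" for i
    using assms by (auto simp: indep_vars_def2)
  let ?G = "\<lambda>i. {Z i -` A \<inter> space M |A. A \<in> sets (M' i)}"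
  have ind: "indep_sets ?G {1..}" using assms by (simp add: indep_vars_def2)
  show "indep_sets (\<lambda>i. ?G (Suc i)) UNIV"
  proof (rule indep_setsI)
    show "?G (Suc i) \<subseteq> events" for i using ind by (auto simp: indep_sets_def)
    fix A J assume J: "J \<noteq> {}" "finite J" and A: "\<forall>j\<in>J. A j \<in> ?G (Suc j)"
    have "prob (\<Inter>j\<in>Suc ` J. A (j - 1)) = (\<Prod>j\<in>Suc ` J. prob (A (j - 1)))"
      by (rule indep_setsD[OF ind]) (use J A in auto)
    then show "prob (\<Inter>j\<in>J. A j) = (\<Prod>j\<in>J. prob (A j))"
      by (simp add: prod.reindex)
  qed
qed

context lamperti_process
begin

abbreviation excursions_iid_if_recurrent :: bool where
  "excursions_iid_if_recurrent \<equiv>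
     emeasure M {\<omega>\<in>space M. Nexc X \<omega> = \<infinity>} > 0 \<longrightarrow>
     (let P = uniform_measure M {\<omega>\<in>space M. Nexc X \<omega> = \<infinity>} in
     prob_space.indep_vars P (\<lambda>_. count_space UNIV) (excursion X) {1..} \<and>
     (\<forall>n\<ge>1. distr P (count_space UNIV) (excursion X n)
     = distr P (count_space UNIV) (excursion X 1)))"

abbreviation return_prob_constant :: bool where
  "return_prob_constant \<equiv>
     \<forall>n\<ge>1. measure M {\<omega>\<in>space M. tau X n \<omega> < \<infinity>} > 0 \<longrightarrow>
     measure M {\<omega>\<in>space M. eta X (n + 1) \<omega> < \<infinity> \<and> tau X n \<omega> < \<infinity>}
     / measure M {\<omega>\<in>space M. tau X n \<omega> < \<infinity>}
     = measure M {\<omega>\<in>space M. eta X 1 \<omega> < \<infinity>}"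

lemma alive_iff_tau: "\<omega> \<in> space M \<Longrightarrow> tau X 1 \<omega> = enat b \<Longrightarrow> \<omega> \<in> alive t \<longleftrightarrow> t < b"
proof -
  assume w: "\<omega> \<in> space M" and b: "tau X 1 \<omega> = enat b"
  have "1 < b \<and> X b \<omega> = 0 \<and> (\<forall>u. 1 < u \<and> u < b \<longrightarrow> X u \<omega> \<noteq> 0)"
    using tau_Suc_eq_enat_iff[of X 0 \<omega> b] b by (auto simp: one_enat_def simp del: tau.simps(2))
  then show ?thesis using w unfolding alive_def by (auto simp: not_less)
qed

lemma tau_infinite_alive: "\<omega> \<in> space M \<Longrightarrow> tau X 1 \<omega> = \<infinity> \<Longrightarrow> \<omega> \<in> alive t"
  by (auto simp: alive_def one_enat_def split: if_splits)

lemma AE_tau_finite: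
  assumes recur: "(\<lambda>t. prob (alive t)) \<longlonglongrightarrow> 0"
    and A3b: "return_prob_constant"
  shows "AE \<omega> in M. \<forall>n. tau X n \<omega> \<noteq> \<infinity>"
proof -
  note sets_fin = tau_finite_sets[OF X_meas]
  have p1: "prob {\<omega>\<in>space M. tau X 1 \<omega> < \<infinity>} = 1"
  proof -
    have "1 - prob {\<omega>\<in>space M. tau X 1 \<omega> < \<infinity>} = prob (space M - {\<omega>\<in>space M. tau X 1 \<omega> < \<infinity>})"
      by (rule prob_compl[symmetric, OF sets_fin]) simp
    also have "\<dots> \<le> prob (alive t)" for t
    proof (rule finite_measure_mono)
      show "space M - {\<omega>\<in>space M. tau X 1 \<omega> < \<infinity>} \<subseteq> alive t"
        using tau_infinite_alive by (auto simp del: tau.simps)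
    qed simp
    finally have "1 - prob {\<omega>\<in>space M. tau X 1 \<omega> < \<infinity>} \<le> 0"
      by (intro LIMSEQ_le_const[OF recur]) auto
    then show ?thesis using prob_le_1[of "{\<omega>\<in>space M. tau X 1 \<omega> < \<infinity>}"] by linarith
  qed
  have pn: "prob {\<omega>\<in>space M. tau X n \<omega> < \<infinity>} = 1" if "n \<ge> 1" for n
    using that
  proof (induction n rule: nat_induct_at_least)
    case (Suc n)
    have "prob {\<omega>\<in>space M. eta X (n + 1) \<omega> < \<infinity> \<and> tau X n \<omega> < \<infinity>} = prob {\<omega>\<in>space M. eta X 1 \<omega> < \<infinity>}"
    proof -
      have "0 < prob {\<omega>\<in>space M. tau X n \<omega> < \<infinity>}" unfolding Suc.IH by simp
      from A3b[rule_format, OF Suc.hyps this] show ?thesis unfolding Suc.IH by (simp only: div_by_1)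
    qed
    then show ?case unfolding eta_Suc_finite_iff eta_1_finite_iff using p1 by simp
  qed (rule p1)
  have "AE \<omega> in M. tau X n \<omega> < \<infinity>" for n
  proof (cases "n \<ge> 1")
    case True
    have "AE \<omega> in M. \<omega> \<in> {\<omega>\<in>space M. tau X n \<omega> < \<infinity>}"
      by (rule AE_prob_1[OF pn[OF True]])
    then show ?thesis by (auto elim!: eventually_mono simp del: tau.simps)
  next
    case False
    then have "n = 0" by simp
    then show ?thesis by (simp add: one_enat_def)
  qed
  then show ?thesis unfolding AE_all_countable by (auto simp del: tau.simps)
qed

lemma excursions_iid:
  assumes fin: "AE \<omega> in M. \<forall>n. tau X n \<omega> \<noteq> \<infinity>"
    and A3a: "excursions_iid_if_recurrent"
  shows "indep_vars (\<lambda>_. count_space UNIV) (excursion X) {1..}"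
    and "\<And>n. n \<ge> 1 \<Longrightarrow> distr M (count_space UNIV) (excursion X n) = distr M (count_space UNIV) (excursion X 1)"
proof -
  define A where "A = {\<omega>\<in>space M. Nexc X \<omega> = \<infinity>}"
  have "A = {\<omega>\<in>space M. \<forall>n\<in>{1..}. tau X n \<omega> < \<infinity>}"
    by (auto simp: A_def Nexc_def split: if_splits simp del: tau.simps)
  also have "\<dots> \<in> sets M"
    by (intro sets.sets_Collect_countable_Ball tau_finite_sets[OF X_meas]) auto
  finally have [measurable]: "A \<in> sets M" .
  have "AE \<omega> in M. \<omega> \<in> A" using fin AE_space
    by eventually_elim (auto simp: A_def Nexc_def simp del: tau.simps)
  then have A1: "emeasure M A = 1" using emeasure_eq_1_AE \<open>A \<in> sets M\<close> by blast
  have uM: "uniform_measure M A = M"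
  proof (rule measure_eqI)
    fix B assume "B \<in> sets (uniform_measure M A)"
    then have [measurable]: "B \<in> sets M" by simp
    have "emeasure (uniform_measure M A) B = emeasure M (A \<inter> B)"
      using A1 divide_ennreal[of "prob (A \<inter> B)" 1] by (simp add: emeasure_eq_measure)
    also have "\<dots> = emeasure M B"
      using \<open>AE \<omega> in M. \<omega> \<in> A\<close> by (intro emeasure_eq_AE) (auto elim!: eventually_mono)
    finally show "emeasure (uniform_measure M A) B = emeasure M B" .
  qed simp
  have "0 < emeasure M A" unfolding A1 by simp
  note iid = A3a[folded A_def, rule_format, OF this, unfolded Let_def uM]
  show "indep_vars (\<lambda>_. count_space UNIV) (excursion X) {1..}"
    by (rule iid[THEN conjunct1])
  show "\<And>n. n \<ge> 1 \<Longrightarrow> distr M (count_space UNIV) (excursion X n) = distr M (count_space UNIV) (excursion X 1)"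
    by (rule iid[THEN conjunct2, rule_format])
qed

lemma renewal_excursions:
  assumes fin: "AE \<omega> in M. \<forall>n. tau X n \<omega> \<noteq> \<infinity>"
    and indep: "indep_vars (\<lambda>_. count_space UNIV) (excursion X) {1..}"
    and ident: "\<And>n. n \<ge> 1 \<Longrightarrow> distr M (count_space UNIV) (excursion X n) = distr M (count_space UNIV) (excursion X 1)"
  shows "renewal_process M (\<lambda>n \<omega>. length (excursion X (Suc n) \<omega>))"
proof
  have [measurable]: "excursion X (Suc n) \<in> measurable M (count_space UNIV)" for n
    using indep by (auto simp: indep_vars_def)
  show "indep_vars (\<lambda>_. count_space UNIV) (\<lambda>n \<omega>. length (excursion X (Suc n) \<omega>)) UNIV"
    by (rule indep_vars_compose2[OF indep_vars_Suc[OF indep]]) auto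
  have "distr M (count_space UNIV) (\<lambda>\<omega>. length (excursion X (Suc n) \<omega>))
      = distr (distr M (count_space UNIV) (excursion X (Suc n))) (count_space UNIV) length" for n
    by (subst distr_distr) (auto simp: comp_def)
  then show "distr M (count_space UNIV) (\<lambda>\<omega>. length (excursion X (Suc n) \<omega>))
      = distr M (count_space UNIV) (\<lambda>\<omega>. length (excursion X (Suc 0) \<omega>))" for n
    using ident[of "Suc n"] by simp
  show "AE \<omega> in M. \<forall>n. 1 \<le> length (excursion X (Suc n) \<omega>)"
    using fin
  proof eventually_elim
    case (elim \<omega>)
    show ?case using tau_eq_sum_length(2)[of X \<omega>] elim by blast
  qed
qed

text \<open>
  (A1) only says that \<open>y\<close> is visited in some excursion; that the first one does so with positive probability
  uses that the excursions are identically distributed.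
\<close>

lemma visits_high:
  assumes fin: "AE \<omega> in M. \<forall>n. tau X n \<omega> \<noteq> \<infinity>"
    and indep: "indep_vars (\<lambda>_. count_space UNIV) (excursion X) {1..}"
    and ident: "\<And>n. n \<ge> 1 \<Longrightarrow> distr M (count_space UNIV) (excursion X n) = distr M (count_space UNIV) (excursion X 1)"
    and hit: "T \<ge> 1" "prob (at_in T {y}) > 0"
  shows "\<exists>k\<ge>1. prob (alive k \<inter> at_in k {y}) > 0"
proof (rule ccontr)
  assume no: "\<not> (\<exists>k\<ge>1. prob (alive k \<inter> at_in k {y}) > 0)"
  have [measurable]: "excursion X (Suc n) \<in> measurable M (count_space UNIV)" for n
    using indep by (auto simp: indep_vars_def)
  define E where "E n = {\<omega>\<in>space M. y \<in> set (excursion X (Suc n) \<omega>)}" for n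
  have Em: "E n = excursion X (Suc n) -` {xs. y \<in> set xs} \<inter> space M" for n by (auto simp: E_def)
  have [measurable]: "E n \<in> sets M" for n unfolding Em by measurable
  have "AE \<omega> in M. \<omega> \<notin> alive k \<inter> at_in k {y}" if "k \<ge> 1" for k
  proof -
    have "prob (alive k \<inter> at_in k {y}) = 0" using no that by (simp add: zero_less_measure_iff)
    then show ?thesis using that by (intro AE_not_in null_setsI sets.Int alive_sets at_in_sets) (auto simp: emeasure_eq_measure)
  qed
  then have "AE \<omega> in M. \<forall>k\<in>{1..}. \<omega> \<notin> alive k \<inter> at_in k {y}"
    by (subst AE_ball_countable) auto
  then have "AE \<omega> in M. \<omega> \<notin> E 0" using fin
  proof eventually_elim
    case (elim \<omega>)
    have "tau X 1 \<omega> \<noteq> \<infinity>" using elim(2) by blast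
    then obtain b where b: "tau X 1 \<omega> = enat b" unfolding not_infinity_eq by blast
    have t0: "tau X 0 \<omega> = enat 1" by (simp add: one_enat_def)
    show ?case
    proof
      assume e: "\<omega> \<in> E 0"
      then have sp: "\<omega> \<in> space M" by (simp add: E_def)
      have "y \<in> (\<lambda>t. X t \<omega>) ` {1..<b}"
        using e excursion_length_eq(1)[OF t0, of b] b by (simp add: E_def del: tau.simps)
      then obtain k where k: "1 \<le> k" "k < b" "X k \<omega> = y" by auto
      then have "\<omega> \<in> alive k \<inter> at_in k {y}"
        using alive_iff_tau[OF sp b] sp by (auto simp: at_in_def)
      then show False using elim(1) k by auto
    qed
  qed
  then have "prob (E 0) = 0" by (subst prob_eq_0) auto
  moreover have "prob (E n) = measure (distr M (count_space UNIV) (excursion X (Suc n))) {xs. y \<in> set xs}" for n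
    unfolding Em by (subst measure_distr) auto
  ultimately have "prob (E n) = 0" for n using ident[of "Suc n"] by simp
  then have "AE \<omega> in M. \<omega> \<notin> E n" for n by (subst (asm) prob_eq_0) auto
  then have "AE \<omega> in M. \<forall>n. \<omega> \<notin> E n" by (simp add: AE_all_countable)
  then have "AE \<omega> in M. \<omega> \<notin> at_in T {y}" using fin
  proof eventually_elim
    case (elim \<omega>)
    show ?case
    proof
      assume "\<omega> \<in> at_in T {y}"
      then have "\<omega> \<in> space M" "X T \<omega> = y" by (auto simp: at_in_def)
      moreover obtain n where "X T \<omega> \<in> set (excursion X (Suc n) \<omega>)"
        using mem_excursion[of X \<omega> T] elim(2) hit(1) by auto
      ultimately show False using elim(1) by (auto simp: E_def)
    qed
  qed
  then have "prob (at_in T {y}) = 0" using hit(1) by (subst prob_eq_0) (auto intro: at_in_sets)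
  then show False using hit(2) by simp
qed

lemma hit_from_zero:
  assumes y: "\<phi>' 0 > 0" and hit: "AE \<omega> in M. real_cond_exp M (F 1)
        (indicator {\<omega>'\<in>space M. X (1 + m' (X 1 \<omega>')) \<omega>' = y} :: 'a \<Rightarrow> real) \<omega> \<ge> \<phi>' (X 1 \<omega>)"
  shows "\<exists>T\<ge>1. prob (at_in T {y}) > 0"
proof -
  interpret sigma_finite_subalgebra M "F 1" by (rule subalg) simp
  define R where "R = {\<omega>\<in>space M. X (1 + m' (X 1 \<omega>)) \<omega> = y}"
  have "R = (\<Union>x\<in>S. at_in 1 {x} \<inter> at_in (1 + m' x) {y})"
    using S_valued[of 1] by (auto simp: R_def at_in_def)
  then have [measurable]: "R \<in> sets M"
    by (simp only:) (intro sets.countable_UN' countable_S; auto intro!: sets.Int at_in_sets)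
  have int: "integrable M (indicator R :: 'a \<Rightarrow> real)" by (auto simp: emeasure_eq_measure)
  have "\<phi>' 0 = (\<integral>\<omega>. \<phi>' 0 \<partial>M)" by (simp add: prob_space)
  also have "\<dots> \<le> (\<integral>\<omega>. real_cond_exp M (F 1) (indicator R) \<omega> \<partial>M)"
  proof (rule integral_mono_AE)
    show "integrable M (real_cond_exp M (F 1) (indicator R))" by (rule real_cond_exp_int(1)[OF int])
    show "AE \<omega> in M. \<phi>' 0 \<le> real_cond_exp M (F 1) (indicator R) \<omega>"
      using hit start unfolding R_def by eventually_elim simp
  qed simp
  also have "\<dots> = prob R" using real_cond_exp_int(2)[OF int] by simp
  also have "\<dots> \<le> prob (at_in (1 + m' 0) {y})"
    using start AE_space by (intro finite_measure_mono_AE at_in_sets) (auto simp: R_def at_in_def elim!: eventually_mono)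
  finally show ?thesis using y by (intro exI[of _ "1 + m' 0"]) auto
qed

lemma recurrence:
  assumes bound: "\<And>T. T \<ge> T0 \<Longrightarrow> (\<Sum>t=1..T. prob (alive t)) \<le> g T"
    and g: "(\<lambda>T. g T / real T) \<longlonglongrightarrow> 0"
  shows "(\<lambda>t. prob (alive t)) \<longlonglongrightarrow> 0"
proof (rule tendsto_sandwich[OF _ _ tendsto_const g])
  show "\<forall>\<^sub>F t in sequentially. prob (alive t) \<le> g t / real t"
    using eventually_ge_at_top[of "max 1 T0"]
  proof eventually_elim
    case (elim t)
    have "real t * prob (alive t) = (\<Sum>s=1..t. prob (alive t))" by simp
    also have "\<dots> \<le> (\<Sum>s=1..t. prob (alive s))" by (intro sum_mono prob_alive_antimono) auto
    also have "\<dots> \<le> g t" using elim by (intro bound) auto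
    finally show ?case using elim by (simp add: field_simps)
  qed
qed auto

end

context lamperti_process
begin

lemma tail_eq_prob_alive:
  assumes fin: "AE \<omega> in M. \<forall>n. tau X n \<omega> \<noteq> \<infinity>"
    and [measurable]: "excursion X (Suc 0) \<in> measurable M (count_space UNIV)"
  shows "prob {\<omega>\<in>space M. s \<le> length (excursion X (Suc 0) \<omega>)} = prob (alive s)"
proof (rule finite_measure_eq_AE)
  show "AE \<omega> in M. \<omega> \<in> {\<omega>\<in>space M. s \<le> length (excursion X (Suc 0) \<omega>)} \<longleftrightarrow> \<omega> \<in> alive s"
    using fin AE_space
  proof eventually_elim
    case (elim \<omega>)
    have "tau X 1 \<omega> \<noteq> \<infinity>" using elim(1) by blast
    then obtain b where b: "tau X 1 \<omega> = enat b" unfolding not_infinity_eq by blast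
    have t0: "tau X 0 \<omega> = enat 1" by (simp add: one_enat_def)
    have "1 < b" using tau_Suc_eq_enat_iff[of X 0 \<omega> b] b t0 by (auto simp del: tau.simps)
    then show ?case
      using elim(2) alive_iff_tau[OF elim(2) b, of s] excursion_length_eq(2)[OF t0, of b] b
      by (auto simp del: tau.simps)
  qed
qed measurable

lemma Ncount_eq_Max:
  assumes "\<forall>n. tau X n \<omega> \<noteq> \<infinity>"
  shows "Ncount X t \<omega> = Max {n. n \<ge> 1 \<and> 1 + (\<Sum>i<n. length (excursion X (Suc i) \<omega>)) \<le> t}"
  unfolding Ncount_def using tau_eq_sum_length(1)[of X \<omega>] assms by simp

lemma Ncount_growth:
  assumes a: "a > 0" "a \<le> 2" and c: "c = - (a - 1) * s2 / 2"
    and hit: "\<And>y. \<exists>y0>y. \<exists>T\<ge>1. prob (at_in T {y0}) > 0"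
    and A3a: "excursions_iid_if_recurrent"
    and A3b: "return_prob_constant"
    and \<epsilon>: "\<epsilon> > 0"
  shows "AE \<omega> in M. \<forall>\<^sub>F t in sequentially.
          real t powr (a / 2) * ln (real t) powr (- 2 - a - \<epsilon>) \<le> real (Ncount X t \<omega>) \<and>
          real (Ncount X t \<omega>) \<le> real t powr (a / 2) * ln (real t) powr (1 + \<epsilon>)"
proof -
  obtain K T0 where K: "K \<ge> 0" and mean: "\<And>T. T \<ge> T0 \<Longrightarrow>
      (\<Sum>t=1..T. prob (alive t)) \<le> K * (real T powr (1 - a / 2) * ln (real T) powr (1 + a))"
    using truncated_mean_bound[OF a c] by blast
  have recur: "(\<lambda>t. prob (alive t)) \<longlonglongrightarrow> 0"
  proof (rule recurrence[OF mean])
    show "(\<lambda>T. K * (real T powr (1 - a / 2) * ln (real T) powr (1 + a)) / real T) \<longlonglongrightarrow> 0"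
      using a by real_asymp
  qed
  note fin = AE_tau_finite[OF recur A3b]
  note iid = excursions_iid[OF fin A3a]
  interpret R: renewal_process M "\<lambda>n \<omega>. length (excursion X (Suc n) \<omega>)"
    by (rule renewal_excursions[OF fin iid])
  have exc [measurable]: "excursion X (Suc 0) \<in> measurable M (count_space UNIV)"
    using iid(1) by (auto simp: indep_vars_def)
  have tail: "R.tail s = prob (alive s)" for s
    unfolding R.tail_def by (rule tail_eq_prob_alive[OF fin exc])
  have "\<exists>y0>y. \<exists>k\<ge>1. prob (alive k \<inter> at_in k {y0}) > 0" for y
    using hit[of y] visits_high[OF fin iid] by blast
  from tail_lower_bound[OF a c this recur] obtain \<gamma> s0 where \<gamma>: "\<gamma> > 0"
    and low: "\<And>s. s \<ge> s0 \<Longrightarrow> \<gamma> * (real s powr (- a / 2) / ln (real s)) \<le> prob (alive s)" by blast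
  have "AE \<omega> in M. \<forall>\<^sub>F t in sequentially. real t powr (a / 2) * ln (real t) powr (- 2 - 2 * (a / 2) - \<epsilon>) \<le> real (R.N t \<omega>)"
    using a mean by (intro R.lower_growth[OF _ _ K \<epsilon>, where ?T0.0 = T0]) (auto simp: tail)
  moreover have "AE \<omega> in M. \<forall>\<^sub>F t in sequentially. real (R.N t \<omega>) \<le> real t powr (a / 2) * ln (real t) powr (1 + \<epsilon>)"
    using a low by (intro R.upper_growth[OF _ _ \<gamma> \<epsilon>, where ?s0.0 = s0]) (auto simp: tail)
  ultimately show ?thesis using fin
  proof eventually_elim
    case (elim \<omega>)
    have "R.N t \<omega> = Ncount X t \<omega>" for t
      unfolding R.N_def R.S_def by (rule Ncount_eq_Max[OF elim(3), symmetric])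
    then show ?case using eventually_conj[OF elim(1,2)] by simp
  qed
qed

lemma Ncount_LLN:
  assumes neg: "2 * c + s2 < 0"
    and A3a: "excursions_iid_if_recurrent"
    and A3b: "return_prob_constant"
  shows "let e = (\<integral>\<^sup>+ \<omega>. ennreal_of_enat (eta X 1 \<omega>) \<partial>M) in
          0 < e \<and> e < \<infinity> \<and>
          (AE \<omega> in M. (\<lambda>t. real (Ncount X t \<omega>) / real t) \<longlonglongrightarrow> 1 / enn2real e)"
proof -
  obtain K where mean: "\<And>T. (\<Sum>t=1..T. prob (alive t)) \<le> K"
    using mean_bound[OF neg] by blast
  have recur: "(\<lambda>t. prob (alive t)) \<longlonglongrightarrow> 0"
  proof (rule recurrence[OF mean])
    show "(\<lambda>T. K / real T) \<longlonglongrightarrow> 0" by real_asymp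
  qed
  note fin = AE_tau_finite[OF recur A3b]
  note iid = excursions_iid[OF fin A3a]
  interpret R: renewal_process M "\<lambda>n \<omega>. length (excursion X (Suc n) \<omega>)"
    by (rule renewal_excursions[OF fin iid])
  have exc [measurable]: "excursion X (Suc 0) \<in> measurable M (count_space UNIV)"
    using iid(1) by (auto simp: indep_vars_def)
  have tail: "R.tail s = prob (alive s)" for s
    unfolding R.tail_def by (rule tail_eq_prob_alive[OF fin exc])
  have mean': "(\<Sum>s=1..T. R.tail s) \<le> K" for T unfolding tail by (rule mean)
  define \<mu> where "\<mu> = expectation (\<lambda>\<omega>. real (length (excursion X (Suc 0) \<omega>)))"
  have \<mu>: "\<mu> \<ge> 1" unfolding \<mu>_def by (rule R.counting_LLN(2)[OF mean'])
  have "(\<integral>\<^sup>+ \<omega>. ennreal_of_enat (eta X 1 \<omega>) \<partial>M) = (\<integral>\<^sup>+ \<omega>. ennreal (real (length (excursion X (Suc 0) \<omega>))) \<partial>M)"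
  proof (rule nn_integral_cong_AE)
    show "AE \<omega> in M. ennreal_of_enat (eta X 1 \<omega>) = ennreal (real (length (excursion X (Suc 0) \<omega>)))"
      using fin
    proof eventually_elim
      case (elim \<omega>)
      have "tau X 1 \<omega> \<noteq> \<infinity>" using elim by blast
      then obtain b where b: "tau X 1 \<omega> = enat b" unfolding not_infinity_eq by blast
      have t0: "tau X 0 \<omega> = enat 1" by (simp add: one_enat_def)
      have "eta X 1 \<omega> = enat (b - 1)" using b t0 by (simp add: eta_def del: tau.simps)
      then show ?case using excursion_length_eq(2)[OF t0, of b] b
        by (simp add: ennreal_of_nat_eq_real_of_nat del: tau.simps)
    qed
  qed
  also have "\<dots> = ennreal \<mu>"
    unfolding \<mu>_def by (rule nn_integral_eq_integral[OF R.integrable_l[OF mean']]) simp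
  finally have e: "(\<integral>\<^sup>+ \<omega>. ennreal_of_enat (eta X 1 \<omega>) \<partial>M) = ennreal \<mu>" .
  have "AE \<omega> in M. (\<lambda>t. real (Ncount X t \<omega>) / real t) \<longlonglongrightarrow> 1 / \<mu>"
    using R.counting_LLN(1)[OF mean'] fin
  proof eventually_elim
    case (elim \<omega>)
    have "R.N t \<omega> = Ncount X t \<omega>" for t
      unfolding R.N_def R.S_def by (rule Ncount_eq_Max[OF elim(2), symmetric])
    then show ?case using elim(1) by (simp add: \<mu>_def)
  qed
  then show ?thesis unfolding e Let_def using \<mu> by simp
qed

end

theorem theorem2p5:
  fixes M :: "'a measure" and F :: "nat \<Rightarrow> 'a measure"
    and X :: "nat \<Rightarrow> 'a \<Rightarrow> real" and S :: "real set"
    and c s2 r :: real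
  assumes prob: "prob_space M"
    \<comment> \<open>(A0): state space\<close>
    and S_nonneg: "S \<subseteq> {0..}" and S_zero: "0 \<in> S"
    and S_locfin: "\<forall>b. finite {x\<in>S. x \<le> b}" and S_unbdd: "\<not> bdd_above S"
    \<comment> \<open>(A0): filtration and adapted S-valued process, X_1 = 0 a.s.\<close>
    and filt_sub: "\<forall>t\<ge>1. subalgebra M (F t)"
    and filt_mono: "\<forall>s t. 1 \<le> s \<and> s \<le> t \<longrightarrow> sets (F s) \<subseteq> sets (F t)"
    and adapted: "\<forall>t\<ge>1. X t \<in> borel_measurable (F t)"
    and S_valued: "\<forall>t\<ge>1. \<forall>\<omega>\<in>space M. X t \<omega> \<in> S"
    and start: "AE \<omega> in M. X 1 \<omega> = 0"
    \<comment> \<open>(A1): irreducibility\<close>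
    and A1: "\<exists>m :: real \<Rightarrow> real \<Rightarrow> nat. \<exists>\<phi> :: real \<Rightarrow> real \<Rightarrow> real.
               (\<forall>x\<in>S. \<forall>y\<in>S. m x y \<ge> 1 \<and> \<phi> x y > 0) \<and>
               (\<forall>y\<in>S. \<forall>t\<ge>1. AE \<omega> in M.
                  real_cond_exp M (F t)
                    (indicator {\<omega>'\<in>space M. X (t + m (X t \<omega>') y) \<omega>' = y} :: 'a \<Rightarrow> real) \<omega>
                  \<ge> \<phi> (X t \<omega>) y)"
    \<comment> \<open>(A2): Lamperti drift with uniform error terms\<close>
    and s2_pos: "s2 > 0"
    and A2: "\<forall>\<epsilon>>0. \<exists>x0. \<forall>t\<ge>1. AE \<omega> in M. X t \<omega> \<ge> x0 \<longrightarrow>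
               nn_cond_exp M (F t) (\<lambda>\<omega>'. ennreal ((X (Suc t) \<omega>' - X t \<omega>') ^ 2)) \<omega> < \<top> \<and>
               \<bar>real_cond_exp M (F t) (\<lambda>\<omega>'. X (Suc t) \<omega>' - X t \<omega>') \<omega> - c / X t \<omega>\<bar>
                  \<le> \<epsilon> / (X t \<omega> * ln (X t \<omega>)) \<and>
               \<bar>enn2real (nn_cond_exp M (F t) (\<lambda>\<omega>'. ennreal ((X (Suc t) \<omega>' - X t \<omega>') ^ 2)) \<omega>) - s2\<bar>
                  \<le> \<epsilon> / ln (X t \<omega>)"
    and r_def: "r = - 2 * c / s2"
    \<comment> \<open>(A3)(a): on {N = \<infinity>} the excursions are i.i.d.\<close>
    and A3a: "emeasure M {\<omega>\<in>space M. Nexc X \<omega> = \<infinity>} > 0 \<longrightarrow>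
               (let P = uniform_measure M {\<omega>\<in>space M. Nexc X \<omega> = \<infinity>} in
                  prob_space.indep_vars P (\<lambda>_. count_space UNIV) (excursion X) {1..} \<and>
                  (\<forall>n\<ge>1. distr P (count_space UNIV) (excursion X n)
                          = distr P (count_space UNIV) (excursion X 1)))"
    \<comment> \<open>(A3)(b)\<close>
    and A3b: "\<forall>n\<ge>1. measure M {\<omega>\<in>space M. tau X n \<omega> < \<infinity>} > 0 \<longrightarrow>
               measure M {\<omega>\<in>space M. eta X (n + 1) \<omega> < \<infinity> \<and> tau X n \<omega> < \<infinity>}
                 / measure M {\<omega>\<in>space M. tau X n \<omega> < \<infinity>}
               = measure M {\<omega>\<in>space M. eta X 1 \<omega> < \<infinity>}"
  shows
    "(-1 < r \<and> r \<le> 1 \<and> (\<exists>p>2. moment_cond M F X p) \<longrightarrow>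
       (\<forall>\<epsilon>>0. AE \<omega> in M. \<forall>\<^sub>F t in sequentially.
          real t powr ((1 + r) / 2) * ln (real t) powr (- 3 - r - \<epsilon>) \<le> real (Ncount X t \<omega>) \<and>
          real (Ncount X t \<omega>) \<le> real t powr ((1 + r) / 2) * ln (real t) powr (1 + \<epsilon>)))
     \<and>
     (r > 1 \<and> (\<exists>p>1 + r. moment_cond M F X p) \<longrightarrow>
       (let e = (\<integral>\<^sup>+ \<omega>. ennreal_of_enat (eta X 1 \<omega>) \<partial>M) in
          0 < e \<and> e < \<infinity> \<and>
          (AE \<omega> in M. (\<lambda>t. real (Ncount X t \<omega>) / real t) \<longlonglongrightarrow> 1 / enn2real e)))"
proof -
  interpret prob_space M by (rule prob)
  obtain m \<phi> where mpos: "\<And>x y. x \<in> S \<Longrightarrow> y \<in> S \<Longrightarrow> m x y \<ge> 1 \<and> \<phi> x y > 0"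
    and ret: "\<And>y t. y \<in> S \<Longrightarrow> t \<ge> 1 \<Longrightarrow> AE \<omega> in M. real_cond_exp M (F t)
        (indicator {\<omega>'\<in>space M. X (t + m (X t \<omega>') y) \<omega>' = y} :: 'a \<Rightarrow> real) \<omega> \<ge> \<phi> (X t \<omega>) y"
    using A1 by blast
  have process: "\<exists>\<delta> C. lamperti_process M F X S c s2 p \<delta> C (\<lambda>x. m x 0) (\<lambda>x. \<phi> x 0)"
    if p: "p > 2" and mom: "moment_cond M F X p" for p
  proof -
    obtain \<delta> C where \<delta>: "\<delta> > 0" and C: "\<And>t. t \<ge> 1 \<Longrightarrow> AE \<omega> in M.
        nn_cond_exp M (F t) (\<lambda>\<omega>'. ennreal (\<bar>X (Suc t) \<omega>' - X t \<omega>'\<bar> powr p)) \<omega>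
          \<le> ennreal (C * (1 + X t \<omega>) powr (p - 2 - \<delta>))"
      using mom unfolding moment_cond_def by blast
    have C': "AE \<omega> in M. nn_cond_exp M (F t) (\<lambda>\<omega>'. ennreal (\<bar>X (Suc t) \<omega>' - X t \<omega>'\<bar> powr p)) \<omega>
          \<le> ennreal (\<bar>C\<bar> * (1 + X t \<omega>) powr (p - 2 - \<delta>))" if "t \<ge> 1" for t
      using C[OF that]
    proof eventually_elim
      case (elim \<omega>)
      also have "ennreal (C * (1 + X t \<omega>) powr (p - 2 - \<delta>)) \<le> ennreal (\<bar>C\<bar> * (1 + X t \<omega>) powr (p - 2 - \<delta>))"
        by (intro ennreal_leI mult_right_mono) auto
      finally show ?case .
    qed
    have "lamperti_process M F X S c s2 p \<delta> \<bar>C\<bar> (\<lambda>x. m x 0) (\<lambda>x. \<phi> x 0)"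
    proof unfold_locales
      show "S \<subseteq> {0..}" "0 \<in> S" "s2 > 0" "p > 2" "\<delta> > 0" "\<bar>C\<bar> \<ge> 0"
        using S_nonneg S_zero s2_pos p \<delta> by auto
      show "finite {x\<in>S. x \<le> b}" for b using S_locfin by blast
      show "subalgebra M (F t)" if "t \<ge> 1" for t using filt_sub that by blast
      show "sets (F s) \<subseteq> sets (F t)" if "1 \<le> s" "s \<le> t" for s t using filt_mono that by blast
      show "X t \<in> borel_measurable (F t)" if "t \<ge> 1" for t using adapted that by blast
      show "X t \<omega> \<in> S" if "t \<ge> 1" "\<omega> \<in> space M" for t \<omega> using S_valued that by blast
      show "AE \<omega> in M. X 1 \<omega> = 0" by (rule start)
      show "m x 0 \<ge> 1" "\<phi> x 0 > 0" if "x \<in> S" for x using mpos[OF that S_zero] by auto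
      show "AE \<omega> in M. real_cond_exp M (F t)
        (indicator {\<omega>'\<in>space M. X (t + m (X t \<omega>') 0) \<omega>' = 0} :: 'a \<Rightarrow> real) \<omega> \<ge> \<phi> (X t \<omega>) 0" if "t \<ge> 1" for t
        by (rule ret[OF S_zero that])
      show "\<exists>x0. \<forall>t\<ge>1. AE \<omega> in M. X t \<omega> \<ge> x0 \<longrightarrow>
               nn_cond_exp M (F t) (\<lambda>\<omega>'. ennreal ((X (Suc t) \<omega>' - X t \<omega>') ^ 2)) \<omega> < \<top> \<and>
               \<bar>real_cond_exp M (F t) (\<lambda>\<omega>'. X (Suc t) \<omega>' - X t \<omega>') \<omega> - c / X t \<omega>\<bar>
                  \<le> \<epsilon> / (X t \<omega> * ln (X t \<omega>)) \<and>
               \<bar>enn2real (nn_cond_exp M (F t) (\<lambda>\<omega>'. ennreal ((X (Suc t) \<omega>' - X t \<omega>') ^ 2)) \<omega>) - s2\<bar>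
                  \<le> \<epsilon> / ln (X t \<omega>)" if "\<epsilon> > 0" for \<epsilon>
        by (rule A2[THEN spec, THEN mp, OF that])
      show "AE \<omega> in M. nn_cond_exp M (F t) (\<lambda>\<omega>'. ennreal (\<bar>X (Suc t) \<omega>' - X t \<omega>'\<bar> powr p)) \<omega>
          \<le> ennreal (\<bar>C\<bar> * (1 + X t \<omega>) powr (p - 2 - \<delta>))" if "t \<ge> 1" for t
        by (rule C'[OF that])
    qed
    then show ?thesis by blast
  qed
  show ?thesis
  proof (intro conjI impI allI)
    fix \<epsilon> :: real assume r: "- 1 < r \<and> r \<le> 1 \<and> (\<exists>p>2. moment_cond M F X p)" and \<epsilon>: "0 < \<epsilon>"
    obtain p \<delta> C where "lamperti_process M F X S c s2 p \<delta> C (\<lambda>x. m x 0) (\<lambda>x. \<phi> x 0)"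
      using r process by blast
    then interpret lamperti_process M F X S c s2 p \<delta> C "\<lambda>x. m x 0" "\<lambda>x. \<phi> x 0" .
    have hit: "\<exists>y0>y. \<exists>T\<ge>1. prob (at_in T {y0}) > 0" for y
    proof -
      obtain y0 where y0: "y0 \<in> S" "y0 > y" using S_unbdd unfolding bdd_above_def by (meson not_le)
      have "\<exists>T\<ge>1. prob (at_in T {y0}) > 0"
        by (rule hit_from_zero[where \<phi>' = "\<lambda>x. \<phi> x y0" and m' = "\<lambda>x. m x y0"])
          (use mpos[OF S_zero y0(1)] ret[OF y0(1), of 1] in auto)
      then show ?thesis using y0 by blast
    qed
    have c: "c = - ((1 + r) - 1) * s2 / 2" using s2_pos r_def by simp
    have "AE \<omega> in M. \<forall>\<^sub>F t in sequentially.
          real t powr ((1 + r) / 2) * ln (real t) powr (- 2 - (1 + r) - \<epsilon>) \<le> real (Ncount X t \<omega>) \<and>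
          real (Ncount X t \<omega>) \<le> real t powr ((1 + r) / 2) * ln (real t) powr (1 + \<epsilon>)"
      using r by (intro Ncount_growth[OF _ _ c hit A3a A3b \<epsilon>]) auto
    moreover have "- 2 - (1 + r) - \<epsilon> = - 3 - r - \<epsilon>" by simp
    ultimately show "AE \<omega> in M. \<forall>\<^sub>F t in sequentially.
          real t powr ((1 + r) / 2) * ln (real t) powr (- 3 - r - \<epsilon>) \<le> real (Ncount X t \<omega>) \<and>
          real (Ncount X t \<omega>) \<le> real t powr ((1 + r) / 2) * ln (real t) powr (1 + \<epsilon>)"
      by (simp only:)
  next
    assume r: "r > 1 \<and> (\<exists>p>1 + r. moment_cond M F X p)"
    then obtain p where p: "p > 1 + r" "moment_cond M F X p" by blast
    then have "p > 2" using r by linarith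
    then obtain \<delta> C where "lamperti_process M F X S c s2 p \<delta> C (\<lambda>x. m x 0) (\<lambda>x. \<phi> x 0)"
      using p process by blast
    then interpret lamperti_process M F X S c s2 p \<delta> C "\<lambda>x. m x 0" "\<lambda>x. \<phi> x 0" .
    have "2 * c + s2 < 0" using r s2_pos r_def by (simp add: field_simps)
    then show "let e = (\<integral>\<^sup>+ \<omega>. ennreal_of_enat (eta X 1 \<omega>) \<partial>M) in
          0 < e \<and> e < \<infinity> \<and>
          (AE \<omega> in M. (\<lambda>t. real (Ncount X t \<omega>) / real t) \<longlonglongrightarrow> 1 / enn2real e)"
      by (rule Ncount_LLN[OF _ A3a A3b])
  qed
qed

end
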